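(* The compact Lie group $G=\mathrm{SU}(2)$ satisfies conditions (a), (b), (c): $a_{V,W}\neq 0$ for all $V,W\in\mathrm{Irr}(G,\mathbb{C})$ with $V\not\cong W$, $V^*\not\cong W$; $b_V\ne0$ for all $V$ of real or complex type; $c_V\neq 0$ for all $V$ of quaternionic type. Consequently, for generic left invariant metrics $g$ on $\mathrm{SU}(2)$ (namely, for $g$ with orthonormal bases in a residual subset of $\mathfrak{su}(2)^{\oplus 3}$), $\Delta_g$ has irreducible real eigenspaces.
   Context: For a compact Lie group $G$ with Lie algebra $\mathfrak{g}$ of dimension $n$: $\mathrm{Irr}(G,\mathbb{C})$ is a set of representatives of isomorphism classes of irreducible complex $G$-modules, $\rho_V$ the representation; $V$ is of real (resp. quaternionic) type if there is a conjugate-linear $G$-map $J:V\to V$ with $J^2=\mathrm{Id}$ (resp. $-\mathrm{Id}$), of complex type otherwise. $\mathrm{Sym}^2(\mathfrak{g})$ is the real span of $Y\cdot Z=\frac12(Y\otimes Z+Z\otimes Y)$; $D_V:\mathrm{Sym}^2(\mathfrak{g})\to\mathrm{End}(V)$ is linear with $D_V(Y\cdot Z)=-\frac12((\rho_V)_*(Y)(\rho_V)_*(Z)+(\rho_V)_*(Z)(\rho_V)_*(Y))$; $p_V(s)=\det(D_V(s)-X\mathrm{Id})\in\mathbb{C}[X]$; $a_{V,W}(s)=\mathrm{res}(p_V(s),p_W(s))$, $b_V(s)=\mathrm{res}(p_V(s),p_V(s)')$, $c_V(s)=\mathrm{res}(p_V(s),p_V(s)'')$ with $\mathrm{res}$ the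 resultant; "$\neq0$" means not identically zero as a polynomial function on $\mathrm{Sym}^2(\mathfrak{g})$. For a left invariant metric $g$, "$\Delta_g$ has irreducible real eigenspaces" means every eigenspace of the Laplacian $\Delta_g=-\mathrm{div}_g\mathrm{grad}_g$ on $C^\infty(G,\mathbb{R})$ is irreducible under the left regular action $(L(x)f)(y)=f(x^{-1}y)$. *)

theory Defs
  imports "HOL-Analysis.Analysis" "Subresultants.Resultant_Prelim" "Jordan_Normal_Form.Char_Poly"
begin

type_synonym m2 = "complex^2^2"

definition cadj :: "m2 \<Rightarrow> m2" where
  "cadj A = (\<chi> i j. cnj (vec_nth (vec_nth A j) i))"

definition SU2 :: "m2 set" where
  "SU2 = {U. U ** cadj U = Finite_Cartesian_Product.mat 1 \<and> Determinants.det U = 1}"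

definition su2 :: "m2 set" where
  "su2 = {Y. cadj Y = - Y \<and> Determinants.trace Y = 0}"

fun mpow :: "m2 \<Rightarrow> nat \<Rightarrow> m2" where
  "mpow A 0 = Finite_Cartesian_Product.mat 1"
| "mpow A (Suc n) = A ** mpow A n"

definition mexp :: "m2 \<Rightarrow> m2" where
  "mexp Y = (\<Sum>n. (1 / fact n) *\<^sub>R mpow Y n)"

definition is_rep :: "nat \<Rightarrow> (m2 \<Rightarrow> complex mat) \<Rightarrow> bool" where
  "is_rep d \<rho> \<longleftrightarrow>
     (\<forall>U\<in>SU2. \<rho> U \<in> carrier_mat d d) \<and>
     \<rho> (Finite_Cartesian_Product.mat 1) = 1\<^sub>m d \<and>
     (\<forall>U\<in>SU2. \<forall>V\<in>SU2. \<rho> (U ** V) = \<rho> U * \<rho> V) \<and>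
     (\<forall>i<d. \<forall>j<d. continuous_on SU2 (\<lambda>U. \<rho> U $$ (i, j)))"

definition csubspace :: "nat \<Rightarrow> complex Matrix.vec set \<Rightarrow> bool" where
  "csubspace d W \<longleftrightarrow> W \<subseteq> carrier_vec d \<and> 0\<^sub>v d \<in> W \<and>
     (\<forall>v\<in>W. \<forall>w\<in>W. v + w \<in> W) \<and> (\<forall>c. \<forall>v\<in>W. c \<cdot>\<^sub>v v \<in> W)"

definition is_irrep :: "nat \<Rightarrow> (m2 \<Rightarrow> complex mat) \<Rightarrow> bool" where
  "is_irrep d \<rho> \<longleftrightarrow> is_rep d \<rho> \<and> d > 0 \<and>
     (\<forall>W. csubspace d W \<and> (\<forall>U\<in>SU2. \<forall>v\<in>W. \<rho> U *\<^sub>v v \<in> W)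
          \<longrightarrow> W = {0\<^sub>v d} \<or> W = carrier_vec d)"

definition rep_iso :: "nat \<Rightarrow> (m2 \<Rightarrow> complex mat) \<Rightarrow> nat \<Rightarrow> (m2 \<Rightarrow> complex mat) \<Rightarrow> bool" where
  "rep_iso d \<rho> d' \<sigma> \<longleftrightarrow> d = d' \<and>
     (\<exists>P \<in> carrier_mat d d. invertible_mat P \<and> (\<forall>U\<in>SU2. P * \<rho> U = \<sigma> U * P))"

text \<open>Dual representation: rho*(g) = rho(g^{-1})^T; for g in SU(2), g^{-1} = cadj g.\<close>
definition dual_rep :: "(m2 \<Rightarrow> complex mat) \<Rightarrow> (m2 \<Rightarrow> complex mat)" where
  "dual_rep \<rho> = (\<lambda>U. transpose_mat (\<rho> (cadj U)))"

definition conj_linear_Gmap :: "nat \<Rightarrow> (m2 \<Rightarrow> complex mat) \<Rightarrow> (complex Matrix.vec \<Rightarrow> complex Matrix.vec) \<Rightarrow> bool" where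
  "conj_linear_Gmap d \<rho> J \<longleftrightarrow>
     (\<forall>v\<in>carrier_vec d. J v \<in> carrier_vec d) \<and>
     (\<forall>v\<in>carrier_vec d. \<forall>w\<in>carrier_vec d. J (v + w) = J v + J w) \<and>
     (\<forall>c. \<forall>v\<in>carrier_vec d. J (c \<cdot>\<^sub>v v) = cnj c \<cdot>\<^sub>v J v) \<and>
     (\<forall>U\<in>SU2. \<forall>v\<in>carrier_vec d. J (\<rho> U *\<^sub>v v) = \<rho> U *\<^sub>v J v)"

definition real_type :: "nat \<Rightarrow> (m2 \<Rightarrow> complex mat) \<Rightarrow> bool" where
  "real_type d \<rho> \<longleftrightarrow> (\<exists>J. conj_linear_Gmap d \<rho> J \<and> (\<forall>v\<in>carrier_vec d. J (J v) = v))"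

definition quaternionic_type :: "nat \<Rightarrow> (m2 \<Rightarrow> complex mat) \<Rightarrow> bool" where
  "quaternionic_type d \<rho> \<longleftrightarrow> (\<exists>J. conj_linear_Gmap d \<rho> J \<and> (\<forall>v\<in>carrier_vec d. J (J v) = - v))"

definition complex_type :: "nat \<Rightarrow> (m2 \<Rightarrow> complex mat) \<Rightarrow> bool" where
  "complex_type d \<rho> \<longleftrightarrow> \<not> real_type d \<rho> \<and> \<not> quaternionic_type d \<rho>"

definition rep_deriv :: "nat \<Rightarrow> (m2 \<Rightarrow> complex mat) \<Rightarrow> m2 \<Rightarrow> complex mat" where
  "rep_deriv d \<rho> Y = Matrix.mat d d (\<lambda>(i, j).
      vector_derivative (\<lambda>t::real. \<rho> (mexp (t *\<^sub>R Y)) $$ (i, j)) (at 0))"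

text \<open>An element s of Sym^2(su(2)) is represented as a finite sum of products Y.Z
  (a list of pairs (Y,Z) with Y, Z in su(2)); every element of Sym^2(su(2)) has this
  form, and D_V is evaluated by linearity.\<close>
definition D_op :: "nat \<Rightarrow> (m2 \<Rightarrow> complex mat) \<Rightarrow> (m2 \<times> m2) list \<Rightarrow> complex mat" where
  "D_op d \<rho> s = foldr (\<lambda>(Y, Z) A. A + ((- 1 / 2) \<cdot>\<^sub>m
       (rep_deriv d \<rho> Y * rep_deriv d \<rho> Z + rep_deriv d \<rho> Z * rep_deriv d \<rho> Y))) s (0\<^sub>m d d)"

definition p_poly :: "nat \<Rightarrow> (m2 \<Rightarrow> complex mat) \<Rightarrow> (m2 \<times> m2) list \<Rightarrow> complex poly" where
  "p_poly d \<rho> s = Determinant.det (map_mat (\<lambda>a. [:a:]) (D_op d \<rho> s) - [:0, 1:] \<cdot>\<^sub>m 1\<^sub>m d)"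

definition sym2_su2 :: "(m2 \<times> m2) list set" where
  "sym2_su2 = {s. \<forall>(Y, Z) \<in> set s. Y \<in> su2 \<and> Z \<in> su2}"

definition lvf :: "m2 \<Rightarrow> (m2 \<Rightarrow> real) \<Rightarrow> (m2 \<Rightarrow> real)" where
  "lvf X f = (\<lambda>x. vector_derivative (\<lambda>t::real. f (x ** mexp (t *\<^sub>R X))) (at 0))"

definition iter_lvf :: "m2 list \<Rightarrow> (m2 \<Rightarrow> real) \<Rightarrow> (m2 \<Rightarrow> real)" where
  "iter_lvf Xs f = foldr lvf Xs f"

definition smooth_SU2 :: "(m2 \<Rightarrow> real) \<Rightarrow> bool" where
  "smooth_SU2 f \<longleftrightarrow> (\<forall>x. x \<notin> SU2 \<longrightarrow> f x = 0) \<and>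
     (\<forall>Xs. set Xs \<subseteq> su2 \<longrightarrow>
        continuous_on SU2 (iter_lvf Xs f) \<and>
        (\<forall>X\<in>su2. \<forall>x\<in>SU2. (\<lambda>t::real. iter_lvf Xs f (x ** mexp (t *\<^sub>R X))) differentiable (at 0)))"

definition is_basis_su2 :: "m2 \<Rightarrow> m2 \<Rightarrow> m2 \<Rightarrow> bool" where
  "is_basis_su2 X1 X2 X3 \<longleftrightarrow> X1 \<in> su2 \<and> X2 \<in> su2 \<and> X3 \<in> su2 \<and>
     (\<forall>a b c :: real. a *\<^sub>R X1 + b *\<^sub>R X2 + c *\<^sub>R X3 = 0 \<longrightarrow> a = 0 \<and> b = 0 \<and> c = 0)"

text \<open>Laplacian of the left invariant metric for which (X1,X2,X3) is orthonormal.\<close>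
definition laplacian :: "m2 \<Rightarrow> m2 \<Rightarrow> m2 \<Rightarrow> (m2 \<Rightarrow> real) \<Rightarrow> (m2 \<Rightarrow> real)" where
  "laplacian X1 X2 X3 f = (\<lambda>x. if x \<in> SU2 then
      - (lvf X1 (lvf X1 f) x + lvf X2 (lvf X2 f) x + lvf X3 (lvf X3 f) x) else 0)"

definition eigenspace :: "m2 \<Rightarrow> m2 \<Rightarrow> m2 \<Rightarrow> real \<Rightarrow> (m2 \<Rightarrow> real) set" where
  "eigenspace X1 X2 X3 lam = {f. smooth_SU2 f \<and> laplacian X1 X2 X3 f = (\<lambda>x. lam * f x)}"

text \<open>Left regular action (L(g) f)(y) = f(g^{-1} y); on SU(2), g^{-1} = cadj g.\<close>
definition left_reg :: "m2 \<Rightarrow> (m2 \<Rightarrow> real) \<Rightarrow> (m2 \<Rightarrow> real)" where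
  "left_reg g f = (\<lambda>y. f (cadj g ** y))"

definition rsubspace :: "(m2 \<Rightarrow> real) set \<Rightarrow> bool" where
  "rsubspace W \<longleftrightarrow> (\<lambda>_. 0) \<in> W \<and> (\<forall>f\<in>W. \<forall>h\<in>W. (\<lambda>x. f x + h x) \<in> W) \<and>
     (\<forall>c::real. \<forall>f\<in>W. (\<lambda>x. c * f x) \<in> W)"

definition irreducible_real_eigenspaces :: "m2 \<Rightarrow> m2 \<Rightarrow> m2 \<Rightarrow> bool" where
  "irreducible_real_eigenspaces X1 X2 X3 \<longleftrightarrow>
     (\<forall>lam. eigenspace X1 X2 X3 lam \<noteq> {\<lambda>_. 0} \<longrightarrow>
        (\<forall>W. W \<subseteq> eigenspace X1 X2 X3 lam \<and> rsubspace W \<and>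
             (\<forall>g\<in>SU2. \<forall>f\<in>W. left_reg g f \<in> W)
             \<longrightarrow> W = {\<lambda>_. 0} \<or> W = eigenspace X1 X2 X3 lam))"

definition residual_in :: "'a::topological_space set \<Rightarrow> 'a set \<Rightarrow> bool" where
  "residual_in S R \<longleftrightarrow> R \<subseteq> S \<and> (\<exists>F :: nat \<Rightarrow> 'a set.
     (\<forall>n. openin (top_of_set S) (F n) \<and> S \<subseteq> closure (F n)) \<and> S \<inter> (\<Inter>n. F n) \<subseteq> R)"

end

theory Submission
  imports Defs "Subresultants.Subresultant_Gcd" "HOL-Computational_Algebra.Field_as_Ring"
    "Jordan_Normal_Form.Spectral_Radius"
begin

text \<open>
  Up to isomorphism, the irreducible representations of \<open>SU(2)\<close> are the spaces of binary forms of degree \<open>n\<close>, and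
  a Laplacian acts on the matrix coefficients of such a representation through a matrix of size \<open>n + 1\<close> with
  characteristic polynomial \<open>\<plusminus> p\<^sub>V\<close>. The round metric gives scalar matrices that tell the degrees apart, a
  metric with tridiagonal matrices gives simple roots for even \<open>n\<close>, and the degenerate tensor \<open>E\<^sub>3\<cdot>E\<^sub>3\<close> gives
  diagonal matrices with roots of multiplicity two for odd \<open>n\<close>. The resultants are polynomial functions, so they are
  all nonzero for metrics in a residual set. For such a metric the Fourier coefficients (with respect to Haar measure) of
  the functions in a given eigenspace live in a single degree \<open>n\<close>. For even \<open>n\<close> the representation is the
  complexified eigenspace; for odd \<open>n\<close> the real eigenspace is the representation itself seen as a real one,
  which is irreducible over the reals because the representation is not of real type.
\<close>

text \<open>For odd degree the invariant antilinear map has square -1 and commutes with every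
  \<open>D_op\<close>, so all eigenvalues have even multiplicity and the resultant with the first
  derivative vanishes identically. Multiplicity two is then the best possible, and this is what the
  second derivative detects. One completeness statement carries the analysis: a continuous function
  on the group that is orthogonal to all entries of all \<open>sym_rep n\<close> is zero. It yields
  the classification of the irreducibles as well as the reconstruction of an eigenfunction from its
  Fourier coefficients. It is reached by showing that orthogonality survives multiplication by
  matrix entries (explicit Clebsch-Gordan relations), hence by polynomials, after which polynomial
  approximation applies. Genericity concerns polynomial functions on triples of vectors, so a
  witness need not be a basis: triples containing zero vectors are allowed and have much simpler
  matrices. Linear independence is one more polynomial condition.\<close>

no_notation vec_nth (infixl "$" 90)
notation vec_nth (infixl "$v" 90)
hide_const (open) Finite_Cartesian_Product.mat Finite_Cartesian_Product.vec Determinants.det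
  Determinants.trace Finite_Cartesian_Product.row Finite_Cartesian_Product.column
hide_const (open) Module.smult

subsection \<open>The group and its Lie algebra as explicit matrices\<close>

lemmas c_scaleR = scaleR_conv_of_real[where 'a=complex]

abbreviation m2_one :: m2 ("\<I>") where "\<I> \<equiv> Finite_Cartesian_Product.mat 1"

lemma m2_eq_iff:
  "(A :: m2) = B \<longleftrightarrow> A $v 1 $v 1 = B $v 1 $v 1 \<and> A $v 1 $v 2 = B $v 1 $v 2 \<and>
     A $v 2 $v 1 = B $v 2 $v 1 \<and> A $v 2 $v 2 = B $v 2 $v 2"
  by (auto simp: Finite_Cartesian_Product.vec_eq_iff forall_2)

lemma m2_mult_nth: "((A :: m2) ** B) $v i $v j = A $v i $v 1 * B $v 1 $v j + A $v i $v 2 * B $v 2 $v j"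
  by (simp add: matrix_matrix_mult_def sum_2)

lemma cadj_nth [simp]: "cadj A $v i $v j = cnj (A $v j $v i)"
  by (simp add: cadj_def)

lemma m2_one_nth [simp]: "\<I> $v 1 $v 1 = 1" "\<I> $v 1 $v 2 = 0" "\<I> $v 2 $v 1 = 0" "\<I> $v 2 $v 2 = 1"
  by (auto simp: Finite_Cartesian_Product.mat_def)

lemma cadj_mult: "cadj (A ** B) = cadj B ** cadj A"
  by (simp add: m2_eq_iff m2_mult_nth mult.commute)

lemma cadj_cadj [simp]: "cadj (cadj A) = A"
  by (simp add: m2_eq_iff)

lemma cadj_one [simp]: "cadj \<I> = \<I>"
  by (simp add: m2_eq_iff)

text \<open>The inverse of a matrix of determinant 1 is its adjugate; comparing it with the adjoint
  expresses the second column through the first. The group thus becomes the unit sphere of pairs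
  (\<open>U $v 1 $v 1\<close>, \<open>U $v 2 $v 1\<close>), the form in which all later computations
  use it.\<close>

lemma SU2_iff:
  "U \<in> SU2 \<longleftrightarrow> U $v 2 $v 2 = cnj (U $v 1 $v 1) \<and> U $v 1 $v 2 = - cnj (U $v 2 $v 1) \<and>
     U $v 1 $v 1 * cnj (U $v 1 $v 1) + U $v 2 $v 1 * cnj (U $v 2 $v 1) = 1"
proof
  assume "U \<in> SU2"
  then have e: "U ** cadj U = \<I>" and d: "Determinants.det U = 1"
    by (auto simp: SU2_def)
  define a b c d' where "a = U $v 1 $v 1" and "b = U $v 1 $v 2" and "c = U $v 2 $v 1" and "d' = U $v 2 $v 2"
  have e1: "a * cnj a + b * cnj b = 1" and e2: "a * cnj c + b * cnj d' = 0"
    using e by (auto simp: m2_eq_iff m2_mult_nth a_def b_def c_def d'_def)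
  have e3: "c * cnj a + d' * cnj b = 0"
    using arg_cong[OF e2, of cnj] by (simp add: mult.commute)
  have dd: "a * d' - b * c = 1"
    using d by (simp add: Determinants.det_2 a_def b_def c_def d'_def)
  have "cnj a * (a * d' - b * c) = d' * (a * cnj a + b * cnj b) - b * (c * cnj a + d' * cnj b)"
    by (simp add: algebra_simps)
  then have 1: "d' = cnj a" using e1 e3 dd by simp
  have "cnj b * (a * d' - b * c) = a * (c * cnj a + d' * cnj b) - c * (a * cnj a + b * cnj b)"
    by (simp add: algebra_simps)
  then have "cnj b = - c" using e1 e3 dd by simp
  then have 2: "b = - cnj c" by (metis complex_cnj_cnj complex_cnj_minus)
  show "U $v 2 $v 2 = cnj (U $v 1 $v 1) \<and> U $v 1 $v 2 = - cnj (U $v 2 $v 1) \<and>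
     U $v 1 $v 1 * cnj (U $v 1 $v 1) + U $v 2 $v 1 * cnj (U $v 2 $v 1) = 1"
    using 1 2 dd by (auto simp: a_def b_def c_def d'_def mult.commute)
next
  assume "U $v 2 $v 2 = cnj (U $v 1 $v 1) \<and> U $v 1 $v 2 = - cnj (U $v 2 $v 1) \<and>
     U $v 1 $v 1 * cnj (U $v 1 $v 1) + U $v 2 $v 1 * cnj (U $v 2 $v 1) = 1"
  then show "U \<in> SU2"
    unfolding SU2_def
    by (simp add: m2_eq_iff m2_mult_nth Determinants.det_2) (simp add: algebra_simps)
qed

lemma su2_iff:
  "Y \<in> su2 \<longleftrightarrow> Y $v 2 $v 2 = - (Y $v 1 $v 1) \<and> Y $v 1 $v 2 = - cnj (Y $v 2 $v 1) \<and> Re (Y $v 1 $v 1) = 0"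
proof -
  have "(cnj z = - z) = (Re z = 0)" for z by (simp add: complex_eq_iff)
  moreover have "(cnj z = - w) = (w = - cnj z)" for z w by (auto simp: complex_eq_iff)
  ultimately show ?thesis
    by (auto simp: su2_def m2_eq_iff Determinants.trace_def sum_2 add_eq_0_iff)
qed

lemma one_SU2 [simp]: "\<I> \<in> SU2" by (simp add: SU2_iff)

lemma SU2_cadj [simp]: "U \<in> SU2 \<Longrightarrow> cadj U \<in> SU2"
  by (simp add: SU2_iff mult.commute)

lemma SU2_mult_cadj [simp]: "U \<in> SU2 \<Longrightarrow> U ** cadj U = \<I>"
  by (simp add: SU2_def)

lemma SU2_cadj_mult [simp]: "U \<in> SU2 \<Longrightarrow> cadj U ** U = \<I>"
  using SU2_mult_cadj[OF SU2_cadj] by simp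

lemma SU2_mult [simp]:
  assumes "U \<in> SU2" "V \<in> SU2"
  shows "U ** V \<in> SU2"
proof -
  have "(U ** V) ** cadj (U ** V) = U ** (V ** cadj V) ** cadj U"
    by (simp only: cadj_mult matrix_mul_assoc)
  also have "\<dots> = \<I>"
    using assms by (simp only: SU2_mult_cadj matrix_mul_rid)
  finally show ?thesis
    using assms by (simp only: SU2_def mem_Collect_eq Determinants.det_mul mult_1)
qed

lemma SU2_mult_left_iff:
  assumes "U \<in> SU2"
  shows "U ** x \<in> SU2 \<longleftrightarrow> x \<in> SU2"
proof
  assume "U ** x \<in> SU2"
  then have "cadj U ** (U ** x) \<in> SU2" using assms by simp
  then show "x \<in> SU2" using assms by (simp add: matrix_mul_assoc)
qed (use assms in simp)

lemma continuous_on_m2_nth [continuous_intros]: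
  "continuous_on S f \<Longrightarrow> continuous_on S (\<lambda>x. (f x :: m2) $v i $v j)"
  by (intro continuous_intros)

lemma continuous_on_m2I:
  fixes f :: "'a::topological_space \<Rightarrow> m2"
  assumes "\<And>i j. continuous_on S (\<lambda>x. f x $v i $v j)"
  shows "continuous_on S f"
proof -
  have "continuous_on S (\<lambda>x. \<chi> i j. f x $v i $v j)"
    by (intro continuous_on_vec_lambda assms)
  then show ?thesis by simp
qed

lemma continuous_on_m2_mult [continuous_intros]:
  fixes f g :: "'a::topological_space \<Rightarrow> m2"
  shows "continuous_on S f \<Longrightarrow> continuous_on S g \<Longrightarrow> continuous_on S (\<lambda>x. f x ** g x)"
  by (rule continuous_on_m2I, simp only: m2_mult_nth) (intro continuous_intros)

lemma continuous_on_cadj [continuous_intros]: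
  "continuous_on S f \<Longrightarrow> continuous_on S (\<lambda>x. cadj (f x))"
  by (rule continuous_on_m2I, simp only: cadj_nth) (intro continuous_intros)

lemma compact_SU2: "compact SU2"
proof -
  have "closed SU2"
  proof -
    have "SU2 = {U. U $v 2 $v 2 = cnj (U $v 1 $v 1)} \<inter> {U. U $v 1 $v 2 = - cnj (U $v 2 $v 1)} \<inter>
      {U. U $v 1 $v 1 * cnj (U $v 1 $v 1) + U $v 2 $v 1 * cnj (U $v 2 $v 1) = 1}"
      using SU2_iff by auto
    also have "closed \<dots>"
      by (intro closed_Int closed_Collect_eq continuous_intros)
    finally show ?thesis .
  qed
  moreover have "bounded SU2"
  proof (rule boundedI)
    fix U assume "U \<in> SU2"
    note U = this[unfolded SU2_iff]
    have "complex_of_real ((cmod (U $v 1 $v 1))\<^sup>2 + (cmod (U $v 2 $v 1))\<^sup>2) = 1"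
      using U by (simp only: of_real_add complex_norm_square)
    then have "(cmod (U $v 1 $v 1))\<^sup>2 + (cmod (U $v 2 $v 1))\<^sup>2 = 1"
      using of_real_eq_1_iff by blast
    then have "norm U = sqrt 2"
      using U by (simp add: norm_vec_def L2_set_def sum_2)
    then show "norm U \<le> sqrt 2" by simp
  qed
  ultimately show ?thesis by (simp add: compact_eq_bounded_closed)
qed

section \<open>The exponential map in closed form\<close>

definition rad :: "m2 \<Rightarrow> real" where
  "rad Y = sqrt ((cmod (Y $v 1 $v 1))\<^sup>2 + (cmod (Y $v 2 $v 1))\<^sup>2)"

text \<open>Cayley-Hamilton for trace 0: \<open>rad Y\<close> squared is the determinant of
  \<open>Y\<close>, and the eigenvalues are i and -i times \<open>rad Y\<close>.\<close>

lemma su2_square: "Y \<in> su2 \<Longrightarrow> Y ** Y = - (rad Y)\<^sup>2 *\<^sub>R \<I>"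
proof -
  assume "Y \<in> su2"
  note Y = this[unfolded su2_iff]
  have 1: "cnj (Y $v 1 $v 1) = - Y $v 1 $v 1" using Y by (simp add: complex_eq_iff)
  have "complex_of_real ((rad Y)\<^sup>2) = Y $v 1 $v 1 * cnj (Y $v 1 $v 1) + Y $v 2 $v 1 * cnj (Y $v 2 $v 1)"
    unfolding rad_def by (simp only: of_real_add complex_norm_square[symmetric]) simp
  then show ?thesis
    using Y by (simp add: m2_eq_iff m2_mult_nth c_scaleR 1 algebra_simps)
qed

lemma su2_rad_0: "Y \<in> su2 \<Longrightarrow> rad Y = 0 \<Longrightarrow> Y = 0"
  by (simp add: su2_iff rad_def m2_eq_iff)

lemma su2_scaleR: "Y \<in> su2 \<Longrightarrow> t *\<^sub>R Y \<in> su2"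
  by (simp add: su2_iff)

lemma rad_scaleR: "rad (t *\<^sub>R Y) = \<bar>t\<bar> * rad Y"
proof -
  have "(cmod (t *\<^sub>R Y $v 1 $v 1))\<^sup>2 + (cmod (t *\<^sub>R Y $v 2 $v 1))\<^sup>2
      = t\<^sup>2 * ((cmod (Y $v 1 $v 1))\<^sup>2 + (cmod (Y $v 2 $v 1))\<^sup>2)"
    by (simp add: power_mult_distrib distrib_left)
  then show ?thesis by (simp add: rad_def real_sqrt_mult)
qed

lemma m2_mult_scaleR:
  fixes A B :: m2
  shows "(c *\<^sub>R A) ** B = c *\<^sub>R (A ** B)" "A ** (c *\<^sub>R B) = c *\<^sub>R (A ** B)"
  by (simp_all add: m2_eq_iff m2_mult_nth algebra_simps)

lemma m2_add_mult:
  fixes A B C :: m2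
  shows "(A + B) ** C = A ** C + B ** C" "C ** (A + B) = C ** A + C ** B"
  by (simp_all add: m2_eq_iff m2_mult_nth algebra_simps)

lemma mpow_su2:
  assumes "Y \<in> su2"
  shows "mpow Y (2 * k) = ((-1) ^ k * rad Y ^ (2 * k)) *\<^sub>R \<I>"
    and "mpow Y (2 * k + 1) = ((-1) ^ k * rad Y ^ (2 * k)) *\<^sub>R Y"
proof (induction k)
  case (Suc k)
  have "mpow Y (2 * Suc k) = ((-1) ^ k * rad Y ^ (2 * k)) *\<^sub>R (Y ** Y)"
    using Suc by (simp add: m2_mult_scaleR)
  then show *: "mpow Y (2 * Suc k) = ((-1) ^ Suc k * rad Y ^ (2 * Suc k)) *\<^sub>R \<I>"
    by (simp add: su2_square[OF assms] power2_eq_square mult.assoc)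
  show "mpow Y (2 * Suc k + 1) = ((-1) ^ Suc k * rad Y ^ (2 * Suc k)) *\<^sub>R Y"
    using arg_cong[OF *, of "\<lambda>Z. Y ** Z"] by (simp only: mpow.simps m2_mult_scaleR matrix_mul_rid Suc_eq_plus1[symmetric])
qed auto

text \<open>Even powers of \<open>Y\<close> are multiples of the identity and odd powers multiples
  of \<open>Y\<close>, so the series splits into a cosine and a sine series. If
  \<open>rad Y = 0\<close>, the quotient is 0 by convention, which is harmless because then
  \<open>Y = 0\<close>.\<close>

lemma mexp_su2:
  assumes Y: "Y \<in> su2"
  shows "mexp Y = cos (rad Y) *\<^sub>R \<I> + (sin (rad Y) / rad Y) *\<^sub>R Y"
proof -
  have *: "(1 / fact n) *\<^sub>R mpow Y n
      = (cos_coeff n * rad Y ^ n) *\<^sub>R \<I> + ((sin_coeff n * rad Y ^ n) / rad Y) *\<^sub>R Y" for n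
  proof (cases "even n")
    case True
    then obtain k where k: "n = 2 * k" by blast
    have "mpow Y n = ((-1) ^ k * rad Y ^ n) *\<^sub>R \<I>"
      unfolding k by (rule mpow_su2[OF Y])
    then show ?thesis by (simp add: cos_coeff_def sin_coeff_def k)
  next
    case False
    then obtain k where k: "n = 2 * k + 1" by (blast elim: oddE)
    have "mpow Y n = ((-1) ^ k * rad Y ^ (2 * k)) *\<^sub>R Y"
      unfolding k by (rule mpow_su2[OF Y])
    then show ?thesis
      using su2_rad_0[OF Y] by (cases "rad Y = 0") (auto simp: cos_coeff_def sin_coeff_def k)
  qed
  have c: "(\<lambda>n. cos_coeff n * rad Y ^ n) sums cos (rad Y)" and s: "(\<lambda>n. sin_coeff n * rad Y ^ n) sums sin (rad Y)"
    using cos_converges[of "rad Y"] sin_converges[of "rad Y"] by auto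
  have "(\<lambda>n. (1 / fact n) *\<^sub>R mpow Y n) sums (cos (rad Y) *\<^sub>R \<I> + (sin (rad Y) / rad Y) *\<^sub>R Y)"
    unfolding * by (intro sums_add sums_scaleR_left sums_divide c s)
  then show ?thesis unfolding mexp_def by (rule sums_unique[symmetric])
qed

lemma mexp_scaleR_su2:
  assumes Y: "Y \<in> su2"
  shows "mexp (t *\<^sub>R Y) = cos (t * rad Y) *\<^sub>R \<I> + (sin (t * rad Y) / rad Y) *\<^sub>R Y"
proof -
  have "cos (\<bar>t\<bar> * rad Y) = cos (t * rad Y)" by (cases "t \<ge> 0") auto
  moreover have "sin (\<bar>t\<bar> * rad Y) / (\<bar>t\<bar> * rad Y) * t = sin (t * rad Y) / rad Y"
    by (cases "t > 0"; cases "t = 0") (auto simp: field_simps)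
  ultimately show ?thesis
    by (simp add: mexp_su2[OF su2_scaleR[OF Y]] rad_scaleR)
qed

lemma mexp_0 [simp]: "mexp 0 = \<I>"
  using mexp_scaleR_su2[of 0 0] by (simp add: su2_iff)

lemma mexp_add:
  assumes Y: "Y \<in> su2"
  shows "mexp ((s + t) *\<^sub>R Y) = mexp (s *\<^sub>R Y) ** mexp (t *\<^sub>R Y)"
proof (cases "rad Y = 0")
  case True
  then show ?thesis using su2_rad_0[OF Y] by simp
next
  case False
  let ?r = "rad Y"
  have "mexp (s *\<^sub>R Y) ** mexp (t *\<^sub>R Y) = (cos (s * ?r) * cos (t * ?r)) *\<^sub>R \<I>
     + (cos (s * ?r) * (sin (t * ?r) / ?r) + (sin (s * ?r) / ?r) * cos (t * ?r)) *\<^sub>R Y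
     + ((sin (s * ?r) / ?r) * (sin (t * ?r) / ?r)) *\<^sub>R (Y ** Y)"
    unfolding mexp_scaleR_su2[OF Y]
    by (simp only: m2_add_mult m2_mult_scaleR matrix_mul_lid matrix_mul_rid
        scaleR_add_left scaleR_scaleR scaleR_add_right) (simp add: add_ac mult_ac)
  also have "\<dots> = (cos (s * ?r) * cos (t * ?r) - sin (s * ?r) * sin (t * ?r)) *\<^sub>R \<I>
      + ((sin (s * ?r) * cos (t * ?r) + cos (s * ?r) * sin (t * ?r)) / ?r) *\<^sub>R Y"
  proof -
    have h1: "((sin (s * ?r) / ?r) * (sin (t * ?r) / ?r)) *\<^sub>R (Y ** Y) = - (sin (s * ?r) * sin (t * ?r)) *\<^sub>R \<I>"
      unfolding su2_square[OF Y] using False by (simp add: power2_eq_square)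
    have h2: "(cos (s * ?r) * (sin (t * ?r) / ?r) + (sin (s * ?r) / ?r) * cos (t * ?r))
      = (sin (s * ?r) * cos (t * ?r) + cos (s * ?r) * sin (t * ?r)) / ?r"
      by (simp add: add_divide_distrib)
    show ?thesis unfolding h1 h2 scaleR_left_diff_distrib by simp
  qed
  also have "\<dots> = mexp ((s + t) *\<^sub>R Y)"
    unfolding mexp_scaleR_su2[OF Y] distrib_right[of s t] cos_add sin_add by (rule refl)
  finally show ?thesis ..
qed

lemma mexp_SU2 [simp]:
  assumes "Y \<in> su2"
  shows "mexp (t *\<^sub>R Y) \<in> SU2"
proof -
  have adj: "cadj Y = - Y" using assms by (simp add: su2_def)
  have "cadj (mexp (t *\<^sub>R Y)) = mexp ((-t) *\<^sub>R Y)"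
  proof -
    have "cadj (a *\<^sub>R \<I> + b *\<^sub>R Y) = a *\<^sub>R \<I> + b *\<^sub>R cadj Y" for a b
      by (simp add: m2_eq_iff c_scaleR)
    then show ?thesis unfolding mexp_scaleR_su2[OF assms] adj by simp
  qed
  then have 1: "mexp (t *\<^sub>R Y) ** cadj (mexp (t *\<^sub>R Y)) = \<I>"
    using mexp_add[OF assms, of t "-t"] by simp
  note Y = assms[unfolded su2_iff]
  have 2: "mexp (t *\<^sub>R Y) $v 2 $v 2 = cnj (mexp (t *\<^sub>R Y) $v 1 $v 1)"
    "mexp (t *\<^sub>R Y) $v 1 $v 2 = - cnj (mexp (t *\<^sub>R Y) $v 2 $v 1)"
    using Y by (auto simp: mexp_scaleR_su2[OF assms] complex_eq_iff)
  have "mexp (t *\<^sub>R Y) $v 1 $v 1 * cnj (mexp (t *\<^sub>R Y) $v 1 $v 1)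
      + mexp (t *\<^sub>R Y) $v 1 $v 2 * cnj (mexp (t *\<^sub>R Y) $v 1 $v 2) = 1"
    using arg_cong[OF 1, of "\<lambda>A. A $v 1 $v 1"] by (simp add: m2_mult_nth)
  then show ?thesis using 2 by (simp add: SU2_iff mult.commute)
qed

lemma has_vector_derivative_mexp:
  assumes Y: "Y \<in> su2"
  shows "((\<lambda>t. mexp (t *\<^sub>R Y)) has_vector_derivative Y) (at 0)"
proof (cases "rad Y = 0")
  case True
  then show ?thesis using su2_rad_0[OF Y] by simp
next
  case False
  have "((\<lambda>t. cos (t * rad Y)) has_field_derivative 0) (at 0)"
    by (auto intro!: derivative_eq_intros)
  moreover have "((\<lambda>t. sin (t * rad Y) / rad Y) has_field_derivative 1) (at 0)"
    using False by (auto intro!: derivative_eq_intros)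
  ultimately have "((\<lambda>t. cos (t * rad Y) *\<^sub>R \<I> + (sin (t * rad Y) / rad Y) *\<^sub>R Y) has_vector_derivative
      (cos (0 * rad Y) *\<^sub>R 0 + 0 *\<^sub>R \<I>) + ((sin (0 * rad Y) / rad Y) *\<^sub>R 0 + 1 *\<^sub>R Y)) (at 0)"
    by (intro has_vector_derivative_add has_vector_derivative_scaleR has_vector_derivative_const)
  then show ?thesis using False by (simp add: mexp_scaleR_su2[OF Y])
qed

lemma has_vector_derivative_m2_nth:
  "(f has_vector_derivative f') F \<Longrightarrow> ((\<lambda>t. (f t :: m2) $v i $v j) has_vector_derivative f' $v i $v j) F"
  by (intro bounded_linear.has_vector_derivative[OF bounded_linear_vec_nth])

subsection \<open>The representations on binary forms\<close>

text \<open>A form of degree \<open>n\<close> in \<open>s, t\<close> is encoded by the polynomial in \<open>s\<close> that it becomes for \<open>t = 1\<close>;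
  \<open>Pp U\<close> and \<open>Qp U\<close> are the images of \<open>s\<close> and \<open>t\<close> under \<open>U\<close>.\<close>
definition Pp :: "m2 \<Rightarrow> complex poly" where "Pp U = [:U $v 2 $v 1, U $v 1 $v 1:]"
definition Qp :: "m2 \<Rightarrow> complex poly" where "Qp U = [:U $v 2 $v 2, U $v 1 $v 2:]"

text \<open>Column \<open>k\<close> lists the coefficients of the image of the monomial s^k t^(n-k).
  For \<open>n = 1\<close> this is the defining representation, with the basis in the order t,
  s.\<close>

definition sym_rep :: "nat \<Rightarrow> m2 \<Rightarrow> complex mat" where
  "sym_rep n U = Matrix.mat (Suc n) (Suc n) (\<lambda>(j, k). coeff (Pp U ^ k * Qp U ^ (n - k)) j)"

lemma sym_rep_carrier [simp]: "sym_rep n U \<in> carrier_mat (Suc n) (Suc n)"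
  by (simp add: sym_rep_def)

lemma sym_rep_dim [simp]: "dim_row (sym_rep n U) = Suc n" "dim_col (sym_rep n U) = Suc n"
  by (simp_all add: sym_rep_def)

lemma sym_rep_index [simp]:
  "j \<le> n \<Longrightarrow> k \<le> n \<Longrightarrow> sym_rep n U $$ (j, k) = coeff (Pp U ^ k * Qp U ^ (n - k)) j"
  by (simp add: sym_rep_def)

lemma coeff_linear_mult:
  "coeff ([:b, a:] * q) j = b * coeff q j + (if j = 0 then 0 else a * coeff q (j - 1))"
  by (cases j) (auto simp: coeff_pCons)

lemma degree_PQ: "degree (Pp U ^ k * Qp V ^ l) \<le> k + l"
proof -
  have "degree (Pp U ^ k) \<le> k" "degree (Qp V ^ l) \<le> l"
    using degree_power_le[of "Pp U" k] degree_power_le[of "Qp V" l]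
    by (auto simp: Pp_def Qp_def intro: order_trans split: if_splits)
  then show ?thesis by (meson add_mono degree_mult_le order_trans)
qed

text \<open>Substitution of \<open>(P, Q)\<close> into the form of degree \<open>n\<close> encoded by \<open>q\<close>.\<close>
definition homsub :: "nat \<Rightarrow> complex poly \<Rightarrow> complex poly \<Rightarrow> complex poly \<Rightarrow> complex poly" where
  "homsub n q P Q = (\<Sum>k\<le>n. smult (coeff q k) (P ^ k * Q ^ (n - k)))"

text \<open>Substitution into forms is multiplicative; one linear factor at a time is enough, since
  the columns of \<open>sym_rep\<close> are products of linear forms. The degree bound makes
  coefficient \<open>Suc n\<close> of \<open>q\<close> vanish, as \<open>q\<close> is read as a form
  of degree \<open>n\<close>.\<close>

lemma homsub_linear:
  assumes "degree q \<le> n"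
  shows "homsub (Suc n) ([:b, a:] * q) P Q = (smult a P + smult b Q) * homsub n q P Q"
proof -
  have "homsub (Suc n) ([:b, a:] * q) P Q
     = (\<Sum>k\<le>Suc n. smult (b * coeff q k) (P ^ k * Q ^ (Suc n - k)))
     + (\<Sum>k\<le>Suc n. smult (if k = 0 then 0 else a * coeff q (k - 1)) (P ^ k * Q ^ (Suc n - k)))"
    unfolding homsub_def coeff_linear_mult smult_add_left sum.distrib ..
  also have "(\<Sum>k\<le>Suc n. smult (b * coeff q k) (P ^ k * Q ^ (Suc n - k)))
     = (\<Sum>k\<le>n. smult b Q * smult (coeff q k) (P ^ k * Q ^ (n - k)))"
  proof -
    have "coeff q (Suc n) = 0" using assms by (simp add: coeff_eq_0)
    then show ?thesis by (auto intro!: sum.cong simp: Suc_diff_le mult_ac)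
  qed
  also have "(\<Sum>k\<le>Suc n. smult (if k = 0 then 0 else a * coeff q (k - 1)) (P ^ k * Q ^ (Suc n - k)))
     = (\<Sum>k\<le>n. smult a P * smult (coeff q k) (P ^ k * Q ^ (n - k)))"
    by (subst sum.atMost_Suc_shift) (auto intro!: sum.cong simp: mult_ac)
  finally show ?thesis
    unfolding homsub_def[of n] distrib_right sum_distrib_left sum.distrib by (simp only: add.commute)
qed

lemma homsub_PQ:
  "homsub (k + l) (Pp V ^ k * Qp V ^ l) P Q
     = (smult (V $v 1 $v 1) P + smult (V $v 2 $v 1) Q) ^ k * (smult (V $v 1 $v 2) P + smult (V $v 2 $v 2) Q) ^ l"
proof (induction k)
  case 0
  show ?case
  proof (induction l)
    case 0
    then show ?case by (simp add: homsub_def)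
  next
    case (Suc l)
    have "homsub (Suc l) (Qp V * (Qp V) ^ l) P Q
       = (smult (V $v 1 $v 2) P + smult (V $v 2 $v 2) Q) * homsub l (Qp V ^ l) P Q"
      using degree_PQ[of V 0 V l] unfolding Qp_def[of V] by (intro homsub_linear) (simp add: Qp_def)
    then show ?case using Suc by simp
  qed
next
  case (Suc k)
  have "homsub (Suc (k + l)) (Pp V * (Pp V ^ k * Qp V ^ l)) P Q
     = (smult (V $v 1 $v 1) P + smult (V $v 2 $v 1) Q) * homsub (k + l) (Pp V ^ k * Qp V ^ l) P Q"
    using degree_PQ[of V k V l] by (subst (1) Pp_def, intro homsub_linear)
  then show ?case using Suc by (simp add: mult_ac)
qed

text \<open>Substituting the images under \<open>U\<close> into a product of linear forms for
  \<open>V\<close> replaces each linear form by the one for \<open>U ** V\<close>; the matrix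
  product is this substitution read off coefficientwise.\<close>

lemma sym_rep_mult: "sym_rep n (U ** V) = sym_rep n U * sym_rep n V"
proof (rule eq_matI)
  fix j l assume jl: "j < dim_row (sym_rep n U * sym_rep n V)" "l < dim_col (sym_rep n U * sym_rep n V)"
  then have j: "j \<le> n" and l: "l \<le> n" by auto
  have 1: "smult (V $v 1 $v 1) (Pp U) + smult (V $v 2 $v 1) (Qp U) = Pp (U ** V)"
    "smult (V $v 1 $v 2) (Pp U) + smult (V $v 2 $v 2) (Qp U) = Qp (U ** V)"
    by (simp_all add: Pp_def Qp_def m2_mult_nth mult.commute)
  have "(sym_rep n U * sym_rep n V) $$ (j, l)
      = (\<Sum>k\<le>n. coeff (Pp U ^ k * Qp U ^ (n - k)) j * coeff (Pp V ^ l * Qp V ^ (n - l)) k)"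
    using jl by (auto simp: scalar_prod_def atLeast0LessThan lessThan_Suc_atMost intro!: sum.cong)
  also have "\<dots> = coeff (homsub (l + (n - l)) (Pp V ^ l * Qp V ^ (n - l)) (Pp U) (Qp U)) j"
    using l by (simp add: homsub_def coeff_sum mult.commute)
  also have "\<dots> = sym_rep n (U ** V) $$ (j, l)"
    unfolding homsub_PQ 1 using j l by simp
  finally show "sym_rep n (U ** V) $$ (j, l) = (sym_rep n U * sym_rep n V) $$ (j, l)" ..
qed auto

lemma monom_one_altdef: "[:0, 1:] ^ k = monom (1::complex) k"
  by (simp add: monom_altdef)

lemma sym_rep_one: "sym_rep n \<I> = 1\<^sub>m (Suc n)"
  by (rule eq_matI) (auto simp: Pp_def Qp_def monom_one_altdef[simplified])

lemma continuous_on_PQ: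
  assumes f: "continuous_on S f"
  shows "continuous_on S (\<lambda>x. coeff (Pp (f x) ^ k * Qp (f x) ^ l) j)"
proof (induction k arbitrary: j)
  case 0
  show ?case
  proof (induction l arbitrary: j)
    case (Suc l)
    have "coeff (Pp (f x) ^ 0 * Qp (f x) ^ Suc l) j = f x $v 2 $v 2 * coeff (Pp (f x) ^ 0 * Qp (f x) ^ l) j
      + (if j = 0 then 0 else f x $v 1 $v 2 * coeff (Pp (f x) ^ 0 * Qp (f x) ^ l) (j - 1))" for x
      unfolding power_Suc power_0 mult_1 by (subst Qp_def, rule coeff_linear_mult)
    then show ?case using Suc f by (cases "j = 0") (auto intro!: continuous_intros)
  qed simp
next
  case (Suc k)
  have "coeff (Pp (f x) ^ Suc k * Qp (f x) ^ l) j = f x $v 2 $v 1 * coeff (Pp (f x) ^ k * Qp (f x) ^ l) j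
      + (if j = 0 then 0 else f x $v 1 $v 1 * coeff (Pp (f x) ^ k * Qp (f x) ^ l) (j - 1))" for x
    unfolding power_Suc mult.assoc by (subst Pp_def, rule coeff_linear_mult)
  then show ?case using Suc f by (cases "j = 0") (auto intro!: continuous_intros)
qed

lemma is_rep_sym_rep: "is_rep (Suc n) (sym_rep n)"
  unfolding is_rep_def
  by (auto simp: sym_rep_one sym_rep_mult less_Suc_eq_le intro!: continuous_on_PQ continuous_intros)

section \<open>Differential of the representation on forms at the identity\<close>

definition coeffs_deriv :: "(real \<Rightarrow> complex poly) \<Rightarrow> complex poly \<Rightarrow> real \<Rightarrow> bool" where
  "coeffs_deriv p p' t \<longleftrightarrow> (\<forall>j. ((\<lambda>s. coeff (p s) j) has_vector_derivative coeff p' j) (at t))"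

lemma coeffs_deriv_mult:
  assumes "coeffs_deriv p p' t" "coeffs_deriv q q' t"
  shows "coeffs_deriv (\<lambda>s. p s * q s) (p t * q' + p' * q t) t"
  unfolding coeffs_deriv_def
proof
  fix j
  have "((\<lambda>s. coeff (p s) i) has_vector_derivative coeff p' i) (at t)"
    "((\<lambda>s. coeff (q s) i) has_vector_derivative coeff q' i) (at t)" for i
    using assms by (simp_all add: coeffs_deriv_def)
  then have "((\<lambda>s. \<Sum>i\<le>j. coeff (p s) i * coeff (q s) (j - i)) has_vector_derivative
      (\<Sum>i\<le>j. coeff (p t) i * coeff q' (j - i) + coeff p' i * coeff (q t) (j - i))) (at t)"
    by (intro has_vector_derivative_sum has_vector_derivative_mult)
  then show "((\<lambda>s. coeff (p s * q s) j) has_vector_derivative coeff (p t * q' + p' * q t) j) (at t)"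
    by (simp only: coeff_mult coeff_add sum.distrib)
qed

lemma coeffs_deriv_const: "coeffs_deriv (\<lambda>s. p) 0 t"
  by (simp add: coeffs_deriv_def)

lemma coeffs_deriv_power:
  assumes "coeffs_deriv p p' t"
  shows "coeffs_deriv (\<lambda>s. p s ^ k) (of_nat k * p t ^ (k - 1) * p') t"
proof (induction k)
  case 0
  then show ?case by (simp add: coeffs_deriv_const)
next
  case (Suc k)
  have "p t * (of_nat k * p t ^ (k - 1) * p') + p' * p t ^ k = of_nat (Suc k) * p t ^ (Suc k - 1) * p'"
    by (cases k) (auto simp: algebra_simps)
  then show ?case using coeffs_deriv_mult[OF assms Suc] by simp
qed

text \<open>Entries of the derivative of \<open>sym_rep n\<close> at the identity in direction \<open>X\<close>.\<close>
definition dent :: "nat \<Rightarrow> m2 \<Rightarrow> nat \<Rightarrow> nat \<Rightarrow> complex" where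
  "dent n X j k = (if k = Suc j then of_nat k * X $v 2 $v 1 else 0)
     + (if j = k then of_nat k * X $v 1 $v 1 + of_nat (n - k) * X $v 2 $v 2 else 0)
     + (if j = Suc k then of_nat (n - k) * X $v 1 $v 2 else 0)"

definition drep :: "nat \<Rightarrow> m2 \<Rightarrow> complex mat" where
  "drep n X = Matrix.mat (Suc n) (Suc n) (\<lambda>(j, k). dent n X j k)"

lemma drep_carrier [simp]: "drep n X \<in> carrier_mat (Suc n) (Suc n)"
  by (simp add: drep_def)

lemma drep_dim [simp]: "dim_row (drep n U) = Suc n" "dim_col (drep n U) = Suc n"
  by (simp_all add: drep_def)

lemma drep_index [simp]: "j \<le> n \<Longrightarrow> k \<le> n \<Longrightarrow> drep n X $$ (j, k) = dent n X j k"
  by (simp add: drep_def)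

text \<open>The Leibniz rule for P^k Q^(n-k) at the identity, where P is s and Q is 1: one linear
  factor at a time is replaced by its derivative, so the exponent of s changes by at most
  one.\<close>

lemma has_vector_derivative_sym_rep:
  assumes Y: "Y \<in> su2" and "j \<le> n" "k \<le> n"
  shows "((\<lambda>t. sym_rep n (mexp (t *\<^sub>R Y)) $$ (j, k)) has_vector_derivative dent n Y j k) (at 0)"
proof -
  have d: "((\<lambda>t. mexp (t *\<^sub>R Y) $v a $v b) has_vector_derivative Y $v a $v b) (at 0)" for a b
    by (intro has_vector_derivative_m2_nth has_vector_derivative_mexp Y)
  have P: "coeffs_deriv (\<lambda>t. Pp (mexp (t *\<^sub>R Y))) [:Y $v 2 $v 1, Y $v 1 $v 1:] 0"
    and Q: "coeffs_deriv (\<lambda>t. Qp (mexp (t *\<^sub>R Y))) [:Y $v 2 $v 2, Y $v 1 $v 2:] 0"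
    using d unfolding coeffs_deriv_def Pp_def Qp_def
    by (auto simp: coeff_pCons split: nat.split)
  have P0: "Pp (mexp (0 *\<^sub>R Y)) = [:0, 1:]" and Q0: "Qp (mexp (0 *\<^sub>R Y)) = 1"
    by (simp_all add: Pp_def Qp_def)
  have A: "coeffs_deriv (\<lambda>t. Pp (mexp (t *\<^sub>R Y)) ^ k * Qp (mexp (t *\<^sub>R Y)) ^ (n - k))
     ([:0, 1:] ^ k * (of_nat (n - k) * 1 ^ (n - k - 1) * [:Y $v 2 $v 2, Y $v 1 $v 2:])
      + of_nat k * [:0, 1:] ^ (k - 1) * [:Y $v 2 $v 1, Y $v 1 $v 1:] * 1 ^ (n - k)) 0"
    using coeffs_deriv_mult[OF coeffs_deriv_power[OF P, of k] coeffs_deriv_power[OF Q, of "n - k"]]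
    by (simp only: P0 Q0)
  have B: "coeff ([:0, 1:] ^ k * (of_nat (n - k) * 1 ^ (n - k - 1) * [:Y $v 2 $v 2, Y $v 1 $v 2:])
      + of_nat k * [:0, 1:] ^ (k - 1) * [:Y $v 2 $v 1, Y $v 1 $v 1:] * 1 ^ (n - k)) j = dent n Y j k"
  proof -
    have e: "[:0, 1:] ^ k * (of_nat (n - k) * 1 ^ (n - k - 1) * [:Y $v 2 $v 2, Y $v 1 $v 2:])
      + of_nat k * [:0, 1:] ^ (k - 1) * [:Y $v 2 $v 1, Y $v 1 $v 1:] * 1 ^ (n - k)
      = smult (of_nat (n - k)) (monom 1 k * [:Y $v 2 $v 2, Y $v 1 $v 2:])
      + smult (of_nat k) (monom 1 (k - 1) * [:Y $v 2 $v 1, Y $v 1 $v 1:])"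
      unfolding monom_one_altdef by (simp add: of_nat_poly mult_ac smult_add_right)
    show ?thesis unfolding e
      by (cases k; cases j) (auto simp: dent_def algebra_simps coeff_pCons split: nat.split)
  qed
  show ?thesis
    using A[unfolded coeffs_deriv_def, rule_format, of j] assms(2,3) by (simp only: B sym_rep_index)
qed

lemma rep_deriv_sym_rep: "Y \<in> su2 \<Longrightarrow> rep_deriv (Suc n) (sym_rep n) Y = drep n Y"
  unfolding rep_deriv_def
  by (rule eq_matI) (auto intro!: vector_derivative_at has_vector_derivative_sym_rep simp: less_Suc_eq_le simp del: sym_rep_index)

section \<open>Irreducibility of the representation on forms\<close>

definition diag_SU2 :: "real \<Rightarrow> m2" where
  "diag_SU2 t = (\<chi> i j. if i = j then (if i = 1 then cis t else cis (- t)) else 0)"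

lemma diag_SU2_nth [simp]:
  "diag_SU2 t $v 1 $v 1 = cis t" "diag_SU2 t $v 2 $v 2 = cis (- t)"
  "diag_SU2 t $v 1 $v 2 = 0" "diag_SU2 t $v 2 $v 1 = 0"
  by (simp_all add: diag_SU2_def)

lemma diag_SU2_mem [simp]: "diag_SU2 t \<in> SU2"
  by (simp add: SU2_iff cis_cnj cis_mult)

lemma pCons_0_power: "[:0, a:] ^ k = monom (a ^ k) k" for a :: complex
  by (induction k) (simp_all add: monom_Suc smult_monom mult.commute)

lemma sym_rep_diag:
  assumes "j \<le> n" "k \<le> n"
  shows "sym_rep n (diag_SU2 t) $$ (j, k) = (if j = k then cis (t * (2 * real k - real n)) else 0)"
proof -
  have "Qp (diag_SU2 t) ^ (n - k) = [:cis (- t) ^ (n - k):]"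
    by (induction "n - k") (auto simp: Qp_def poly_const_pow)
  then have "Pp (diag_SU2 t) ^ k * Qp (diag_SU2 t) ^ (n - k) = monom (cis t ^ k * cis (- t) ^ (n - k)) k"
    by (simp add: Pp_def pCons_0_power smult_monom mult.commute)
  also have "cis t ^ k * cis (- t) ^ (n - k) = cis (t * (2 * real k - real n))"
  proof -
    have "real k * t + real (n - k) * (- t) = t * (2 * real k - real n)"
      using assms by (simp add: of_nat_diff algebra_simps)
    then show ?thesis by (simp only: Complex.DeMoivre cis_mult)
  qed
  finally show ?thesis using assms by simp
qed

text \<open>Monomials are weight vectors of the diagonal torus with distinct weights. Subtracting
  the weight of another index \<open>k'\<close> from the torus action removes coordinate
  \<open>k'\<close> and only rescales coordinate \<open>k\<close>; this is repeated until
  \<open>k\<close> alone is left.\<close>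

lemma sym_rep_invariant_unit_vec:
  assumes W: "csubspace (Suc n) W" and inv: "\<forall>U\<in>SU2. \<forall>v\<in>W. sym_rep n U *\<^sub>v v \<in> W"
    and "w \<in> W" "k \<le> n" "w $ k \<noteq> 0"
  shows "unit_vec (Suc n) k \<in> W"
  using assms(3-5)
proof (induction "card {i. i \<le> n \<and> w $ i \<noteq> 0}" arbitrary: w rule: less_induct)
  case less
  have wc: "w \<in> carrier_vec (Suc n)" using W less.prems unfolding csubspace_def by auto
  show ?case
  proof (cases "\<exists>k'\<le>n. k' \<noteq> k \<and> w $ k' \<noteq> 0")
    case False
    have "unit_vec (Suc n) k = (1 / w $ k) \<cdot>\<^sub>v w"
      by (rule eq_vecI) (use False less.prems wc in \<open>auto simp: less_Suc_eq_le\<close>)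
    then show ?thesis using W less.prems unfolding csubspace_def by auto
  next
    case True
    then obtain k' where k': "k' \<le> n" "k' \<noteq> k" "w $ k' \<noteq> 0" by auto
    \<comment> \<open>With this angle the exponents of two weights differ by less than 2, hence by
      less than a full turn, so a single group element separates all weights.\<close>
    define t where "t = 1 / real (Suc n)"
    let ?\<mu> = "\<lambda>i. cis (t * (2 * real i - real n))"
    let ?w = "sym_rep n (diag_SU2 t) *\<^sub>v w + (- ?\<mu> k') \<cdot>\<^sub>v w"
    have \<mu>: "?\<mu> k \<noteq> ?\<mu> k'"
    proof
      assume eq: "?\<mu> k = ?\<mu> k'"
      have "\<bar>2 * t * (real k - real k')\<bar> < 2 * pi"
      proof -
        have "\<bar>real k - real k'\<bar> \<le> real n" using k' less.prems by auto
        then have "2 * t * \<bar>real k - real k'\<bar> \<le> 2 * t * real n"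
          unfolding t_def by (intro mult_left_mono) auto
        also have "\<dots> < 2" unfolding t_def by (simp add: field_simps)
        finally have "2 * t * \<bar>real k - real k'\<bar> < 2" .
        moreover have "t > 0" by (simp add: t_def)
        ultimately have "\<bar>2 * t * (real k - real k')\<bar> < 2" by (simp only: abs_mult)
        then show ?thesis using pi_gt3 by linarith
      qed
      moreover define a b where "a = t * (2 * real k - real n)" and "b = t * (2 * real k' - real n)"
      have ab: "a - b = 2 * t * (real k - real k')" by (simp add: a_def b_def algebra_simps)
      ultimately have "\<bar>a - b\<bar> < 2 * pi" by simp
      moreover have "exp (\<i> * complex_of_real a) = exp (\<i> * complex_of_real b)"
        using eq unfolding a_def b_def cis_conv_exp .
      ultimately have "\<i> * complex_of_real a = \<i> * complex_of_real b"
        using exp_complex_eqI[of "\<i> * complex_of_real a" "\<i> * complex_of_real b"] by simp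
      then have "a = b" by simp
      then show False using ab k' by (simp add: t_def)
    qed
    have W': "?w \<in> W" using W inv less.prems unfolding csubspace_def by auto
    have w_i: "?w $ i = (?\<mu> i - ?\<mu> k') * w $ i" if "i \<le> n" for i
    proof -
      have "?w $ i = (sym_rep n (diag_SU2 t) *\<^sub>v w) $ i + (- ?\<mu> k') * w $ i"
        using that wc by simp
      also have "(sym_rep n (diag_SU2 t) *\<^sub>v w) $ i = (\<Sum>j\<in>{0..<Suc n}. (if i = j then ?\<mu> j else 0) * w $ j)"
        using that wc by (simp add: scalar_prod_def sym_rep_diag del: sym_rep_index)
      also have "\<dots> = (\<Sum>j\<in>{0..<Suc n}. if i = j then ?\<mu> j * w $ j else 0)"
        by (intro sum.cong) auto
      also have "\<dots> = ?\<mu> i * w $ i" using that by (subst sum.delta') auto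
      finally show ?thesis by (simp only: left_diff_distrib) simp
    qed
    have "card {i. i \<le> n \<and> ?w $ i \<noteq> 0} < card {i. i \<le> n \<and> w $ i \<noteq> 0}"
    proof (rule psubset_card_mono)
      have "i \<in> {i. i \<le> n \<and> w $ i \<noteq> 0}" if "i \<in> {i. i \<le> n \<and> ?w $ i \<noteq> 0}" for i
        using that w_i[of i] by (simp del: index_add_vec index_mult_mat_vec)
      moreover have "k' \<in> {i. i \<le> n \<and> w $ i \<noteq> 0}" "k' \<notin> {i. i \<le> n \<and> ?w $ i \<noteq> 0}"
        using k' w_i[of k'] by (simp_all del: index_add_vec index_mult_mat_vec)
      ultimately show "{i. i \<le> n \<and> ?w $ i \<noteq> 0} \<subset> {i. i \<le> n \<and> w $ i \<noteq> 0}" by blast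
    qed simp
    moreover have "?w $ k \<noteq> 0" using w_i[OF \<open>k \<le> n\<close>] \<mu> less.prems by simp
    ultimately show ?thesis using less.hyps W' less.prems by blast
  qed
qed

text \<open>A rotation by 45 degrees. It sends s and t to multiples of s + t and t - s, so powers of
  the images have no vanishing coefficient.\<close>

definition mix_SU2 :: m2 where
  "mix_SU2 = (\<chi> i j. if i = 1 \<and> j = 2 then - complex_of_real (1 / sqrt 2) else complex_of_real (1 / sqrt 2))"

lemma mix_SU2_nth [simp]:
  "mix_SU2 $v 1 $v 1 = of_real (1 / sqrt 2)" "mix_SU2 $v 1 $v 2 = - of_real (1 / sqrt 2)"
  "mix_SU2 $v 2 $v 1 = of_real (1 / sqrt 2)" "mix_SU2 $v 2 $v 2 = of_real (1 / sqrt 2)"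
  by (simp_all add: mix_SU2_def)

lemma mix_SU2_mem [simp]: "mix_SU2 \<in> SU2"
proof -
  have "complex_of_real (1 / sqrt 2) * complex_of_real (1 / sqrt 2) + of_real (1 / sqrt 2) * of_real (1 / sqrt 2) = 1"
    unfolding of_real_mult[symmetric] of_real_add[symmetric] by simp
  then show ?thesis unfolding SU2_iff mix_SU2_nth complex_cnj_complex_of_real by simp
qed

text \<open>A nonzero invariant subspace contains some monomial. \<open>mix_SU2\<close> maps it to a
  form whose coefficient of s^n is not 0, so s^n lies in the subspace; and s^n goes to a multiple of
  (s + t)^n, in which every monomial occurs.\<close>

lemma is_irrep_sym_rep: "is_irrep (Suc n) (sym_rep n)"
  unfolding is_irrep_def
proof (intro conjI allI impI, goal_cases)
  case (3 W)
  then have W: "csubspace (Suc n) W" and inv: "\<forall>U\<in>SU2. \<forall>v\<in>W. sym_rep n U *\<^sub>v v \<in> W" by auto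
  note unit = sym_rep_invariant_unit_vec[OF W inv]
  have Wc: "W \<subseteq> carrier_vec (Suc n)" and W0: "0\<^sub>v (Suc n) \<in> W"
    and Wa: "\<And>v w. v \<in> W \<Longrightarrow> w \<in> W \<Longrightarrow> v + w \<in> W" and Ws: "\<And>c v. v \<in> W \<Longrightarrow> c \<cdot>\<^sub>v v \<in> W"
    using W unfolding csubspace_def by auto
  let ?c = "complex_of_real (1 / sqrt 2)"
  have c0: "?c \<noteq> 0" by simp
  have col: "(sym_rep n U *\<^sub>v unit_vec (Suc n) k) $ j = coeff (Pp U ^ k * Qp U ^ (n - k)) j"
    if "j \<le> n" "k \<le> n" for U j k
    using that by (simp add: sym_rep_def)
  show ?case
  proof (cases "W = {0\<^sub>v (Suc n)}")
    case False
    then obtain w where w: "w \<in> W" "w \<noteq> 0\<^sub>v (Suc n)" using W0 by auto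
    then have "\<exists>k\<le>n. w $ k \<noteq> 0"
      using Wc by (metis (no_types, lifting) carrier_vecD eq_vecI index_zero_vec less_Suc_eq_le subsetD)
    then obtain k where k: "k \<le> n" "unit_vec (Suc n) k \<in> W" using unit w by blast
    have "coeff (Pp mix_SU2 ^ k * Qp mix_SU2 ^ (n - k)) n \<noteq> 0"
    proof -
      have d: "degree (Pp mix_SU2 ^ k) = k" "degree (Qp mix_SU2 ^ (n - k)) = n - k"
        using c0 by (simp_all add: Pp_def Qp_def degree_power_eq)
      have "coeff (Pp mix_SU2 ^ k * Qp mix_SU2 ^ (n - k)) (degree (Pp mix_SU2 ^ k) + degree (Qp mix_SU2 ^ (n - k)))
         = lead_coeff (Pp mix_SU2 ^ k) * lead_coeff (Qp mix_SU2 ^ (n - k))"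
        by (rule coeff_mult_degree_sum)
      moreover have "lead_coeff (Pp mix_SU2 ^ k) * lead_coeff (Qp mix_SU2 ^ (n - k)) \<noteq> 0"
        unfolding lead_coeff_power using c0 by (simp add: Pp_def Qp_def)
      ultimately show ?thesis using k unfolding d by simp
    qed
    then have n: "unit_vec (Suc n) n \<in> W"
      using k col[of n k mix_SU2] by (intro unit[of "sym_rep n mix_SU2 *\<^sub>v unit_vec (Suc n) k"]) (use inv in auto)
    have "coeff (Pp mix_SU2 ^ n * Qp mix_SU2 ^ (n - n)) j \<noteq> 0" if "j \<le> n" for j
    proof -
      have "Pp mix_SU2 ^ n * Qp mix_SU2 ^ (n - n) = smult (?c ^ n) ([:1, 1:] ^ n)"
        unfolding smult_power[symmetric] Pp_def by simp
      moreover have "coeff ([:1, 1 :: complex:] ^ n) j = of_nat (n choose j)"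
        using that by (subst coeff_linear_poly_power) simp_all
      ultimately show ?thesis using c0 that by (simp only: coeff_smult) simp
    qed
    then have e: "unit_vec (Suc n) j \<in> W" if "j \<le> n" for j
      using n col[of j n mix_SU2] that inv
      by (intro unit[of "sym_rep n mix_SU2 *\<^sub>v unit_vec (Suc n) n"]) auto
    have "v \<in> W" if v: "v \<in> carrier_vec (Suc n)" for v
    proof -
      have "vec (Suc n) (\<lambda>i. if i < m then v $ i else 0) \<in> W" if "m \<le> Suc n" for m
        using that
      proof (induction m)
        case 0
        then show ?case using W0 by (simp add: zero_vec_def)
      next
        case (Suc m)
        have "vec (Suc n) (\<lambda>i. if i < Suc m then v $ i else 0)
            = vec (Suc n) (\<lambda>i. if i < m then v $ i else 0) + v $ m \<cdot>\<^sub>v unit_vec (Suc n) m"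
          using Suc.prems by (intro eq_vecI) (auto simp: less_Suc_eq unit_vec_def)
        then show ?case using Suc e[of m] Wa Ws by auto
      qed
      from this[of "Suc n"] have "vec (Suc n) (\<lambda>i. if i < Suc n then v $ i else 0) \<in> W" by simp
      also have "vec (Suc n) (\<lambda>i. if i < Suc n then v $ i else 0) = v"
        using v by (intro eq_vecI) auto
      finally show ?thesis .
    qed
    then show ?thesis using Wc by auto
  qed simp
qed (simp_all add: is_rep_sym_rep)

section \<open>The invariant antilinear map on forms\<close>

definition J0 :: m2 where
  "J0 = (\<chi> i j. if i = 1 \<and> j = 2 then - 1 else if i = 2 \<and> j = 1 then 1 else 0)"

lemma J0_nth [simp]: "J0 $v 1 $v 1 = 0" "J0 $v 1 $v 2 = - 1" "J0 $v 2 $v 1 = 1" "J0 $v 2 $v 2 = 0"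
  by (simp_all add: J0_def)

definition cnj_m2 :: "m2 \<Rightarrow> m2" where "cnj_m2 U = (\<chi> i j. cnj (U $v i $v j))"

lemma cnj_m2_nth [simp]: "cnj_m2 U $v i $v j = cnj (U $v i $v j)"
  by (simp add: cnj_m2_def)

text \<open>Entrywise conjugation on the group is conjugation by the quaternion unit
  \<open>J0\<close>. Hence complex conjugation followed by \<open>J0\<close> commutes with the
  group, first on pairs and then on forms of any degree.\<close>

lemma J0_cnj: "U \<in> SU2 \<Longrightarrow> J0 ** cnj_m2 U = U ** J0"
  by (simp add: SU2_iff m2_eq_iff m2_mult_nth)

lemma cnj_coeff_PQ: "cnj (coeff (Pp U ^ k * Qp U ^ l) j) = coeff (Pp (cnj_m2 U) ^ k * Qp (cnj_m2 U) ^ l) j"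
proof -
  interpret cnj: comm_ring_hom cnj by standard auto
  interpret mp: map_poly_comm_ring_hom cnj ..
  have "map_poly cnj (Pp U ^ k * Qp U ^ l) = map_poly cnj (Pp U) ^ k * map_poly cnj (Qp U) ^ l"
    by (simp only: mp.hom_mult mp.hom_power)
  also have "map_poly cnj (Pp U) = Pp (cnj_m2 U)"
    by (rule poly_eqI) (simp add: Pp_def coeff_map_poly coeff_pCons split: nat.split)
  also have "map_poly cnj (Qp U) = Qp (cnj_m2 U)"
    by (rule poly_eqI) (simp add: Qp_def coeff_map_poly coeff_pCons split: nat.split)
  finally show ?thesis by (metis complex_cnj_zero coeff_map_poly)
qed

lemma cnj_sym_rep: "map_mat cnj (sym_rep n U) = sym_rep n (cnj_m2 U)"
  by (rule eq_matI) (auto simp: cnj_coeff_PQ)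

lemma cnj_mat_mult_vec:
  "A \<in> carrier_mat n m \<Longrightarrow> v \<in> carrier_vec m \<Longrightarrow> map_vec cnj (A *\<^sub>v v) = map_mat cnj A *\<^sub>v map_vec cnj v"
  by (rule eq_vecI) (auto simp: scalar_prod_def)

definition conj_sym :: "nat \<Rightarrow> complex Matrix.vec \<Rightarrow> complex Matrix.vec" where
  "conj_sym n v = sym_rep n J0 *\<^sub>v map_vec cnj v"

lemma conj_sym_carrier [simp]: "conj_sym n v \<in> carrier_vec (Suc n)"
  unfolding conj_sym_def carrier_vec_def by simp

lemma conj_linear_conj_sym: "conj_linear_Gmap (Suc n) (sym_rep n) (conj_sym n)"
  unfolding conj_linear_Gmap_def
proof (intro conjI ballI allI, goal_cases)
  case (2 v w)
  have "map_vec cnj (v + w) = map_vec cnj v + map_vec cnj w"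
    using 2 by (intro eq_vecI) auto
  then show ?case using 2 by (simp add: conj_sym_def mult_add_distrib_mat_vec[of _ "Suc n" "Suc n"])
next
  case (3 c v)
  have "map_vec cnj (c \<cdot>\<^sub>v v) = cnj c \<cdot>\<^sub>v map_vec cnj v"
    using 3 by (intro eq_vecI) auto
  then show ?case using 3 by (simp add: conj_sym_def mult_mat_vec[of _ "Suc n" "Suc n"])
next
  case (4 U v)
  have "conj_sym n (sym_rep n U *\<^sub>v v) = sym_rep n J0 *\<^sub>v (sym_rep n (cnj_m2 U) *\<^sub>v map_vec cnj v)"
    using 4 by (simp add: conj_sym_def cnj_mat_mult_vec[of _ "Suc n" "Suc n"] cnj_sym_rep)
  also have "\<dots> = sym_rep n (J0 ** cnj_m2 U) *\<^sub>v map_vec cnj v"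
    using 4 by (simp add: sym_rep_mult assoc_mult_mat_vec[of _ "Suc n" "Suc n" _ "Suc n"])
  also have "\<dots> = sym_rep n U *\<^sub>v conj_sym n v"
    using 4 by (simp add: conj_sym_def J0_cnj sym_rep_mult assoc_mult_mat_vec[of _ "Suc n" "Suc n" _ "Suc n"])
  finally show ?case .
qed simp

lemma sym_rep_minus_one: "sym_rep n (J0 ** J0) = (-1) ^ n \<cdot>\<^sub>m 1\<^sub>m (Suc n)"
proof (rule eq_matI)
  fix j k assume "j < dim_row ((-1) ^ n \<cdot>\<^sub>m 1\<^sub>m (Suc n) :: complex mat)" "k < dim_col ((-1) ^ n \<cdot>\<^sub>m 1\<^sub>m (Suc n) :: complex mat)"
  then have jk: "j \<le> n" "k \<le> n" by auto
  have "Qp (J0 ** J0) ^ (n - k) = [:(-1) ^ (n - k):]"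
    by (simp add: Qp_def m2_mult_nth poly_const_pow)
  moreover have "Pp (J0 ** J0) ^ k = monom ((-1) ^ k) k"
    by (simp add: Pp_def m2_mult_nth pCons_0_power)
  ultimately have "Pp (J0 ** J0) ^ k * Qp (J0 ** J0) ^ (n - k) = monom ((-1) ^ (n - k) * (-1) ^ k) k"
    by (simp add: smult_monom)
  also have "(-1) ^ (n - k) * (-1) ^ k = ((-1) ^ n :: complex)"
    using jk by (simp flip: power_add)
  finally show "sym_rep n (J0 ** J0) $$ (j, k) = ((-1) ^ n \<cdot>\<^sub>m 1\<^sub>m (Suc n)) $$ (j, k)"
    using jk by simp
qed auto

text \<open>\<open>J0\<close> has real entries and its square is minus the identity, which acts on
  forms of degree \<open>n\<close> by the sign (-1)^n. So the parity of the degree decides between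
  real and quaternionic type.\<close>

lemma conj_sym_twice:
  assumes "v \<in> carrier_vec (Suc n)"
  shows "conj_sym n (conj_sym n v) = (-1) ^ n \<cdot>\<^sub>v v"
proof -
  have J: "cnj_m2 J0 = J0" by (simp add: m2_eq_iff)
  have "map_vec cnj (map_vec cnj v) = v" by (rule eq_vecI) auto
  then have "conj_sym n (conj_sym n v) = sym_rep n (J0 ** J0) *\<^sub>v v"
    using assms by (simp add: conj_sym_def cnj_mat_mult_vec[of _ "Suc n" "Suc n"] cnj_sym_rep J sym_rep_mult
        assoc_mult_mat_vec[of _ "Suc n" "Suc n" _ "Suc n"])
  then show ?thesis using assms unfolding sym_rep_minus_one
    by (intro eq_vecI) auto
qed

subsection \<open>Invariant measure\<close>

text \<open>The quaternions as a real algebra of matrices: the shape of \<open>SU2_iff\<close>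
  without the norm condition. Left and right multiplication by group elements thereby become linear
  maps of Euclidean 4-space.\<close>

definition quat :: "real^4 \<Rightarrow> m2" where
  "quat x = (\<chi> i j. if i = 1 then (if j = 1 then Complex (x $v 1) (x $v 2) else Complex (- (x $v 3)) (x $v 4))
                     else (if j = 1 then Complex (x $v 3) (x $v 4) else Complex (x $v 1) (- (x $v 2))))"

lemma quat_nth [simp]:
  "quat x $v 1 $v 1 = Complex (x $v 1) (x $v 2)" "quat x $v 1 $v 2 = Complex (- (x $v 3)) (x $v 4)"
  "quat x $v 2 $v 1 = Complex (x $v 3) (x $v 4)" "quat x $v 2 $v 2 = Complex (x $v 1) (- (x $v 2))"
  by (simp_all add: quat_def)

definition unquat :: "m2 \<Rightarrow> real^4" where
  "unquat A = (\<chi> i. if i = 1 then Re (A $v 1 $v 1) else if i = 2 then Im (A $v 1 $v 1)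
      else if i = 3 then Re (A $v 2 $v 1) else Im (A $v 2 $v 1))"

lemma unquat_nth [simp]:
  "unquat A $v 1 = Re (A $v 1 $v 1)" "unquat A $v 2 = Im (A $v 1 $v 1)"
  "unquat A $v 3 = Re (A $v 2 $v 1)" "unquat A $v 4 = Im (A $v 2 $v 1)"
  by (simp_all add: unquat_def)

lemma quat_unquat: "A $v 2 $v 2 = cnj (A $v 1 $v 1) \<Longrightarrow> A $v 1 $v 2 = - cnj (A $v 2 $v 1) \<Longrightarrow> quat (unquat A) = A"
  by (simp add: m2_eq_iff complex_eq_iff)

lemma norm_quat: "(norm x)\<^sup>2 = (cmod (quat x $v 1 $v 1))\<^sup>2 + (cmod (quat x $v 2 $v 1))\<^sup>2"
  by (simp add: norm_vec_def L2_set_def sum_4 cmod_power2 real_sqrt_pow2)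

lemma det_quat: "Determinants.det (quat x) = of_real ((norm x)\<^sup>2)"
  unfolding norm_quat by (simp add: Determinants.det_2 complex_eq_iff cmod_power2) (simp add: power2_eq_square)

lemma quat_SU2: "quat x \<in> SU2 \<longleftrightarrow> norm x = 1"
proof -
  have "quat x \<in> SU2 \<longleftrightarrow> complex_of_real ((norm x)\<^sup>2) = 1"
    unfolding norm_quat of_real_add complex_norm_square SU2_iff by (auto simp: complex_eq_iff)
  also have "\<dots> \<longleftrightarrow> (norm x)\<^sup>2 = 1" by (rule of_real_eq_1_iff)
  also have "\<dots> \<longleftrightarrow> norm x = 1" using power2_eq_1_iff[of "norm x"] norm_ge_zero[of x] by auto
  finally show ?thesis .
qed

lemma quat_scaleR: "quat (c *\<^sub>R x) = c *\<^sub>R quat x"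
  by (simp add: m2_eq_iff complex_eq_iff)

lemma quat_mult_left: "U \<in> SU2 \<Longrightarrow> quat (unquat (U ** quat x)) = U ** quat x"
  by (rule quat_unquat; simp add: SU2_iff m2_mult_nth; simp add: complex_eq_iff)

lemma quat_mult_right: "U \<in> SU2 \<Longrightarrow> quat (unquat (quat x ** U)) = quat x ** U"
  by (rule quat_unquat; simp add: SU2_iff m2_mult_nth; simp add: complex_eq_iff)

lemma quat_add: "quat (x + y) = quat x + quat y"
  by (simp add: m2_eq_iff complex_eq_iff)

lemma unquat_add: "unquat (A + B) = unquat A + unquat B"
  and unquat_scaleR: "unquat (c *\<^sub>R A) = c *\<^sub>R unquat A"
  by (simp_all add: Finite_Cartesian_Product.vec_eq_iff forall_4)

lemma linear_quat_mult:
  "linear (\<lambda>x. unquat (U ** quat x))" "linear (\<lambda>x. unquat (quat x ** U))"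
  by (rule linearI; simp only: quat_add quat_scaleR m2_add_mult m2_mult_scaleR unquat_add unquat_scaleR)+

lemma det_SU2: "U \<in> SU2 \<Longrightarrow> Determinants.det U = 1"
  unfolding SU2_def by blast

text \<open>The determinant of a quaternion matrix is its squared norm, and determinants
  multiply.\<close>

lemma orthogonal_quat_mult:
  assumes "U \<in> SU2"
  shows "orthogonal_transformation (\<lambda>x. unquat (U ** quat x))"
    and "orthogonal_transformation (\<lambda>x. unquat (quat x ** U))"
proof -
  have "complex_of_real ((norm (unquat (U ** quat x)))\<^sup>2) = of_real ((norm x)\<^sup>2)" for x
    unfolding det_quat[symmetric] quat_mult_left[OF assms] Determinants.det_mul det_SU2[OF assms] by simp
  then have "(norm (unquat (U ** quat x)))\<^sup>2 = (norm x)\<^sup>2" for x by (simp only: of_real_eq_iff)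
  then have "norm (unquat (U ** quat x)) = norm x" for x by (rule power2_eq_imp_eq) simp_all
  then show "orthogonal_transformation (\<lambda>x. unquat (U ** quat x))"
    unfolding orthogonal_transformation using linear_quat_mult by blast
  have "complex_of_real ((norm (unquat (quat x ** U)))\<^sup>2) = of_real ((norm x)\<^sup>2)" for x
    unfolding det_quat[symmetric] quat_mult_right[OF assms] Determinants.det_mul det_SU2[OF assms] by simp
  then have "(norm (unquat (quat x ** U)))\<^sup>2 = (norm x)\<^sup>2" for x by (simp only: of_real_eq_iff)
  then have "norm (unquat (quat x ** U)) = norm x" for x by (rule power2_eq_imp_eq) simp_all
  then show "orthogonal_transformation (\<lambda>x. unquat (quat x ** U))"
    unfolding orthogonal_transformation using linear_quat_mult by blast
qed

text \<open>The origin is removed so that radial projection is continuous on the whole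
  domain.\<close>

abbreviation pball :: "(real^4) set" where "pball \<equiv> ball 0 1 - {0}"

definition ballM :: "(real^4) measure" where "ballM = restrict_space lborel pball"

lemma space_ballM [simp]: "space ballM = pball"
  by (simp add: ballM_def space_restrict_space)

lemma sets_ballM: "A \<in> sets ballM \<longleftrightarrow> A \<in> sets borel \<and> A \<subseteq> pball"
  by (auto simp: ballM_def sets_restrict_space_iff)

lemma emeasure_ballM: "A \<in> sets ballM \<Longrightarrow> emeasure ballM A = emeasure lborel A"
  unfolding sets_ballM by (simp add: ballM_def emeasure_restrict_space)

lemma emeasure_ballM_finite: "A \<in> sets ballM \<Longrightarrow> emeasure ballM A < \<infinity>"
proof -
  assume A: "A \<in> sets ballM"
  then have "emeasure ballM A \<le> emeasure lborel (ball (0::real^4) 1)"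
    by (subst emeasure_ballM[OF A]) (intro emeasure_mono, auto simp: sets_ballM)
  also have "\<dots> < \<infinity>" using emeasure_lborel_ball_finite[of "0::real^4" 1] by simp
  finally show ?thesis .
qed

lemma distr_ballM_orthogonal:
  assumes f: "orthogonal_transformation (f :: real^4 \<Rightarrow> real^4)"
  shows "f \<in> measurable ballM ballM" and "distr ballM ballM f = ballM"
proof -
  have lin: "linear f" and nf: "\<And>x. norm (f x) = norm x"
    using f by (auto simp: orthogonal_transformation)
  have fb: "f x \<in> pball \<longleftrightarrow> x \<in> pball" for x
    using nf[of x] by (metis DiffD1 DiffD2 DiffI dist_0_norm mem_ball norm_eq_zero singletonD singletonI)
  have fm: "f \<in> borel_measurable borel"
    using lin by (intro borel_measurable_continuous_onI linear_continuous_on) (simp add: linear_linear)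
  show m: "f \<in> measurable ballM ballM"
    unfolding ballM_def
    by (rule measurable_restrict_space3) (use fm fb in auto)
  show "distr ballM ballM f = ballM"
  proof (rule measure_eqI)
    fix A assume "A \<in> sets (distr ballM ballM f)"
    then have A: "A \<in> sets ballM" by simp
    let ?S = "f -` A \<inter> space ballM"
    have S: "?S \<in> sets ballM" using m A by (rule measurable_sets)
    have SA: "f ` ?S = A"
    proof (intro equalityI subsetI)
      fix y assume y: "y \<in> A"
      obtain x where "y = f x" using orthogonal_transformation_surj[OF f] by (metis surjD)
      then show "y \<in> f ` ?S" using y A fb[of x] by (auto simp: sets_ballM)
    qed auto
    have lm: "X \<in> lmeasurable" "emeasure ballM X = ennreal (measure lebesgue X)" if "X \<in> sets ballM" for X
    proof -
      have b: "X \<in> sets borel" using that by (simp add: sets_ballM)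
      have e: "emeasure lebesgue X = emeasure ballM X"
        using that b by (simp add: emeasure_ballM)
      show "X \<in> lmeasurable"
        using b emeasure_ballM_finite[OF that] unfolding e[symmetric] by (intro fmeasurableI) auto
      then show "emeasure ballM X = ennreal (measure lebesgue X)"
        unfolding e[symmetric] by (simp add: emeasure_eq_measure2)
    qed
    have "emeasure (distr ballM ballM f) A = emeasure ballM ?S"
      using m A by (simp add: emeasure_distr)
    also have "\<dots> = ennreal (measure lebesgue (f ` ?S))"
      using lm[OF S] measure_orthogonal_image[OF f, of ?S] by simp
    also have "\<dots> = emeasure ballM A" unfolding SA using lm[OF A] by simp
    finally show "emeasure (distr ballM ballM f) A = emeasure ballM A" .
  qed simp
qed

abbreviation SU2M :: "m2 measure" where "SU2M \<equiv> restrict_space borel SU2"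

definition sphere_proj :: "real^4 \<Rightarrow> m2" where "sphere_proj x = quat (x /\<^sub>R norm x)"

lemma continuous_on_quat: "continuous_on UNIV quat"
proof -
  have "linear quat" by (rule linearI) (simp_all add: m2_eq_iff complex_eq_iff)
  then show ?thesis by (simp add: linear_continuous_on linear_linear)
qed

lemma continuous_on_sphere_proj: "continuous_on pball sphere_proj"
  unfolding sphere_proj_def
  by (intro continuous_on_compose2[OF continuous_on_quat] continuous_intros) auto

lemma sphere_proj_SU2: "x \<in> pball \<Longrightarrow> sphere_proj x \<in> SU2"
  by (simp add: sphere_proj_def quat_SU2)

lemma sphere_proj_measurable [measurable]: "sphere_proj \<in> measurable ballM SU2M"
proof (rule measurable_restrict_space2)
  show "sphere_proj \<in> space ballM \<rightarrow> SU2" using sphere_proj_SU2 by simp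
  have "sphere_proj \<in> borel_measurable (restrict_space borel pball)"
    by (rule borel_measurable_continuous_on_restrict[OF continuous_on_sphere_proj])
  moreover have "measurable (restrict_space borel pball) (borel :: m2 measure) = measurable ballM borel"
    by (rule measurable_cong_sets) (auto simp: ballM_def sets_restrict_space)
  ultimately show "sphere_proj \<in> borel_measurable ballM" by (simp only:)
qed

text \<open>Radial projection of Lebesgue measure on the ball of quaternions of norm less than 1, not normalised. It is
  invariant because multiplication by a unit quaternion is an orthogonal map of \<open>\<real>\<^sup>4\<close>.\<close>
definition haar :: "m2 measure" where "haar = distr ballM SU2M sphere_proj"

lemma space_haar [simp]: "space haar = SU2"
  by (simp add: haar_def space_restrict_space)

lemma sets_haar [measurable_cong]: "sets haar = sets SU2M"
  by (simp add: haar_def)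

lemma finite_measure_haar: "finite_measure haar"
  unfolding haar_def using emeasure_ballM_finite[of pball]
  by (intro finite_measure.finite_measure_distr finite_measureI sphere_proj_measurable) (auto simp: sets_ballM)

interpretation haar: finite_measure haar by (rule finite_measure_haar)

lemma haar_measurable: "continuous_on SU2 f \<Longrightarrow> f \<in> borel_measurable haar"
  using borel_measurable_continuous_on_restrict[of SU2 f] measurable_cong_sets[OF sets_haar refl] by blast

lemma haar_integrable:
  fixes f :: "m2 \<Rightarrow> 'b::{banach, second_countable_topology}"
  assumes "continuous_on SU2 f"
  shows "integrable haar f"
proof -
  have "bounded (f ` SU2)"
    using compact_continuous_image[OF assms compact_SU2] by (rule compact_imp_bounded)
  then obtain B where "\<And>x. x \<in> SU2 \<Longrightarrow> norm (f x) \<le> B" unfolding bounded_iff by auto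
  then show ?thesis
    by (intro haar.integrable_const_bound[of _ B] haar_measurable assms) auto
qed

text \<open>The map \<open>g\<close> on the group is covered by the isometry \<open>f\<close> of the
  ball. The ball measure is invariant under \<open>f\<close>, and pushing it through the commuting
  square gives invariance of \<open>haar\<close> under \<open>g\<close>.\<close>

lemma haar_distr:
  assumes g: "\<And>x. x \<in> SU2 \<Longrightarrow> g x \<in> SU2" and cg: "continuous_on SU2 g"
    and f: "orthogonal_transformation f" and gf: "\<And>x. x \<in> pball \<Longrightarrow> g (sphere_proj x) = sphere_proj (f x)"
  shows "distr haar haar g = haar"
proof -
  have gm: "g \<in> measurable SU2M SU2M"
    by (rule measurable_restrict_space2) (auto simp: g space_restrict_space intro: borel_measurable_continuous_on_restrict cg)
  note fm = distr_ballM_orthogonal[OF f]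
  have "distr haar haar g = distr ballM SU2M (g \<circ> sphere_proj)"
    unfolding haar_def by (subst distr_distr[symmetric, OF gm sphere_proj_measurable]) (rule distr_cong; simp)
  also have "\<dots> = distr ballM SU2M (sphere_proj \<circ> f)"
    by (rule distr_cong) (auto simp: gf)
  also have "\<dots> = distr (distr ballM ballM f) SU2M sphere_proj"
    by (rule distr_distr[symmetric, OF sphere_proj_measurable fm(1)])
  finally show ?thesis unfolding fm(2) haar_def[symmetric] .
qed

lemma sphere_proj_mult:
  assumes "U \<in> SU2"
  shows "U ** sphere_proj x = sphere_proj (unquat (U ** quat x))"
    and "sphere_proj x ** U = sphere_proj (unquat (quat x ** U))"
proof -
  have n: "norm (unquat (U ** quat x)) = norm x" "norm (unquat (quat x ** U)) = norm x"
    using orthogonal_quat_mult[OF assms] by (auto simp: orthogonal_transformation)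
  show "U ** sphere_proj x = sphere_proj (unquat (U ** quat x))"
    unfolding sphere_proj_def n quat_scaleR quat_mult_left[OF assms] m2_mult_scaleR ..
  show "sphere_proj x ** U = sphere_proj (unquat (quat x ** U))"
    unfolding sphere_proj_def n quat_scaleR quat_mult_right[OF assms] m2_mult_scaleR ..
qed

lemma haar_integral_translate:
  fixes f :: "m2 \<Rightarrow> 'b::{banach, second_countable_topology}"
  assumes U: "U \<in> SU2" and f: "continuous_on SU2 f"
  shows "(LINT x|haar. f (U ** x)) = (LINT x|haar. f x)" (is ?L)
    and "(LINT x|haar. f (x ** U)) = (LINT x|haar. f x)" (is ?R)
proof -
  have d: "distr haar haar (\<lambda>x. U ** x) = haar" "distr haar haar (\<lambda>x. x ** U) = haar"
    using U by (intro haar_distr[OF _ _ orthogonal_quat_mult(1)[OF U]] haar_distr[OF _ _ orthogonal_quat_mult(2)[OF U]];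
      auto intro!: continuous_intros simp: sphere_proj_mult[OF U])+
  have m: "(\<lambda>x. U ** x) \<in> measurable haar haar" "(\<lambda>x. x ** U) \<in> measurable haar haar"
    unfolding measurable_cong_sets[OF sets_haar sets_haar] using U
    by (auto intro!: measurable_restrict_space2 borel_measurable_continuous_on_restrict continuous_intros simp: space_restrict_space)
  show ?L using integral_distr[OF m(1) haar_measurable[OF f]] by (simp add: d)
  show ?R using integral_distr[OF m(2) haar_measurable[OF f]] by (simp add: d)
qed

text \<open>The measure has full support: where \<open>f\<close> is nonzero, its pullback to the
  ball is nonzero on a nonempty open set, and such a set has positive Lebesgue measure.\<close>

lemma haar_integral_0_imp:
  fixes f :: "m2 \<Rightarrow> real"
  assumes f: "continuous_on SU2 f" and nn: "\<And>x. x \<in> SU2 \<Longrightarrow> 0 \<le> f x"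
    and 0: "(LINT x|haar. f x) = 0" and y: "y \<in> SU2"
  shows "f y = 0"
proof (rule ccontr)
  assume fy: "f y \<noteq> 0"
  have "AE x in haar. 0 \<le> f x" by (rule AE_I2) (simp add: nn)
  then have "AE x in haar. f x = 0"
    using integral_nonneg_eq_0_iff_AE[OF haar_integrable[OF f]] 0 by blast
  then have AE: "AE x in ballM. f (sphere_proj x) = 0"
    unfolding haar_def by (rule AE_distrD[OF sphere_proj_measurable])
  let ?S = "{x \<in> pball. f (sphere_proj x) \<noteq> 0}"
  have "continuous_on pball (\<lambda>x. f (sphere_proj x))"
    by (rule continuous_on_compose2[OF f continuous_on_sphere_proj]) (rule image_subsetI, rule sphere_proj_SU2)
  then have "open ((\<lambda>x. f (sphere_proj x)) -` (- {0}) \<inter> pball)"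
    by (subst (asm) continuous_on_open_vimage) auto
  moreover have "(\<lambda>x. f (sphere_proj x)) -` (- {0}) \<inter> pball = ?S" by auto
  ultimately have op: "open ?S" by simp
  \<comment> \<open>A point of the open ball on the ray through \<open>y\<close>; the sphere itself
    lies outside the ball.\<close>
  have "(1/2) *\<^sub>R unquat y \<in> ?S"
  proof -
    have q: "quat (unquat y) = y" using y by (intro quat_unquat) (auto simp: SU2_iff)
    then have n: "norm (unquat y) = 1" using quat_SU2[of "unquat y"] y by simp
    then have "(1/2) *\<^sub>R unquat y \<in> pball" by auto
    moreover have "sphere_proj ((1/2) *\<^sub>R unquat y) = y"
      unfolding sphere_proj_def using n q by simp
    ultimately show ?thesis using fy by simp
  qed
  then have "\<not> negligible ?S" using open_not_negligible[OF op] by blast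
  moreover have "emeasure ballM ?S = 0"
  proof -
    have "?S \<in> sets ballM" using op by (auto simp: sets_ballM)
    then show ?thesis using AE by (subst (asm) AE_iff_measurable[of ?S]) auto
  qed
  then have "emeasure lborel ?S = 0"
    using op by (subst (asm) emeasure_ballM) (auto simp: sets_ballM)
  then have "?S \<in> null_sets lebesgue" using op
    by (simp add: null_sets_def)
  ultimately show False by (simp add: negligible_iff_null_sets)
qed

lemma haar_measure_pos: "measure haar SU2 > 0"
proof -
  have "measure haar SU2 \<noteq> 0"
    using haar_integral_0_imp[of "\<lambda>_. 1" \<I>] by auto
  then show ?thesis using measure_nonneg[of haar SU2] by linarith
qed

subsection \<open>Completeness of the matrix coefficients\<close>

text \<open>The matrix entry of row \<open>j\<close> and column \<open>k\<close>, but without a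
  bound on \<open>j\<close>, so that the recurrences below can shift indices freely; coefficients
  beyond the degree are 0.\<close>

definition form_coeff :: "nat \<Rightarrow> nat \<Rightarrow> nat \<Rightarrow> m2 \<Rightarrow> complex" where
  "form_coeff m k j x = coeff (Pp x ^ k * Qp x ^ (m - k)) j"

lemma continuous_on_form_coeff [continuous_intros]: "continuous_on S f \<Longrightarrow> continuous_on S (\<lambda>x. form_coeff m k j (f x))"
  unfolding form_coeff_def by (rule continuous_on_PQ)

lemma sym_rep_form_coeff: "j \<le> n \<Longrightarrow> k \<le> n \<Longrightarrow> sym_rep n x $$ (j, k) = form_coeff n k j x"
  by (simp add: form_coeff_def)

text \<open>Determinant 1 expresses the constant 1 through the two linear forms. This is the
  relation that lets a product drop to a lower degree.\<close>

lemma smult_Qp: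
  assumes "x \<in> SU2"
  shows "smult (x $v 1 $v 1) (Qp x) = 1 + smult (x $v 1 $v 2) (Pp x)"
proof -
  have "x $v 1 $v 1 * x $v 2 $v 2 - x $v 1 $v 2 * x $v 2 $v 1 = 1"
    using det_SU2[OF assms] by (simp add: Determinants.det_2)
  then show ?thesis by (auto simp: Pp_def Qp_def one_pCons algebra_simps simp del: pCons_one)
qed

text \<open>An explicit Clebsch-Gordan formula: a matrix entry times a coefficient of degree
  \<open>m\<close> splits into degrees \<open>m + 1\<close> and \<open>m - 1\<close>. The first part
  comes from differentiating a product of higher degree, the second from the relation
  \<open>smult_Qp\<close>. At \<open>k = m\<close> the truncated exponent is harmless, because the
  factor \<open>m - k\<close> is 0.\<close>

lemma smult_PQ_11:
  assumes x: "x \<in> SU2" and "k \<le> m"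
  shows "smult (of_nat (Suc m) * x $v 1 $v 1) (Pp x ^ k * Qp x ^ (m - k))
     = pderiv (Pp x ^ Suc k * Qp x ^ (m - k)) + smult (of_nat (m - k)) (Pp x ^ k * Qp x ^ (m - 1 - k))"
proof -
  have dP: "pderiv (Pp x) = [:x $v 1 $v 1:]" and dQ: "pderiv (Qp x) = [:x $v 1 $v 2:]"
    by (simp_all add: Pp_def Qp_def pderiv_pCons)
  show ?thesis
  proof (cases "m - k")
    case 0
    then have mk: "m = k" using assms by simp
    show ?thesis unfolding mk
      by (simp only: diff_self_eq_0 power_0 mult_1_right of_nat_0 smult_0_left add_0_right pderiv_power_Suc dP)
        (simp add: mult.commute del: of_nat_Suc)
  next
    case (Suc l)
    have "Suc m = Suc k + Suc l" and l: "m - 1 - k = l"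
      using Suc assms by auto
    then have m: "of_nat (Suc m) = (of_nat (Suc k) + of_nat (Suc l) :: complex)"
      by (simp only: of_nat_add)
    have "pderiv (Pp x ^ Suc k * Qp x ^ Suc l)
       = smult (of_nat (Suc k) * x $v 1 $v 1) (Pp x ^ k * Qp x ^ Suc l)
       + smult (of_nat (Suc l)) (Pp x ^ k * Qp x ^ l * smult (x $v 1 $v 2) (Pp x))"
      unfolding pderiv_mult pderiv_power_Suc dP dQ by (simp add: algebra_simps)
    also have "smult (x $v 1 $v 2) (Pp x) = smult (x $v 1 $v 1) (Qp x) - 1"
      using smult_Qp[OF x] by simp
    also have "smult (of_nat (Suc k) * x $v 1 $v 1) (Pp x ^ k * Qp x ^ Suc l)
       + smult (of_nat (Suc l)) (Pp x ^ k * Qp x ^ l * (smult (x $v 1 $v 1) (Qp x) - 1))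
       = smult (of_nat (Suc m) * x $v 1 $v 1) (Pp x ^ k * Qp x ^ Suc l) - smult (of_nat (Suc l)) (Pp x ^ k * Qp x ^ l)"
      unfolding m by (simp add: algebra_simps smult_diff_right smult_add_left del: of_nat_Suc)
    finally show ?thesis unfolding Suc l by simp
  qed
qed

text \<open>The same argument with the two linear forms exchanged; the relation then enters with the
  opposite sign.\<close>

lemma smult_PQ_12:
  assumes x: "x \<in> SU2" and "k \<le> m"
  shows "smult (of_nat (Suc m) * x $v 1 $v 2) (Pp x ^ k * Qp x ^ (m - k))
     = pderiv (Pp x ^ k * Qp x ^ (Suc m - k)) - smult (of_nat k) (Pp x ^ (k - 1) * Qp x ^ (m - k))"
proof -
  have dP: "pderiv (Pp x) = [:x $v 1 $v 1:]" and dQ: "pderiv (Qp x) = [:x $v 1 $v 2:]"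
    by (simp_all add: Pp_def Qp_def pderiv_pCons)
  have s: "Suc m - k = Suc (m - k)" using assms by simp
  show ?thesis
  proof (cases k)
    case 0
    show ?thesis unfolding 0
      by (simp only: minus_nat.diff_0 power_0 mult_1_left of_nat_0 smult_0_left diff_zero pderiv_power_Suc dQ)
        (simp add: mult.commute del: of_nat_Suc)
  next
    case (Suc l)
    have "Suc m = Suc l + Suc (m - k)"
      using Suc assms by auto
    then have m: "of_nat (Suc m) = (of_nat (Suc l) + of_nat (Suc (m - k)) :: complex)"
      by (simp only: of_nat_add)
    have "pderiv (Pp x ^ Suc l * Qp x ^ Suc (m - k))
       = smult (of_nat (Suc l)) (Pp x ^ l * Qp x ^ (m - k) * smult (x $v 1 $v 1) (Qp x))
       + smult (of_nat (Suc (m - k)) * x $v 1 $v 2) (Pp x ^ Suc l * Qp x ^ (m - k))"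
      unfolding pderiv_mult pderiv_power_Suc dP dQ by (simp add: algebra_simps)
    also have "smult (of_nat (Suc l)) (Pp x ^ l * Qp x ^ (m - k) * smult (x $v 1 $v 1) (Qp x))
       + smult (of_nat (Suc (m - k)) * x $v 1 $v 2) (Pp x ^ Suc l * Qp x ^ (m - k))
       = smult (of_nat (Suc m) * x $v 1 $v 2) (Pp x ^ Suc l * Qp x ^ (m - k)) + smult (of_nat (Suc l)) (Pp x ^ l * Qp x ^ (m - k))"
      unfolding m smult_Qp[OF x] by (simp add: algebra_simps smult_add_right smult_add_left del: of_nat_Suc)
    finally show ?thesis unfolding s unfolding Suc by (simp del: power_Suc of_nat_Suc)
  qed
qed

lemma form_coeff_11:
  assumes "x \<in> SU2" "k \<le> m"
  shows "x $v 1 $v 1 * form_coeff m k j x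
    = 1 / of_nat (Suc m) * (of_nat (Suc j) * form_coeff (Suc m) (Suc k) (Suc j) x + of_nat (m - k) * form_coeff (m - 1) k j x)"
  using arg_cong[OF smult_PQ_11[OF assms], of "\<lambda>p. coeff p j"]
  by (simp add: form_coeff_def coeff_pderiv field_simps del: power_Suc of_nat_Suc)

lemma form_coeff_12:
  assumes "x \<in> SU2" "k \<le> m"
  shows "x $v 1 $v 2 * form_coeff m k j x
    = 1 / of_nat (Suc m) * (of_nat (Suc j) * form_coeff (Suc m) k (Suc j) x - of_nat k * form_coeff (m - 1) (k - 1) j x)"
proof -
  have "form_coeff (m - 1) (k - 1) j x = coeff (Pp x ^ (k - 1) * Qp x ^ (m - k)) j" if "k \<noteq> 0"
    using that by (simp add: form_coeff_def)
  then show ?thesis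
    using arg_cong[OF smult_PQ_12[OF assms], of "\<lambda>p. coeff p j"]
    by (cases "k = 0") (simp_all add: form_coeff_def coeff_pderiv field_simps del: power_Suc of_nat_Suc)
qed

text \<open>The entries of the second row need no derivative: comparing coefficient \<open>j\<close>
  in a product with the linear form \<open>Pp x\<close> reduces them to a coefficient of degree
  \<open>Suc m\<close> and to the first row.\<close>

lemma form_coeff_21:
  "x $v 2 $v 1 * form_coeff m k j x = form_coeff (Suc m) (Suc k) j x - (if j = 0 then 0 else x $v 1 $v 1 * form_coeff m k (j - 1) x)"
proof -
  have "form_coeff (Suc m) (Suc k) j x = coeff (Pp x * (Pp x ^ k * Qp x ^ (m - k))) j"
    by (simp add: form_coeff_def mult.assoc)
  then have "form_coeff (Suc m) (Suc k) j x = coeff ([:x $v 2 $v 1, x $v 1 $v 1:] * (Pp x ^ k * Qp x ^ (m - k))) j"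
    by (simp only: Pp_def[of x, symmetric])
  then show ?thesis unfolding coeff_linear_mult by (simp add: form_coeff_def)
qed

lemma form_coeff_22:
  assumes "k \<le> m"
  shows "x $v 2 $v 2 * form_coeff m k j x = form_coeff (Suc m) k j x - (if j = 0 then 0 else x $v 1 $v 2 * form_coeff m k (j - 1) x)"
proof -
  have "Suc m - k = Suc (m - k)" using assms by simp
  then have "form_coeff (Suc m) k j x = coeff ([:x $v 2 $v 2, x $v 1 $v 2:] * (Pp x ^ k * Qp x ^ (m - k))) j"
    by (simp add: form_coeff_def Qp_def mult_ac)
  then show ?thesis unfolding coeff_linear_mult by (simp add: form_coeff_def)
qed

text \<open>Orthogonality to all degrees at once, since multiplication by a matrix entry mixes
  neighbouring degrees and a condition on one degree would not be stable.\<close>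

definition annihil :: "(m2 \<Rightarrow> complex) \<Rightarrow> bool" where
  "annihil f \<longleftrightarrow> continuous_on SU2 f \<and>
     (\<forall>m k j. k \<le> m \<longrightarrow> has_bochner_integral haar (\<lambda>x. f x * form_coeff m k j x) 0)"

lemma annihilD: "annihil f \<Longrightarrow> k \<le> m \<Longrightarrow> has_bochner_integral haar (\<lambda>x. f x * form_coeff m k j x) 0"
  by (simp add: annihil_def)

lemma annihilI:
  assumes "continuous_on SU2 f"
    and "\<And>m k j. k \<le> m \<Longrightarrow> has_bochner_integral haar (g m k j) 0"
    and "\<And>m k j x. k \<le> m \<Longrightarrow> x \<in> SU2 \<Longrightarrow> f x * form_coeff m k j x = g m k j x"
  shows "annihil f"
  unfolding annihil_def
proof (intro conjI allI impI assms(1))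
  fix m k j :: nat assume km: "k \<le> m"
  show "has_bochner_integral haar (\<lambda>x. f x * form_coeff m k j x) 0"
    by (subst has_bochner_integral_cong[of haar haar _ "g m k j" _ 0])
      (use assms(2,3)[OF km] in auto)
qed

lemma has_bochner_integral_0_add:
  "has_bochner_integral M f 0 \<Longrightarrow> has_bochner_integral M g 0 \<Longrightarrow> has_bochner_integral M (\<lambda>x. f x + g x) (0::complex)"
  using has_bochner_integral_add[of M f 0 g 0] by simp

lemma has_bochner_integral_0_mult:
  "has_bochner_integral M f 0 \<Longrightarrow> has_bochner_integral M (\<lambda>x. c * f x) (0::complex)"
  using has_bochner_integral_mult_right[of c M f 0] by simp

lemma annihil_add:
  assumes "annihil f" "annihil g"
  shows "annihil (\<lambda>x. f x + g x)"
  by (rule annihilI[where g = "\<lambda>m k j x. f x * form_coeff m k j x + g x * form_coeff m k j x"])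
    (use assms in \<open>auto simp: annihil_def distrib_right intro!: continuous_intros has_bochner_integral_0_add\<close>)

lemma annihil_mult:
  assumes "annihil f"
  shows "annihil (\<lambda>x. c * f x)"
  by (rule annihilI[where g = "\<lambda>m k j x. c * (f x * form_coeff m k j x)"])
    (use assms in \<open>auto simp: annihil_def intro!: continuous_intros has_bochner_integral_0_mult\<close>)

lemma annihil_11:
  assumes f: "annihil f"
  shows "annihil (\<lambda>x. x $v 1 $v 1 * f x)"
proof (rule annihilI[where g = "\<lambda>m k j x. 1 / of_nat (Suc m) * (of_nat (Suc j) * (f x * form_coeff (Suc m) (Suc k) (Suc j) x) + of_nat (m - k) * (f x * form_coeff (m - 1) k j x))"], goal_cases)
  case (2 m k j)
  \<comment> \<open>For \<open>k = m\<close> the index leaves the range allowed in degree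
    \<open>m - 1\<close>, but there the factor \<open>m - k\<close> is 0.\<close>
  have H: "has_bochner_integral haar (\<lambda>x. of_nat (m - k) * (f x * form_coeff (m - 1) k j x)) 0"
  proof (cases "k = m")
    case False
    then show ?thesis using 2 by (intro has_bochner_integral_0_mult annihilD[OF f]) auto
  qed (simp add: has_bochner_integral_zero)
  show ?case
    by (rule has_bochner_integral_0_mult, rule has_bochner_integral_0_add[OF _ H],
        rule has_bochner_integral_0_mult, rule annihilD[OF f]) (use 2 in simp)
next
  case (3 m k j x)
  have "x $v 1 $v 1 * f x * form_coeff m k j x = f x * (x $v 1 $v 1 * form_coeff m k j x)" by simp
  then show ?case unfolding form_coeff_11[OF 3(2,1)] by (simp add: distrib_left mult_ac del: of_nat_Suc)
qed (use f in \<open>auto simp: annihil_def intro!: continuous_intros\<close>)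

lemma annihil_12:
  assumes f: "annihil f"
  shows "annihil (\<lambda>x. x $v 1 $v 2 * f x)"
proof (rule annihilI[where g = "\<lambda>m k j x. 1 / of_nat (Suc m) * (of_nat (Suc j) * (f x * form_coeff (Suc m) k (Suc j) x) + (- of_nat k) * (f x * form_coeff (m - 1) (k - 1) j x))"], goal_cases)
  case (2 m k j)
  then show ?case
    by (intro has_bochner_integral_0_mult has_bochner_integral_0_add annihilD[OF f]) auto
next
  case (3 m k j x)
  have "x $v 1 $v 2 * f x * form_coeff m k j x = f x * (x $v 1 $v 2 * form_coeff m k j x)" by simp
  then show ?case unfolding form_coeff_12[OF 3(2,1)] by (simp add: distrib_left right_diff_distrib mult_ac del: of_nat_Suc)
qed (use f in \<open>auto simp: annihil_def intro!: continuous_intros\<close>)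

lemma annihil_21:
  assumes f: "annihil f"
  shows "annihil (\<lambda>x. x $v 2 $v 1 * f x)"
proof (rule annihilI[where g = "\<lambda>m k j x. f x * form_coeff (Suc m) (Suc k) j x + (if j = 0 then 0 else - 1) * ((x $v 1 $v 1 * f x) * form_coeff m k (j - 1) x)"], goal_cases)
  case (2 m k j)
  then show ?case
    by (intro has_bochner_integral_0_mult has_bochner_integral_0_add annihilD[OF f] annihilD[OF annihil_11[OF f]]) auto
next
  case (3 m k j x)
  have "x $v 2 $v 1 * f x * form_coeff m k j x = f x * (x $v 2 $v 1 * form_coeff m k j x)" by simp
  then show ?case unfolding form_coeff_21 by (simp add: right_diff_distrib mult_ac)
qed (use f in \<open>auto simp: annihil_def intro!: continuous_intros\<close>)

lemma annihil_22:
  assumes f: "annihil f"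
  shows "annihil (\<lambda>x. x $v 2 $v 2 * f x)"
proof (rule annihilI[where g = "\<lambda>m k j x. f x * form_coeff (Suc m) k j x + (if j = 0 then 0 else - 1) * ((x $v 1 $v 2 * f x) * form_coeff m k (j - 1) x)"], goal_cases)
  case (2 m k j)
  then show ?case
    by (intro has_bochner_integral_0_mult has_bochner_integral_0_add annihilD[OF f] annihilD[OF annihil_12[OF f]]) auto
next
  case (3 m k j x)
  have "x $v 2 $v 2 * f x * form_coeff m k j x = f x * (x $v 2 $v 2 * form_coeff m k j x)" by simp
  then show ?case unfolding form_coeff_22[OF 3(1)] by (simp add: right_diff_distrib mult_ac)
qed (use f in \<open>auto simp: annihil_def intro!: continuous_intros\<close>)

lemma annihil_cong:
  assumes f: "annihil f" and "\<And>x. x \<in> SU2 \<Longrightarrow> f x = g x"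
  shows "annihil g"
  by (rule annihilI[where g = "\<lambda>m k j x. f x * form_coeff m k j x"])
    (use assms in \<open>auto simp: annihil_def cong: continuous_on_cong\<close>)

text \<open>On the group the conjugates of matrix entries are again matrix entries up to sign. Real
  and imaginary parts, and with them all real linear functionals, are therefore complex combinations
  of the four entries.\<close>

lemma annihil_linear:
  assumes f: "annihil f" and g: "bounded_linear (g :: m2 \<Rightarrow> real)"
  shows "annihil (\<lambda>x. of_real (g x) * f x)"
proof -
  define e where "e i = quat (axis i 1)" for i
  \<comment> \<open>The coefficients in \<open>?h\<close> come from writing Re z as (z + cnj z) / 2
    and Im z as -i (z - cnj z) / 2 for the two entries of the first column.\<close>
  define G where "G i = complex_of_real (g (e i))" for i
  let ?h = "\<lambda>x. ((G 1 / 2 - \<i> * G 2 / 2) * (x $v 1 $v 1 * f x) + (G 1 / 2 + \<i> * G 2 / 2) * (x $v 2 $v 2 * f x))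
    + ((G 3 / 2 - \<i> * G 4 / 2) * (x $v 2 $v 1 * f x) + (- G 3 / 2 - \<i> * G 4 / 2) * (x $v 1 $v 2 * f x))"
  have "annihil ?h"
    by (intro annihil_add annihil_mult annihil_11 annihil_12 annihil_21 annihil_22 f)
  then show ?thesis
  proof (rule annihil_cong)
    fix x assume x: "x \<in> SU2"
    interpret g: bounded_linear g by (rule g)
    have q: "x = quat (unquat x)" using x by (intro quat_unquat[symmetric]) (auto simp: SU2_iff)
    have "x = Re (x $v 1 $v 1) *\<^sub>R e 1 + Im (x $v 1 $v 1) *\<^sub>R e 2 + Re (x $v 2 $v 1) *\<^sub>R e 3 + Im (x $v 2 $v 1) *\<^sub>R e 4"
      by (subst q) (simp add: m2_eq_iff e_def axis_def complex_eq_iff)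
    then have "g x = Re (x $v 1 $v 1) * g (e 1) + Im (x $v 1 $v 1) * g (e 2) + Re (x $v 2 $v 1) * g (e 3) + Im (x $v 2 $v 1) * g (e 4)"
      by (metis g.add g.scaleR real_scaleR_def)
    then have gx: "of_real (g x) = of_real (Re (x $v 1 $v 1)) * G 1 + of_real (Im (x $v 1 $v 1)) * G 2
        + of_real (Re (x $v 2 $v 1)) * G 3 + of_real (Im (x $v 2 $v 1)) * G 4"
      by (simp add: G_def)
    have r: "complex_of_real (Re z) = (z + cnj z) / 2" "complex_of_real (Im z) = - \<i> * (z - cnj z) / 2" for z
      by (auto simp: complex_eq_iff)
    have "x $v 2 $v 2 = cnj (x $v 1 $v 1)" "x $v 1 $v 2 = - cnj (x $v 2 $v 1)"
      using x by (auto simp: SU2_iff)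
    then show "?h x = of_real (g x) * f x"
      unfolding gx r by (simp add: field_simps)
  qed
qed

lemma annihil_polynomial:
  assumes "real_polynomial_function g"
  shows "annihil f \<Longrightarrow> annihil (\<lambda>x. of_real (g x) * f x)"
  using assms
proof (induction g arbitrary: f rule: real_polynomial_function.induct)
  case (linear g)
  then show ?case by (intro annihil_linear)
next
  case (const c)
  then show ?case by (intro annihil_mult)
next
  case (add g h)
  then show ?case using annihil_add[OF add.IH(1) add.IH(2)] by (simp add: distrib_right)
next
  case (mult g h)
  then show ?case using mult.IH(1)[OF mult.IH(2)] by (simp add: mult.assoc)
qed

text \<open>If a polynomial approximates \<open>u\<close> within e, orthogonality bounds the
  integral of the square of \<open>u\<close> by e times the integral of its absolute value. So the
  former is 0, and full support of the measure finishes.\<close>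

lemma real_orthogonal_imp_zero:
  fixes u :: "m2 \<Rightarrow> real"
  assumes u: "continuous_on SU2 u"
    and 0: "\<And>g. real_polynomial_function g \<Longrightarrow> (LINT x|haar. u x * g x) = 0"
    and y: "y \<in> SU2"
  shows "u y = 0"
proof -
  let ?K = "LINT x|haar. \<bar>u x\<bar>"
  let ?I = "LINT x|haar. (u x)\<^sup>2"
  have I: "?I \<le> e * ?K" if e: "e > 0" for e
  proof -
    obtain g where g: "real_polynomial_function g" "\<And>x. x \<in> SU2 \<Longrightarrow> \<bar>u x - g x\<bar> < e"
      using Stone_Weierstrass_real_polynomial_function[OF compact_SU2 u e] by blast
    have cg: "continuous_on SU2 g"
      using g(1) continuous_on_polymonial_function real_polynomial_function_eq by blast
    have "?I = (LINT x|haar. u x * (u x - g x)) + (LINT x|haar. u x * g x)"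
      by (subst Bochner_Integration.integral_add[symmetric])
        (auto intro!: haar_integrable continuous_intros u cg simp: power2_eq_square algebra_simps)
    also have "\<dots> = (LINT x|haar. u x * (u x - g x))" by (simp add: 0[OF g(1)])
    also have "\<dots> \<le> (LINT x|haar. e * \<bar>u x\<bar>)"
    proof (rule integral_mono)
      fix x assume "x \<in> space haar"
      then have "\<bar>u x\<bar> * \<bar>u x - g x\<bar> \<le> \<bar>u x\<bar> * e"
        using g(2)[of x] by (intro mult_left_mono) auto
      then show "u x * (u x - g x) \<le> e * \<bar>u x\<bar>"
        by (metis abs_ge_self abs_mult mult.commute order_trans)
    qed (auto intro!: haar_integrable continuous_intros u cg)
    finally show ?thesis by simp
  qed
  have "?K \<ge> 0" by simp
  have "?I \<le> 0"
  proof (rule field_le_epsilon)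
    fix d :: real assume d: "d > 0"
    \<comment> \<open>Adding 1 keeps the denominator positive even when \<open>?K\<close> is
      0.\<close>
    have "?I \<le> d / (?K + 1) * ?K" using I[of "d / (?K + 1)"] d \<open>?K \<ge> 0\<close> by simp
    also have "d / (K + 1) * K \<le> d" if "K \<ge> 0" for K
      using d that by (simp add: field_simps)
    then have "d / (?K + 1) * ?K \<le> d" using \<open>?K \<ge> 0\<close> by blast
    finally show "?I \<le> 0 + d" by simp
  qed
  moreover have "?I \<ge> 0" by simp
  ultimately have "?I = 0" by linarith
  then have "(u y)\<^sup>2 = 0"
    by (intro haar_integral_0_imp[where f = "\<lambda>x. (u x)\<^sup>2", OF _ _ _ y] continuous_intros u) auto
  then show ?thesis by simp
qed

text \<open>Orthogonality to all coefficients passes from \<open>f\<close> to its products with real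
  polynomials. Testing these products against degree 0, whose only coefficient is the constant 1,
  makes \<open>f\<close> orthogonal to every real polynomial.\<close>

theorem sym_rep_complete:
  assumes f: "continuous_on SU2 f"
    and 0: "\<And>n j k. j \<le> n \<Longrightarrow> k \<le> n \<Longrightarrow> (LINT x|haar. f x * sym_rep n x $$ (j, k)) = 0"
    and y: "y \<in> SU2"
  shows "f y = 0"
proof -
  have an: "annihil f"
    unfolding annihil_def
  proof (intro conjI allI impI f)
    fix m k j :: nat assume k: "k \<le> m"
    have "integrable haar (\<lambda>x. f x * form_coeff m k j x)"
      by (intro haar_integrable continuous_intros f)
    moreover have "(LINT x|haar. f x * form_coeff m k j x) = 0"
    proof (cases "j \<le> m")
      case True
      show ?thesis by (rule 0[OF True k, unfolded sym_rep_form_coeff[OF True k]])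
    next
      case False
      have "form_coeff m k j x = 0" for x
        unfolding form_coeff_def using degree_PQ[of x k x "m - k"] False k by (intro coeff_eq_0) auto
      then show ?thesis by simp
    qed
    ultimately show "has_bochner_integral haar (\<lambda>x. f x * form_coeff m k j x) 0"
      by (simp add: has_bochner_integral_iff)
  qed
  have int: "(LINT x|haar. f x * of_real (g x)) = 0" if "real_polynomial_function g" for g
  proof -
    have "has_bochner_integral haar (\<lambda>x. of_real (g x) * f x * form_coeff 0 0 0 x) 0"
      using annihil_polynomial[OF that an] by (intro annihilD) auto
    then show ?thesis by (simp add: form_coeff_def mult.commute has_bochner_integral_iff)
  qed
  have cg: "continuous_on SU2 g" if "real_polynomial_function g" for g :: "m2 \<Rightarrow> real"
    using that continuous_on_polymonial_function real_polynomial_function_eq by blast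
  have "Re (f y) = 0"
  proof (rule real_orthogonal_imp_zero[OF _ _ y])
    fix g :: "m2 \<Rightarrow> real" assume g: "real_polynomial_function g"
    have "(LINT x|haar. Re (f x) * g x) = Re (LINT x|haar. f x * of_real (g x))"
      by (subst integral_Re[symmetric]) (auto intro!: haar_integrable continuous_intros f cg g)
    then show "(LINT x|haar. Re (f x) * g x) = 0" using int[OF g] by simp
  qed (intro continuous_intros f)
  moreover have "Im (f y) = 0"
  proof (rule real_orthogonal_imp_zero[OF _ _ y])
    fix g :: "m2 \<Rightarrow> real" assume g: "real_polynomial_function g"
    have "(LINT x|haar. Im (f x) * g x) = Im (LINT x|haar. f x * of_real (g x))"
      by (subst integral_Im[symmetric]) (auto intro!: haar_integrable continuous_intros f cg g)
    then show "(LINT x|haar. Im (f x) * g x) = 0" using int[OF g] by simp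
  qed (intro continuous_intros f)
  ultimately show ?thesis by (simp add: complex_eq_iff)
qed

text \<open>Inversion on the group is quaternion conjugation, an isometry of 4-space that commutes
  with radial projection.\<close>

lemma haar_integral_cadj:
  fixes f :: "m2 \<Rightarrow> 'b::{banach, second_countable_topology}"
  assumes f: "continuous_on SU2 f"
  shows "(LINT x|haar. f (cadj x)) = (LINT x|haar. f x)"
proof -
  let ?c = "\<lambda>x. unquat (cadj (quat x))"
  have cq: "quat (?c x) = cadj (quat x)" for x
    by (rule quat_unquat) (simp_all add: complex_eq_iff)
  have n2: "(norm (?c x))\<^sup>2 = (norm x)\<^sup>2" for x
    unfolding norm_quat cq by (simp add: cmod_power2)
  have n: "norm (?c x) = norm x" for x
    by (rule power2_eq_imp_eq[OF n2]) simp_all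
  have "linear ?c"
    by (rule linearI) (simp_all add: Finite_Cartesian_Product.vec_eq_iff forall_4)
  then have o: "orthogonal_transformation ?c" using n by (simp add: orthogonal_transformation)
  have d: "distr haar haar cadj = haar"
  proof (rule haar_distr[OF _ _ o])
    fix x :: "real^4"
    have "cadj (c *\<^sub>R A) = c *\<^sub>R cadj A" for c A by (simp add: m2_eq_iff)
    then show "cadj (sphere_proj x) = sphere_proj (?c x)"
      unfolding sphere_proj_def n quat_scaleR cq by simp
  qed (auto intro!: continuous_intros)
  have m: "cadj \<in> measurable haar haar"
    unfolding measurable_cong_sets[OF sets_haar sets_haar]
    by (rule measurable_restrict_space2)
      (auto intro!: borel_measurable_continuous_on_restrict continuous_intros simp: space_restrict_space)
  show ?thesis using integral_distr[OF m haar_measurable[OF f]] by (simp add: d)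
qed

subsection \<open>Schur orthogonality and classification of irreducible representations\<close>

lemma mat_mult_index:
  "i < n \<Longrightarrow> j < p \<Longrightarrow> A \<in> carrier_mat n m \<Longrightarrow> B \<in> carrier_mat m p \<Longrightarrow>
    (A * B) $$ (i, j) = (\<Sum>k<m. A $$ (i, k) * B $$ (k, j))"
  by (auto simp: scalar_prod_def atLeast0LessThan intro!: sum.cong)

lemma mult_mat_vec_index:
  "i < n \<Longrightarrow> A \<in> carrier_mat n m \<Longrightarrow> v \<in> carrier_vec m \<Longrightarrow>
    (A *\<^sub>v v) $ i = (\<Sum>k<m. A $$ (i, k) * v $ k)"
  by (auto simp: scalar_prod_def atLeast0LessThan intro!: sum.cong)

lemma mult_mat_unit_vec:
  assumes "(A :: 'a::comm_ring_1 mat) \<in> carrier_mat n m" "j < m"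
  shows "A *\<^sub>v unit_vec m j = col A j"
  by (rule eq_vecI) (use assms in auto)

lemma mat_eqI_mult_vec:
  assumes "(A :: 'a::comm_ring_1 mat) \<in> carrier_mat n m" "B \<in> carrier_mat n m"
    and "\<And>v. v \<in> carrier_vec m \<Longrightarrow> A *\<^sub>v v = B *\<^sub>v v"
  shows "A = B"
proof (rule mat_col_eqI)
  fix j assume "j < dim_col B"
  then show "col A j = col B j"
    using assms mult_mat_unit_vec[of A n m j] mult_mat_unit_vec[of B n m j] by auto
qed (use assms in auto)

lemma zero_mat_mult_vec: "v \<in> carrier_vec m \<Longrightarrow> 0\<^sub>m n m *\<^sub>v v = (0\<^sub>v n :: 'a::comm_ring_1 Matrix.vec)"
  by (rule eq_vecI) (auto simp: scalar_prod_def)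

lemma is_irrepD:
  assumes "is_irrep d \<rho>"
  shows "is_rep d \<rho>" "d > 0"
    and "csubspace d W \<Longrightarrow> (\<And>U v. U \<in> SU2 \<Longrightarrow> v \<in> W \<Longrightarrow> \<rho> U *\<^sub>v v \<in> W) \<Longrightarrow> W = {0\<^sub>v d} \<or> W = carrier_vec d"
  using assms unfolding is_irrep_def by auto

lemma is_repD:
  assumes "is_rep d \<rho>"
  shows "U \<in> SU2 \<Longrightarrow> \<rho> U \<in> carrier_mat d d" "\<rho> \<I> = 1\<^sub>m d"
    "U \<in> SU2 \<Longrightarrow> V \<in> SU2 \<Longrightarrow> \<rho> (U ** V) = \<rho> U * \<rho> V"
    "i < d \<Longrightarrow> j < d \<Longrightarrow> continuous_on SU2 (\<lambda>U. \<rho> U $$ (i, j))"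
  using assms unfolding is_rep_def by auto

text \<open>Schur: kernel and image of \<open>T\<close> are invariant subspaces, and
  \<open>T\<close> is not zero, so it is bijective. The inverse is assembled from preimages of the
  unit vectors.\<close>

lemma intertwiner_inverse:
  assumes \<rho>: "is_irrep d \<rho>" and \<sigma>: "is_irrep d' \<sigma>" and T: "T \<in> carrier_mat d d'"
    and comm: "\<And>U. U \<in> SU2 \<Longrightarrow> \<rho> U * T = T * \<sigma> U" and T0: "T \<noteq> 0\<^sub>m d d'"
  shows "d = d' \<and> (\<exists>S\<in>carrier_mat d' d. T * S = 1\<^sub>m d \<and> S * T = 1\<^sub>m d')"
proof -
  note \<rho>c = is_repD(1)[OF is_irrepD(1)[OF \<rho>]] and \<sigma>c = is_repD(1)[OF is_irrepD(1)[OF \<sigma>]]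
  have ex: "\<exists>v\<in>carrier_vec d'. T *\<^sub>v v \<noteq> 0\<^sub>v d"
  proof (rule ccontr)
    assume "\<not> ?thesis"
    then have z: "T *\<^sub>v v = 0\<^sub>v d" if "v \<in> carrier_vec d'" for v using that by blast
    have "T = 0\<^sub>m d d'" by (rule mat_eqI_mult_vec[OF T]) (simp_all add: z zero_mat_mult_vec)
    then show False using T0 by blast
  qed
  have comm': "\<rho> U *\<^sub>v (T *\<^sub>v v) = T *\<^sub>v (\<sigma> U *\<^sub>v v)" if "U \<in> SU2" "v \<in> carrier_vec d'" for U v
  proof -
    have "\<rho> U *\<^sub>v (T *\<^sub>v v) = (\<rho> U * T) *\<^sub>v v"
      using \<rho>c[OF that(1)] T that(2) by (rule assoc_mult_mat_vec[symmetric])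
    also have "\<dots> = T *\<^sub>v (\<sigma> U *\<^sub>v v)"
      unfolding comm[OF that(1)] using T \<sigma>c[OF that(1)] that(2) by (rule assoc_mult_mat_vec)
    finally show ?thesis .
  qed
  define K where "K = {v \<in> carrier_vec d'. T *\<^sub>v v = 0\<^sub>v d}"
  have "csubspace d' K"
    unfolding csubspace_def K_def using T
    by (auto simp: mult_add_distrib_mat_vec[of _ d d'] mult_mat_vec[of _ d d'])
  then have "K = {0\<^sub>v d'} \<or> K = carrier_vec d'"
  proof (rule is_irrepD(3)[OF \<sigma>])
    fix U v assume U: "U \<in> SU2" and v: "v \<in> K"
    have "\<rho> U *\<^sub>v 0\<^sub>v d = 0\<^sub>v d" using \<rho>c[OF U] by (intro eq_vecI) auto
    then show "\<sigma> U *\<^sub>v v \<in> K" using comm'[OF U, of v] v \<sigma>c[OF U] by (auto simp: K_def)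
  qed
  moreover have "K \<noteq> carrier_vec d'" using ex by (auto simp: K_def)
  ultimately have K: "K = {0\<^sub>v d'}" by simp
  define I where "I = (\<lambda>v. T *\<^sub>v v) ` carrier_vec d'"
  have "csubspace d I"
    unfolding csubspace_def
  proof (intro conjI ballI allI)
    show "I \<subseteq> carrier_vec d" using T by (auto simp: I_def)
    have "0\<^sub>v d = T *\<^sub>v 0\<^sub>v d'" using T by (intro eq_vecI) auto
    then show "0\<^sub>v d \<in> I" by (auto simp: I_def)
  next
    fix v w assume "v \<in> I" "w \<in> I"
    then obtain a b where "a \<in> carrier_vec d'" "b \<in> carrier_vec d'" "v = T *\<^sub>v a" "w = T *\<^sub>v b" by (auto simp: I_def)
    then have "v + w = T *\<^sub>v (a + b)" "a + b \<in> carrier_vec d'" using T by (auto simp: mult_add_distrib_mat_vec[of _ d d'])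
    then show "v + w \<in> I" by (auto simp: I_def)
  next
    fix c v assume "v \<in> I"
    then obtain a where "a \<in> carrier_vec d'" "v = T *\<^sub>v a" by (auto simp: I_def)
    then have "c \<cdot>\<^sub>v v = T *\<^sub>v (c \<cdot>\<^sub>v a)" "c \<cdot>\<^sub>v a \<in> carrier_vec d'" using T by (auto simp: mult_mat_vec[of _ d d'])
    then show "c \<cdot>\<^sub>v v \<in> I" by (auto simp: I_def)
  qed
  then have "I = {0\<^sub>v d} \<or> I = carrier_vec d"
  proof (rule is_irrepD(3)[OF \<rho>])
    fix U v assume U: "U \<in> SU2" and v: "v \<in> I"
    then obtain a where a: "a \<in> carrier_vec d'" "v = T *\<^sub>v a" by (auto simp: I_def)
    then show "\<rho> U *\<^sub>v v \<in> I" using comm'[OF U a(1)] mult_mat_vec_carrier[OF \<sigma>c[OF U] a(1)] by (auto simp: I_def)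
  qed
  moreover have "I \<noteq> {0\<^sub>v d}" using ex by (auto simp: I_def)
  ultimately have I: "I = carrier_vec d" by simp
  have "\<exists>s. s \<in> carrier_vec d' \<and> T *\<^sub>v s = unit_vec d j" for j
    using I unit_vec_carrier[of d j] unfolding I_def by (metis imageE)
  then obtain s where s: "\<And>j. s j \<in> carrier_vec d'" "\<And>j. T *\<^sub>v s j = unit_vec d j" by metis
  define S where "S = Matrix.mat d' d (\<lambda>(i, j). s j $ i)"
  have S: "S \<in> carrier_mat d' d" by (simp add: S_def)
  have cS: "col S j = s j" if "j < d" for j
    using that s(1)[of j] by (intro eq_vecI) (auto simp: S_def)
  have TS: "T * S = 1\<^sub>m d"
  proof (rule mat_col_eqI)
    fix j assume "j < dim_col (1\<^sub>m d :: complex mat)"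
    then show "col (T * S) j = col (1\<^sub>m d) j"
      using T S cS s(2) by (simp add: col_mult2[of _ d d' _ d])
  qed (use T S in auto)
  have ST: "S * T = 1\<^sub>m d'"
  proof (rule mat_eqI_mult_vec)
    fix v :: "complex Matrix.vec" assume v: "v \<in> carrier_vec d'"
    let ?u = "S *\<^sub>v (T *\<^sub>v v)"
    have u: "?u \<in> carrier_vec d'" using S T v by auto
    have "T *\<^sub>v ?u = (T * S) *\<^sub>v (T *\<^sub>v v)" using S T v by (simp add: assoc_mult_mat_vec[of _ d d' _ d])
    also have "\<dots> = T *\<^sub>v v" unfolding TS using T v by simp
    finally have e: "T *\<^sub>v ?u = T *\<^sub>v v" .
    have "T *\<^sub>v (?u - v) = T *\<^sub>v ?u - T *\<^sub>v v"
      using T u v by (rule mult_minus_distrib_mat_vec)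
    also have "\<dots> = 0\<^sub>v d" unfolding e using T v by auto
    finally have "?u - v \<in> K" using u v by (auto simp: K_def)
    then have d0: "?u - v = 0\<^sub>v d'" using K by auto
    have "?u = v"
    proof (rule eq_vecI)
      fix i assume "i < dim_vec v"
      then show "?u $ i = v $ i" using arg_cong[OF d0, of "\<lambda>x. x $ i"] u v
        by (simp del: index_mult_mat_vec)
    qed (use u v S in auto)
    then show "S * T *\<^sub>v v = 1\<^sub>m d' *\<^sub>v v" using S T v by (simp add: assoc_mult_mat_vec[of _ d' d _ d'])
  qed (use S T in auto)
  \<comment> \<open>Equality of the two sizes comes from the traces of \<open>T * S\<close> and
    \<open>S * T\<close>, which agree.\<close>
  have "of_nat d = (\<Sum>i<d. (T * S) $$ (i, i))" by (simp add: TS)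
  also have "\<dots> = (\<Sum>i<d. \<Sum>k<d'. T $$ (i, k) * S $$ (k, i))"
    using T S by (intro sum.cong refl mat_mult_index) auto
  also have "\<dots> = (\<Sum>k<d'. \<Sum>i<d. S $$ (k, i) * T $$ (i, k))"
    by (subst sum.swap) (simp add: mult.commute)
  also have "\<dots> = (\<Sum>k<d'. (S * T) $$ (k, k))"
    using T S by (intro sum.cong refl mat_mult_index[symmetric]) auto
  also have "\<dots> = of_nat d'" by (simp add: ST)
  finally have "(of_nat d :: complex) = of_nat d'" .
  then show ?thesis using S TS ST by auto
qed

text \<open>An eigenspace of \<open>T\<close> is invariant and not zero, hence everything.\<close>

lemma schur_scalar:
  assumes \<rho>: "is_irrep d \<rho>" and T: "T \<in> carrier_mat d d"
    and comm: "\<And>U. U \<in> SU2 \<Longrightarrow> \<rho> U * T = T * \<rho> U"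
  shows "\<exists>c. T = c \<cdot>\<^sub>m 1\<^sub>m d"
proof -
  note \<rho>c = is_repD(1)[OF is_irrepD(1)[OF \<rho>]]
  obtain c where "eigenvalue T c"
    using spectrum_non_empty[OF T is_irrepD(2)[OF \<rho>]] by (auto simp: spectrum_def)
  then obtain v where v: "v \<in> carrier_vec d" "v \<noteq> 0\<^sub>v d" "T *\<^sub>v v = c \<cdot>\<^sub>v v"
    using T by (auto simp: eigenvalue_def eigenvector_def)
  define K where "K = {v \<in> carrier_vec d. T *\<^sub>v v = c \<cdot>\<^sub>v v}"
  have "csubspace d K"
    unfolding csubspace_def K_def using T
    by (auto simp: mult_add_distrib_mat_vec[of _ d d] mult_mat_vec[of _ d d] smult_add_distrib_vec[of _ d] smult_smult_assoc mult.commute)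
  then have "K = {0\<^sub>v d} \<or> K = carrier_vec d"
  proof (rule is_irrepD(3)[OF \<rho>])
    fix U w assume U: "U \<in> SU2" and w: "w \<in> K"
    then have wc: "w \<in> carrier_vec d" and we: "T *\<^sub>v w = c \<cdot>\<^sub>v w" by (auto simp: K_def)
    have "T *\<^sub>v (\<rho> U *\<^sub>v w) = (T * \<rho> U) *\<^sub>v w"
      using assoc_mult_mat_vec[OF T \<rho>c[OF U] wc] by simp
    also have "\<dots> = \<rho> U *\<^sub>v (T *\<^sub>v w)"
      unfolding comm[OF U, symmetric] using assoc_mult_mat_vec[OF \<rho>c[OF U] T wc] by simp
    also have "\<dots> = c \<cdot>\<^sub>v (\<rho> U *\<^sub>v w)" unfolding we using mult_mat_vec[OF \<rho>c[OF U] wc] by simp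
    finally show "\<rho> U *\<^sub>v w \<in> K" using mult_mat_vec_carrier[OF \<rho>c[OF U] wc] by (auto simp: K_def)
  qed
  moreover have "K \<noteq> {0\<^sub>v d}" using v by (auto simp: K_def)
  ultimately have K: "K = carrier_vec d" by simp
  have "T = c \<cdot>\<^sub>m 1\<^sub>m d"
  proof (rule mat_eqI_mult_vec[OF T])
    fix v :: "complex Matrix.vec" assume v: "v \<in> carrier_vec d"
    then have "T *\<^sub>v v = c \<cdot>\<^sub>v v" using K by (auto simp: K_def)
    also have "\<dots> = (c \<cdot>\<^sub>m 1\<^sub>m d) *\<^sub>v v" using v by (intro eq_vecI) auto
    finally show "T *\<^sub>v v = (c \<cdot>\<^sub>m 1\<^sub>m d) *\<^sub>v v" .
  qed simp
  then show ?thesis ..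
qed

text \<open>The group average of \<rho>(x) E \<sigma>(x^-1), where E is the matrix unit at position
  (\<open>k\<close>, \<open>l\<close>). Its entries are at the same time inner products of matrix
  coefficients.\<close>

definition avg_mat :: "nat \<Rightarrow> (m2 \<Rightarrow> complex mat) \<Rightarrow> nat \<Rightarrow> (m2 \<Rightarrow> complex mat) \<Rightarrow> nat \<Rightarrow> nat \<Rightarrow> complex mat" where
  "avg_mat d \<rho> d' \<sigma> k l = Matrix.mat d d' (\<lambda>(i, j). LINT x|haar. \<rho> x $$ (i, k) * \<sigma> (cadj x) $$ (l, j))"

text \<open>Multiplication by \<open>U\<close> on the left turns x into U x inside the first factor;
  by translation invariance this reappears as a factor \<open>U\<close> on the right of the second
  one.\<close>

lemma avg_mat_intertwines:
  assumes \<rho>: "is_rep d \<rho>" and \<sigma>: "is_rep d' \<sigma>" and k: "k < d" and l: "l < d'" and U: "U \<in> SU2"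
  shows "\<rho> U * avg_mat d \<rho> d' \<sigma> k l = avg_mat d \<rho> d' \<sigma> k l * \<sigma> U"
proof (rule eq_matI)
  let ?T = "avg_mat d \<rho> d' \<sigma> k l"
  have T: "?T \<in> carrier_mat d d'" by (simp add: avg_mat_def)
  note \<rho>c = is_repD(1)[OF \<rho>] and \<sigma>c = is_repD(1)[OF \<sigma>]
  have c\<sigma>: "continuous_on SU2 (\<lambda>x. \<sigma> (cadj x) $$ (i, j))" if "i < d'" "j < d'" for i j
    by (rule continuous_on_compose2[OF is_repD(4)[OF \<sigma> that]]) (auto intro!: continuous_intros)
  have c\<sigma>2: "continuous_on SU2 (\<lambda>x. \<sigma> (cadj (cadj U ** x)) $$ (i, j))" if "i < d'" "j < d'" for i j
    by (rule continuous_on_compose2[OF is_repD(4)[OF \<sigma> that]]) (use U in \<open>auto intro!: continuous_intros\<close>)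
  note cont = is_repD(4)[OF \<rho>] c\<sigma> c\<sigma>2
  fix i j assume "i < dim_row (?T * \<sigma> U)" "j < dim_col (?T * \<sigma> U)"
  then have i: "i < d" and j: "j < d'" using T \<sigma>c[OF U] by auto
  have "(\<rho> U * ?T) $$ (i, j) = (\<Sum>p<d. \<rho> U $$ (i, p) * (LINT x|haar. \<rho> x $$ (p, k) * \<sigma> (cadj x) $$ (l, j)))"
    using mat_mult_index[OF i j \<rho>c[OF U] T] j by (simp add: avg_mat_def)
  also have "\<dots> = (\<Sum>p<d. LINT x|haar. \<rho> U $$ (i, p) * (\<rho> x $$ (p, k) * \<sigma> (cadj x) $$ (l, j)))"
    by simp
  also have "\<dots> = (LINT x|haar. (\<Sum>p<d. \<rho> U $$ (i, p) * (\<rho> x $$ (p, k) * \<sigma> (cadj x) $$ (l, j))))"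
    by (rule Bochner_Integration.integral_sum[symmetric])
      (use i j k l in \<open>auto intro!: haar_integrable continuous_intros cont\<close>)
  also have "\<dots> = (LINT x|haar. \<rho> (U ** x) $$ (i, k) * \<sigma> (cadj (cadj U ** (U ** x))) $$ (l, j))"
  proof (rule Bochner_Integration.integral_cong)
    fix x assume "x \<in> space haar"
    then have x: "x \<in> SU2" by simp
    have "(\<Sum>p<d. \<rho> U $$ (i, p) * \<rho> x $$ (p, k)) = \<rho> (U ** x) $$ (i, k)"
      using mat_mult_index[OF i k \<rho>c[OF U] \<rho>c[OF x]] is_repD(3)[OF \<rho> U x] by simp
    then have "(\<Sum>p<d. \<rho> U $$ (i, p) * \<rho> x $$ (p, k)) * \<sigma> (cadj x) $$ (l, j)
       = \<rho> (U ** x) $$ (i, k) * \<sigma> (cadj (cadj U ** (U ** x))) $$ (l, j)"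
      using U by (simp add: matrix_mul_assoc)
    then show "(\<Sum>p<d. \<rho> U $$ (i, p) * (\<rho> x $$ (p, k) * \<sigma> (cadj x) $$ (l, j)))
       = \<rho> (U ** x) $$ (i, k) * \<sigma> (cadj (cadj U ** (U ** x))) $$ (l, j)"
      by (simp add: sum_distrib_right mult.assoc)
  qed simp
  also have "\<dots> = (LINT x|haar. \<rho> x $$ (i, k) * \<sigma> (cadj (cadj U ** x)) $$ (l, j))"
    by (rule haar_integral_translate(1)[OF U]) (use i j k l in \<open>auto intro!: continuous_intros cont\<close>)
  also have "\<dots> = (LINT x|haar. (\<Sum>q<d'. \<rho> x $$ (i, k) * \<sigma> (cadj x) $$ (l, q) * \<sigma> U $$ (q, j)))"
  proof (rule Bochner_Integration.integral_cong)
    fix x assume "x \<in> space haar"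
    then have x: "x \<in> SU2" by simp
    have "cadj (cadj U ** x) = cadj x ** U" by (simp add: cadj_mult)
    then have "\<sigma> (cadj (cadj U ** x)) $$ (l, j) = (\<Sum>q<d'. \<sigma> (cadj x) $$ (l, q) * \<sigma> U $$ (q, j))"
      using mat_mult_index[OF l j \<sigma>c[OF SU2_cadj[OF x]] \<sigma>c[OF U]] is_repD(3)[OF \<sigma> SU2_cadj[OF x] U] by simp
    then show "\<rho> x $$ (i, k) * \<sigma> (cadj (cadj U ** x)) $$ (l, j) = (\<Sum>q<d'. \<rho> x $$ (i, k) * \<sigma> (cadj x) $$ (l, q) * \<sigma> U $$ (q, j))"
      by (simp add: sum_distrib_left mult.assoc)
  qed simp
  also have "\<dots> = (\<Sum>q<d'. LINT x|haar. \<rho> x $$ (i, k) * \<sigma> (cadj x) $$ (l, q) * \<sigma> U $$ (q, j))"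
    by (rule Bochner_Integration.integral_sum) (use i j k l in \<open>auto intro!: haar_integrable continuous_intros cont\<close>)
  also have "\<dots> = (\<Sum>q<d'. ?T $$ (i, q) * \<sigma> U $$ (q, j))"
    using i by (intro sum.cong) (auto simp: avg_mat_def)
  also have "\<dots> = (?T * \<sigma> U) $$ (i, j)"
    using mat_mult_index[OF i j T \<sigma>c[OF U]] by simp
  finally show "(\<rho> U * ?T) $$ (i, j) = (?T * \<sigma> U) $$ (i, j)" .
qed (use is_repD(1)[OF \<rho> U] is_repD(1)[OF \<sigma> U] in \<open>auto simp: avg_mat_def\<close>)

text \<open>Were all averages between \<rho> and the form representations zero, an entry of
  \<rho>(x^-1) would be orthogonal to all their coefficients and hence vanish identically; but its
  (0, 0) entry is 1 at the identity. A nonzero average is an isomorphism by Schur.\<close>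

theorem irrep_classification:
  assumes \<rho>: "is_irrep d \<rho>"
  shows "\<exists>n T S. d = Suc n \<and> T \<in> carrier_mat d d \<and> S \<in> carrier_mat d d \<and> T * S = 1\<^sub>m d \<and> S * T = 1\<^sub>m d \<and>
    (\<forall>U\<in>SU2. \<rho> U * T = T * sym_rep n U)"
proof -
  note rep = is_irrepD(1)[OF \<rho>] and d = is_irrepD(2)[OF \<rho>]
  have "\<exists>n k l. k < d \<and> l < Suc n \<and> avg_mat d \<rho> (Suc n) (sym_rep n) k l \<noteq> 0\<^sub>m d (Suc n)"
  proof (rule ccontr)
    assume "\<not> ?thesis"
    then have z: "avg_mat d \<rho> (Suc n) (sym_rep n) k l = 0\<^sub>m d (Suc n)" if "k < d" "l < Suc n" for n k l
      using that by auto
    have c0: "continuous_on SU2 (\<lambda>x. \<rho> (cadj x) $$ (0, 0))"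
      by (rule continuous_on_compose2[OF is_repD(4)[OF rep d d]]) (auto intro!: continuous_intros)
    have "\<rho> (cadj \<I>) $$ (0, 0) = 0"
    proof (rule sym_rep_complete[OF c0])
      fix n l j :: nat assume lj: "l \<le> n" "j \<le> n"
      have c: "continuous_on SU2 (\<lambda>x. \<rho> (cadj x) $$ (0, 0) * sym_rep n x $$ (l, j))"
        unfolding sym_rep_form_coeff[OF lj] by (intro continuous_intros c0)
      have "(LINT x|haar. \<rho> (cadj x) $$ (0, 0) * sym_rep n x $$ (l, j))
          = (LINT x|haar. \<rho> (cadj (cadj x)) $$ (0, 0) * sym_rep n (cadj x) $$ (l, j))"
        by (rule haar_integral_cadj[OF c, symmetric])
      also have "\<dots> = avg_mat d \<rho> (Suc n) (sym_rep n) 0 l $$ (0, j)"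
        using d lj by (simp add: avg_mat_def del: sym_rep_index)
      also have "\<dots> = 0" using z[OF d, of l n] d lj by simp
      finally show "(LINT x|haar. \<rho> (cadj x) $$ (0, 0) * sym_rep n x $$ (l, j)) = 0" .
    qed simp
    then show False using is_repD(2)[OF rep] d by simp
  qed
  then obtain n k l where kl: "k < d" "l < Suc n" and T0: "avg_mat d \<rho> (Suc n) (sym_rep n) k l \<noteq> 0\<^sub>m d (Suc n)"
    by blast
  let ?T = "avg_mat d \<rho> (Suc n) (sym_rep n) k l"
  have T: "?T \<in> carrier_mat d (Suc n)" by (simp add: avg_mat_def)
  note comm = avg_mat_intertwines[OF rep is_rep_sym_rep kl]
  from intertwiner_inverse[OF \<rho> is_irrep_sym_rep T comm T0] T comm
  show ?thesis by metis
qed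

lemma avg_mat_sym_rep_neq:
  assumes "m \<noteq> n" "k \<le> m" "l \<le> n"
  shows "avg_mat (Suc m) (sym_rep m) (Suc n) (sym_rep n) k l = 0\<^sub>m (Suc m) (Suc n)"
proof (rule ccontr)
  assume T0: "\<not> ?thesis"
  have "Suc m = Suc n"
    using intertwiner_inverse[OF is_irrep_sym_rep is_irrep_sym_rep _ _ T0]
      avg_mat_intertwines[OF is_rep_sym_rep is_rep_sym_rep, of k m l n] assms
    by (auto simp: avg_mat_def)
  then show False using assms by simp
qed

text \<open>The average is scalar, and its trace is the integral of entry (\<open>l\<close>,
  \<open>k\<close>) of \<open>sym_rep n (cadj x) * sym_rep n x\<close>, the identity matrix. The
  total mass appears because \<open>haar\<close> is not normalised.\<close>

lemma avg_mat_sym_rep_eq: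
  assumes "k \<le> n" "l \<le> n"
  shows "avg_mat (Suc n) (sym_rep n) (Suc n) (sym_rep n) k l
     = (if k = l then of_real (measure haar SU2) / of_nat (Suc n) else 0) \<cdot>\<^sub>m 1\<^sub>m (Suc n)"
proof -
  let ?T = "avg_mat (Suc n) (sym_rep n) (Suc n) (sym_rep n) k l"
  have "\<exists>c. ?T = c \<cdot>\<^sub>m 1\<^sub>m (Suc n)"
    by (rule schur_scalar[OF is_irrep_sym_rep])
      (use assms avg_mat_intertwines[OF is_rep_sym_rep is_rep_sym_rep, of k n l n] in \<open>auto simp: avg_mat_def\<close>)
  then obtain c where c: "?T = c \<cdot>\<^sub>m 1\<^sub>m (Suc n)" ..
  have cont: "continuous_on SU2 (\<lambda>x. sym_rep n x $$ (i, k) * sym_rep n (cadj x) $$ (l, i))" if "i \<le> n" for i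
    using that assms by (auto simp: form_coeff_def[symmetric] intro!: continuous_intros)
  have "of_nat (Suc n) * c = (\<Sum>i<Suc n. ?T $$ (i, i))" by (simp add: c)
  also have "\<dots> = (\<Sum>i<Suc n. LINT x|haar. sym_rep n x $$ (i, k) * sym_rep n (cadj x) $$ (l, i))"
    by (intro sum.cong) (auto simp: avg_mat_def simp del: sym_rep_index)
  also have "\<dots> = (LINT x|haar. (\<Sum>i<Suc n. sym_rep n x $$ (i, k) * sym_rep n (cadj x) $$ (l, i)))"
    by (rule Bochner_Integration.integral_sum[symmetric]) (auto intro!: haar_integrable cont simp del: sym_rep_index)
  also have "\<dots> = (LINT x|haar. (if k = l then 1 else 0))"
  proof (rule Bochner_Integration.integral_cong)
    fix x assume "x \<in> space haar"
    then have x: "x \<in> SU2" by simp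
    have "(\<Sum>i<Suc n. sym_rep n x $$ (i, k) * sym_rep n (cadj x) $$ (l, i)) = (sym_rep n (cadj x) * sym_rep n x) $$ (l, k)"
      using assms by (subst mat_mult_index[of l "Suc n" k "Suc n" _ "Suc n"]) (auto simp: mult.commute)
    also have "\<dots> = (1\<^sub>m (Suc n)) $$ (l, k)"
      using x by (simp add: sym_rep_mult[symmetric] sym_rep_one)
    finally show "(\<Sum>i<Suc n. sym_rep n x $$ (i, k) * sym_rep n (cadj x) $$ (l, i)) = (if k = l then 1 else 0)"
      using assms by auto
  qed simp
  also have "\<dots> = (if k = l then of_real (measure haar SU2) else 0)"
    by (simp add: c_scaleR)
  finally have "c = (if k = l then of_real (measure haar SU2) / of_nat (Suc n) else 0)"
    by (auto simp: field_simps simp del: of_nat_Suc split: if_splits)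
  then show ?thesis using c by simp
qed

text \<open>The composite of the two antilinear maps is linear and equivariant, so it is a scalar c.
  Then K is \<open>cnj c\<close> times J, and the square of K is the nonnegative number |c|^2, which
  cannot be -1.\<close>

lemma real_quaternionic_exclusive:
  assumes \<rho>: "is_irrep d \<rho>" and r: "real_type d \<rho>" and q: "quaternionic_type d \<rho>"
  shows False
proof -
  note \<rho>c = is_repD(1)[OF is_irrepD(1)[OF \<rho>]]
  obtain J where J: "conj_linear_Gmap d \<rho> J" "\<And>v. v \<in> carrier_vec d \<Longrightarrow> J (J v) = v"
    using r unfolding real_type_def by auto
  obtain K where K: "conj_linear_Gmap d \<rho> K" "\<And>v. v \<in> carrier_vec d \<Longrightarrow> K (K v) = - v"
    using q unfolding quaternionic_type_def by auto
  note J' = J(1)[unfolded conj_linear_Gmap_def] and K' = K(1)[unfolded conj_linear_Gmap_def]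
  let ?F = "\<lambda>v. J (K v)"
  define T where "T = Matrix.mat d d (\<lambda>(i, j). ?F (unit_vec d j) $ i)"
  have T: "T \<in> carrier_mat d d" by (simp add: T_def)
  have F: "?F v \<in> carrier_vec d" if "v \<in> carrier_vec d" for v using J' K' that by auto
  have Fadd: "?F (v + w) = ?F v + ?F w" if "v \<in> carrier_vec d" "w \<in> carrier_vec d" for v w
    using J' K' that by auto
  have Fs: "?F (c \<cdot>\<^sub>v v) = c \<cdot>\<^sub>v ?F v" if "v \<in> carrier_vec d" for c v
    using J' K' that by auto
  have Tv: "T *\<^sub>v v = ?F v" if v: "v \<in> carrier_vec d" for v
  proof -
    let ?t = "\<lambda>m. vec d (\<lambda>i. if i < m then v $ i else 0)"
    have "T *\<^sub>v ?t m = ?F (?t m)" if "m \<le> d" for m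
      using that
    proof (induction m)
      case 0
      have z: "?t 0 = 0 \<cdot>\<^sub>v 0\<^sub>v d" by (rule eq_vecI) auto
      have "?F (?t 0) = 0 \<cdot>\<^sub>v ?F (0\<^sub>v d)" unfolding z by (rule Fs) simp
      also have "\<dots> = 0\<^sub>v d" using F[of "0\<^sub>v d"] by (intro eq_vecI) auto
      finally have "?F (?t 0) = 0\<^sub>v d" .
      moreover have "T *\<^sub>v ?t 0 = 0\<^sub>v d" using T by (intro eq_vecI) (auto simp: scalar_prod_def)
      ultimately show ?case by simp
    next
      case (Suc m)
      have s: "?t (Suc m) = ?t m + v $ m \<cdot>\<^sub>v unit_vec d m"
        using Suc.prems by (intro eq_vecI) (auto simp: less_Suc_eq unit_vec_def)
      have "T *\<^sub>v unit_vec d m = ?F (unit_vec d m)"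
        using Suc.prems F[of "unit_vec d m"] by (subst mult_mat_unit_vec[OF T]) (auto simp: T_def intro!: eq_vecI)
      then show ?case unfolding s using Suc T F
        by (subst Fadd) (auto simp: mult_add_distrib_mat_vec[of _ d d] mult_mat_vec[of _ d d] Fs)
    qed
    moreover have "?t d = v" using v by (intro eq_vecI) auto
    ultimately show ?thesis by (metis order_refl)
  qed
  have "\<exists>c. T = c \<cdot>\<^sub>m 1\<^sub>m d"
  proof (rule schur_scalar[OF \<rho> T])
    fix U assume U: "U \<in> SU2"
    show "\<rho> U * T = T * \<rho> U"
    proof (rule mat_eqI_mult_vec)
      fix v :: "complex Matrix.vec" assume v: "v \<in> carrier_vec d"
      have "(\<rho> U * T) *\<^sub>v v = \<rho> U *\<^sub>v ?F v" using assoc_mult_mat_vec[OF \<rho>c[OF U] T v] Tv[OF v] by simp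
      also have "\<dots> = ?F (\<rho> U *\<^sub>v v)" using J' K' U v by auto
      also have "\<dots> = (T * \<rho> U) *\<^sub>v v"
        using assoc_mult_mat_vec[OF T \<rho>c[OF U] v] Tv[OF mult_mat_vec_carrier[OF \<rho>c[OF U] v]] by simp
      finally show "(\<rho> U * T) *\<^sub>v v = (T * \<rho> U) *\<^sub>v v" .
    qed (use T \<rho>c[OF U] in auto)
  qed
  then obtain c where c: "T = c \<cdot>\<^sub>m 1\<^sub>m d" ..
  have Fc: "?F v = c \<cdot>\<^sub>v v" if "v \<in> carrier_vec d" for v
  proof -
    have "(c \<cdot>\<^sub>m 1\<^sub>m d) *\<^sub>v v = c \<cdot>\<^sub>v v" using that by (intro eq_vecI) auto
    then show ?thesis using Tv[OF that] unfolding c by simp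
  qed
  have Kv: "K v = cnj c \<cdot>\<^sub>v J v" if v: "v \<in> carrier_vec d" for v
  proof -
    have "K v = J (?F v)" using J(2)[of "K v"] K' v by auto
    then show ?thesis unfolding Fc[OF v] using J' v by auto
  qed
  define v :: "complex Matrix.vec" where "v = unit_vec d 0"
  have v: "v \<in> carrier_vec d" by (simp add: v_def)
  then have Jv: "J v \<in> carrier_vec d" using J' by auto
  have "- v = K (K v)" using K(2)[OF v] by simp
  also have "\<dots> = cnj c \<cdot>\<^sub>v J (cnj c \<cdot>\<^sub>v J v)" using Kv v Jv by simp
  also have "\<dots> = (cnj c * c) \<cdot>\<^sub>v v" using J' J(2)[OF v] Jv by (simp add: smult_smult_assoc)
  finally have "(- v) $ 0 = ((cnj c * c) \<cdot>\<^sub>v v) $ 0" by simp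
  then have "- 1 = cnj c * c" using is_irrepD(2)[OF \<rho>] by (simp add: v_def)
  also have "cnj c * c = of_real ((cmod c)\<^sup>2)" using complex_norm_square[of c] by (simp only: mult.commute)
  finally have "of_real (- 1) = complex_of_real ((cmod c)\<^sup>2)" by simp
  then have "- 1 = (cmod c)\<^sup>2" by (simp only: of_real_eq_iff)
  then show False using zero_le_power2[of "cmod c"] by linarith
qed

subsection \<open>Metrics with tridiagonal Laplacian: resultant witnesses\<close>

lemma resultant_nonzeroI:
  fixes p q :: "complex poly"
  assumes "p \<noteq> 0" and "\<And>z. poly p z = 0 \<Longrightarrow> poly q z = 0 \<Longrightarrow> False"
  shows "resultant p q \<noteq> 0"
proof
  assume "resultant p q = 0"
  then have "degree (gcd p q) \<noteq> 0" by (simp add: resultant_0_gcd)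
  then obtain z where "poly (gcd p q) z = 0"
    using fundamental_theorem_of_algebra[of "gcd p q"] by (auto simp: constant_degree)
  then have "[:- z, 1:] dvd gcd p q" by (simp add: poly_eq_0_iff_dvd)
  then have "[:- z, 1:] dvd p" "[:- z, 1:] dvd q" by auto
  then show False using assms(2)[of z] by (simp add: poly_eq_0_iff_dvd)
qed

lemma resultant_common_root:
  fixes p q :: "complex poly"
  assumes "p \<noteq> 0" "poly p z = 0" "poly q z = 0"
  shows "resultant p q = 0"
proof -
  have "[:- z, 1:] dvd gcd p q" using assms by (simp add: poly_eq_0_iff_dvd)
  then have "degree (gcd p q) \<ge> 1" using assms(1) dvd_imp_degree_le[of "[:- z, 1:]" "gcd p q"] by simp
  then show ?thesis by (simp add: resultant_0_gcd)
qed

section \<open>Tridiagonal determinants and simplicity of their roots\<close>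

definition tridiag :: "(nat \<Rightarrow> 'a) \<Rightarrow> (nat \<Rightarrow> 'a) \<Rightarrow> (nat \<Rightarrow> 'a) \<Rightarrow> nat \<Rightarrow> 'a::zero mat" where
  "tridiag a u l k = Matrix.mat k k (\<lambda>(i, j). if i = j then a i else if j = Suc i then u i else if i = Suc j then l j else 0)"

lemma tridiag_carrier [simp]: "tridiag a u l k \<in> carrier_mat k k"
  by (simp add: tridiag_def)

text \<open>Expansion along the last row leaves two minors, and the last column of the second one
  has a single entry. Opposite off-diagonal entries enter only through their product.\<close>

lemma det_tridiag:
  fixes a :: "nat \<Rightarrow> 'a::comm_ring_1"
  shows "det (tridiag a u l (Suc (Suc k)))
    = a (Suc k) * det (tridiag a u l (Suc k)) - u k * l k * det (tridiag a u l k)"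
proof -
  let ?A = "tridiag a u l (Suc (Suc k))"
  let ?B = "mat_delete ?A (Suc k) k"
  have A: "?A \<in> carrier_mat (Suc (Suc k)) (Suc (Suc k))" by simp
  have B: "?B \<in> carrier_mat (Suc k) (Suc k)" by (simp add: mat_delete_def tridiag_def)
  have d1: "mat_delete ?A (Suc k) (Suc k) = tridiag a u l (Suc k)"
    by (rule eq_matI) (auto simp: mat_delete_def tridiag_def)
  have d2: "mat_delete ?B k k = tridiag a u l k"
    by (rule eq_matI) (auto simp: mat_delete_def tridiag_def)
  have Bk: "?B $$ (i, k) = (if i = k then u k else 0)" if "i < Suc k" for i
    using that by (auto simp: mat_delete_def tridiag_def)
  have "det ?B = (\<Sum>i<Suc k. ?B $$ (i, k) * cofactor ?B i k)"
    by (rule laplace_expansion_column[OF B]) simp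
  also have "\<dots> = (\<Sum>i<Suc k. if i = k then u k * cofactor ?B k k else 0)"
    by (intro sum.cong) (auto simp: Bk)
  also have "\<dots> = u k * det (tridiag a u l k)"
    by (simp add: cofactor_def d2)
  finally have dB: "det ?B = u k * det (tridiag a u l k)" .
  have "det ?A = (\<Sum>j<Suc (Suc k). ?A $$ (Suc k, j) * cofactor ?A (Suc k) j)"
    by (rule laplace_expansion_row[OF A]) simp
  also have "\<dots> = (\<Sum>j\<in>{k, Suc k}. ?A $$ (Suc k, j) * cofactor ?A (Suc k) j)"
    by (rule sum.mono_neutral_right) (auto simp: tridiag_def)
  also have "\<dots> = ?A $$ (Suc k, k) * cofactor ?A (Suc k) k + ?A $$ (Suc k, Suc k) * cofactor ?A (Suc k) (Suc k)"
    by simp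
  also have "cofactor ?A (Suc k) k = - det ?B"
    by (simp add: cofactor_def)
  also have "cofactor ?A (Suc k) (Suc k) = det (tridiag a u l (Suc k))"
    by (simp add: cofactor_def d1)
  also have "?A $$ (Suc k, k) = l k" by (simp add: tridiag_def)
  also have "?A $$ (Suc k, Suc k) = a (Suc k)" by (simp add: tridiag_def)
  finally show ?thesis by (simp add: dB algebra_simps)
qed

text \<open>The three-term recurrence of monic orthogonal polynomials: \<alpha> is the diagonal of a
  Jacobi matrix and \<beta> the products of opposite off-diagonal entries. Positive products suffice
  for simple roots, so the matrix itself may be unsymmetric.\<close>

fun jacobi_poly :: "(nat \<Rightarrow> real) \<Rightarrow> (nat \<Rightarrow> real) \<Rightarrow> nat \<Rightarrow> complex poly" where
  "jacobi_poly \<alpha> \<beta> 0 = 1"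
| "jacobi_poly \<alpha> \<beta> (Suc 0) = [:- of_real (\<alpha> 0), 1:]"
| "jacobi_poly \<alpha> \<beta> (Suc (Suc k)) = [:- of_real (\<alpha> (Suc k)), 1:] * jacobi_poly \<alpha> \<beta> (Suc k)
     - smult (of_real (\<beta> k)) (jacobi_poly \<alpha> \<beta> k)"

lemma char_poly_tridiag:
  assumes "\<And>k. u k * l k = of_real (\<beta> k)"
  shows "char_poly (tridiag (\<lambda>i. of_real (\<alpha> i)) u l k) = jacobi_poly \<alpha> \<beta> k"
proof -
  let ?a = "\<lambda>i. [:- of_real (\<alpha> i), 1:] :: complex poly"
  have "char_poly_matrix (tridiag (\<lambda>i. of_real (\<alpha> i)) u l k) = tridiag ?a (\<lambda>i. [:- u i:]) (\<lambda>i. [:- l i:]) k" for k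
    by (rule eq_matI) (auto simp: char_poly_matrix_def tridiag_def)
  then have cp: "char_poly (tridiag (\<lambda>i. of_real (\<alpha> i)) u l k) = det (tridiag ?a (\<lambda>i. [:- u i:]) (\<lambda>i. [:- l i:]) k)" for k
    by (simp add: char_poly_def)
  show ?thesis unfolding cp
  proof (induction k rule: induct_nat_012)
    case 0
    show ?case by (simp add: det_dim_zero[OF tridiag_carrier])
  next
    case 1
    show ?case by (subst det_single[OF tridiag_carrier, simplified]) (simp add: tridiag_def)
  next
    case (ge2 k)
    have lu: "l k * u k = of_real (\<beta> k)" using assms[of k] by (simp only: mult.commute[of "l k"])
    have "[:- l k:] * [:- u k:] = [:of_real (\<beta> k):]" "[:- u k:] * [:- l k:] = [:of_real (\<beta> k):]"
      using lu assms[of k] by simp_all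
    then show ?case using ge2 unfolding det_tridiag jacobi_poly.simps by (simp add: mult.commute[of "l k"])
  qed
qed

text \<open>Complex zeros: the imaginary part of \<open>cnj q\<^sub>k(z) * q\<^sub>k\<^sub>+\<^sub>1(z)\<close> has the sign of \<open>Im z\<close>. Real zeros are
  simple because the Wronskian \<open>q\<^sub>k q\<^sub>k\<^sub>+\<^sub>1' - q\<^sub>k' q\<^sub>k\<^sub>+\<^sub>1\<close> stays positive on the real line.\<close>
lemma jacobi_poly_simple_roots:
  assumes \<beta>: "\<And>i. i < k \<Longrightarrow> \<beta> i > 0" and root: "poly (jacobi_poly \<alpha> \<beta> (Suc k)) z = 0"
  shows "poly (pderiv (jacobi_poly \<alpha> \<beta> (Suc k))) z \<noteq> 0"
proof -
  define q where "q i = poly (jacobi_poly \<alpha> \<beta> i) z" for i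
  define q' where "q' i = poly (pderiv (jacobi_poly \<alpha> \<beta> i)) z" for i
  have q0: "q 0 = 1" "q 1 = z - of_real (\<alpha> 0)" and qS: "q (Suc (Suc i)) = (z - of_real (\<alpha> (Suc i))) * q (Suc i) - of_real (\<beta> i) * q i" for i
    by (simp_all add: q_def algebra_simps)
  have q'0: "q' 0 = 0" "q' 1 = 1" and q'S: "q' (Suc (Suc i)) = q (Suc i) + (z - of_real (\<alpha> (Suc i))) * q' (Suc i) - of_real (\<beta> i) * q' i" for i
    unfolding q_def q'_def jacobi_poly.simps pderiv_diff pderiv_mult pderiv_smult One_nat_def
    by (simp_all add: pderiv_pCons algebra_simps)
  have "Im z = 0"
  proof (rule ccontr)
    assume y: "Im z \<noteq> 0"
    have "Im z * Im (cnj (q i) * q (Suc i)) > 0" if "i \<le> k" for i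
      using that
    proof (induction i)
      case 0
      then show ?case using y q0 by (auto simp: zero_less_mult_iff linorder_neq_iff)
    next
      case (Suc i)
      have e: "Im (cnj (q (Suc i)) * q (Suc (Suc i))) = Im z * (cmod (q (Suc i)))\<^sup>2 + \<beta> i * Im (cnj (q i) * q (Suc i))"
        unfolding qS cmod_power2 by (simp add: algebra_simps power2_eq_square)
      have "Im z * Im (cnj (q (Suc i)) * q (Suc (Suc i)))
         = (Im z)\<^sup>2 * (cmod (q (Suc i)))\<^sup>2 + \<beta> i * (Im z * Im (cnj (q i) * q (Suc i)))"
        unfolding e by (simp only: distrib_left power2_eq_square mult_ac)
      moreover have "\<beta> i * (Im z * Im (cnj (q i) * q (Suc i))) > 0" using Suc \<beta>[of i] by simp
      ultimately show ?case by (simp add: add_nonneg_pos)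
    qed
    from this[of k] show False using root by (simp add: q_def)
  qed
  then have zr: "z \<in> \<real>" by (simp add: complex_is_Real_iff)
  have qr: "q i \<in> \<real> \<and> q (Suc i) \<in> \<real>" for i
    by (induction i) (auto simp: q0[simplified] qS zr)
  have "\<exists>w>0. q i * q' (Suc i) - q' i * q (Suc i) = of_real w" if "i \<le> k" for i
    using that
  proof (induction i)
    case 0
    show ?case using q0 q'0 by (intro exI[of _ 1]) simp
  next
    case (Suc i)
    then obtain w where w: "w > 0" "q i * q' (Suc i) - q' i * q (Suc i) = of_real w" by auto
    obtain t where t: "q (Suc i) = of_real t" using qr[of i] by (auto elim: Reals_cases)
    have "q (Suc i) * q' (Suc (Suc i)) - q' (Suc i) * q (Suc (Suc i))
       = q (Suc i) * q (Suc i) + of_real (\<beta> i) * (q i * q' (Suc i) - q' i * q (Suc i))"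
      unfolding qS q'S by (simp add: algebra_simps)
    also have "\<dots> = of_real (t * t + \<beta> i * w)" unfolding w(2) unfolding t by simp
    finally show ?case using w \<beta>[of i] Suc.prems by (intro exI[of _ "t * t + \<beta> i * w"]) (simp add: add_nonneg_pos)
  qed
  from this[of k] obtain w where "w > 0" "q k * q' (Suc k) - q' k * q (Suc k) = of_real w" by auto
  then show ?thesis using root by (auto simp: q_def q'_def)
qed

lemma jacobi_poly_nonzero: "degree (jacobi_poly \<alpha> \<beta> k) = k \<and> jacobi_poly \<alpha> \<beta> k \<noteq> 0"
proof (induction \<alpha> \<beta> k rule: jacobi_poly.induct)
  case (3 \<alpha> \<beta> k)
  let ?p = "[:- of_real (\<alpha> (Suc k)), 1:] * jacobi_poly \<alpha> \<beta> (Suc k)"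
  have d: "degree ?p = Suc (Suc k)" using 3 by (subst degree_mult_eq) auto
  moreover have "degree (smult (of_real (\<beta> k)) (jacobi_poly \<alpha> \<beta> k)) < Suc (Suc k)"
    using 3 by (auto intro: le_less_trans[OF degree_smult_le])
  ultimately have "degree (jacobi_poly \<alpha> \<beta> (Suc (Suc k))) = Suc (Suc k)"
    unfolding jacobi_poly.simps by (metis (no_types, lifting) degree_add_eq_left degree_minus diff_conv_add_uminus)
  then show ?case by (metis degree_0 nat.distinct(1))
qed auto

section \<open>Matrices of the Laplacian and the three explicit triples\<close>

type_synonym tri = "m2 \<times> m2 \<times> m2"

text \<open>By left invariance, the Laplacian for which \<open>(X, Y, Z)\<close> is orthonormal multiplies the matrix \<open>sym_rep n\<close> from
  the right by this matrix.\<close>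
definition lap_mat :: "nat \<Rightarrow> tri \<Rightarrow> complex mat" where
  "lap_mat n = (\<lambda>(X, Y, Z). Matrix.mat (Suc n) (Suc n) (\<lambda>(j, k).
      - (\<Sum>l\<le>n. dent n X j l * dent n X l k + dent n Y j l * dent n Y l k + dent n Z j l * dent n Z l k)))"

lemma lap_mat_carrier [simp]: "lap_mat n X \<in> carrier_mat (Suc n) (Suc n)"
  by (simp add: lap_mat_def split: prod.split)

lemma lap_mat_dim [simp]: "dim_row (lap_mat n X) = Suc n" "dim_col (lap_mat n X) = Suc n"
  by (simp_all add: lap_mat_def split: prod.split)

text \<open>A tridiagonal factor leaves three terms. Neighbours outside the index range do no harm:
  at \<open>k = 0\<close> and \<open>k = n\<close> their coefficients \<open>k\<close> and
  \<open>n - k\<close> vanish.\<close>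

lemma dent_mult:
  assumes "k \<le> n"
  shows "(\<Sum>l\<le>n. dent n X j l * dent n Y l k)
    = of_nat k * Y $v 2 $v 1 * dent n X j (k - 1)
    + (of_nat k * Y $v 1 $v 1 + of_nat (n - k) * Y $v 2 $v 2) * dent n X j k
    + of_nat (n - k) * Y $v 1 $v 2 * dent n X j (Suc k)"
proof -
  have "dent n X j l * dent n Y l k = (if l = k - 1 then of_nat k * Y $v 2 $v 1 * dent n X j l else 0)
    + (if l = k then (of_nat k * Y $v 1 $v 1 + of_nat (n - k) * Y $v 2 $v 2) * dent n X j l else 0)
    + (if l = Suc k then of_nat (n - k) * Y $v 1 $v 2 * dent n X j l else 0)" for l
    unfolding dent_def[of n Y l k] by (cases k) (auto simp: algebra_simps)
  then have "(\<Sum>l\<le>n. dent n X j l * dent n Y l k)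
    = (\<Sum>l\<le>n. if l = k - 1 then of_nat k * Y $v 2 $v 1 * dent n X j l else 0)
    + (\<Sum>l\<le>n. if l = k then (of_nat k * Y $v 1 $v 1 + of_nat (n - k) * Y $v 2 $v 2) * dent n X j l else 0)
    + (\<Sum>l\<le>n. if l = Suc k then of_nat (n - k) * Y $v 1 $v 2 * dent n X j l else 0)"
    by (simp add: sum.distrib)
  also have "(\<Sum>l\<le>n. if l = k - 1 then of_nat k * Y $v 2 $v 1 * dent n X j l else 0) = of_nat k * Y $v 2 $v 1 * dent n X j (k - 1)"
    using assms by (subst sum.delta) auto
  also have "(\<Sum>l\<le>n. if l = k then (of_nat k * Y $v 1 $v 1 + of_nat (n - k) * Y $v 2 $v 2) * dent n X j l else 0)
     = (of_nat k * Y $v 1 $v 1 + of_nat (n - k) * Y $v 2 $v 2) * dent n X j k"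
    using assms by (subst sum.delta) auto
  also have "(\<Sum>l\<le>n. if l = Suc k then of_nat (n - k) * Y $v 1 $v 2 * dent n X j l else 0)
     = of_nat (n - k) * Y $v 1 $v 2 * dent n X j (Suc k)"
    using assms by (subst sum.delta) auto
  finally show ?thesis .
qed

text \<open>Up to sign, \<open>E1\<close>, \<open>J0\<close> and \<open>E3\<close> are i times the
  Pauli matrices. \<open>E3\<close> acts diagonally on monomials, \<open>E1\<close> and
  \<open>J0\<close> shift the exponent by one.\<close>

definition E1 :: m2 where "E1 = (\<chi> i j. if i = j then 0 else \<i>)"
definition E3 :: m2 where "E3 = (\<chi> i j. if i = j then (if i = 1 then \<i> else - \<i>) else 0)"

lemma E_nth [simp]:
  "E1 $v 1 $v 1 = 0" "E1 $v 1 $v 2 = \<i>" "E1 $v 2 $v 1 = \<i>" "E1 $v 2 $v 2 = 0"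
  "E3 $v 1 $v 1 = \<i>" "E3 $v 1 $v 2 = 0" "E3 $v 2 $v 1 = 0" "E3 $v 2 $v 2 = - \<i>"
  by (simp_all add: E1_def E3_def)

lemma E_su2 [simp]: "E1 \<in> su2" "E3 \<in> su2" "J0 \<in> su2" "E1 + E3 \<in> su2" "0 \<in> su2"
  by (simp_all add: su2_iff)

lemma lap_mat_index:
  assumes "j \<le> n" "k \<le> n"
  shows "lap_mat n (X, Y, Z) $$ (j, k) = - ((\<Sum>l\<le>n. dent n X j l * dent n X l k)
    + (\<Sum>l\<le>n. dent n Y j l * dent n Y l k) + (\<Sum>l\<le>n. dent n Z j l * dent n Z l k))"
  using assms by (simp add: lap_mat_def sum.distrib)

text \<open>The sum of the three squares is the Casimir element; the value is 4 l (l + 1) for spin l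
  = n / 2.\<close>

lemma lap_mat_casimir: "lap_mat n (E1, J0, E3) = of_nat (n * (n + 2)) \<cdot>\<^sub>m 1\<^sub>m (Suc n)"
proof (rule eq_matI)
  fix j k assume "j < dim_row (of_nat (n * (n + 2)) \<cdot>\<^sub>m 1\<^sub>m (Suc n) :: complex mat)"
    "k < dim_col (of_nat (n * (n + 2)) \<cdot>\<^sub>m 1\<^sub>m (Suc n) :: complex mat)"
  then have jk: "j \<le> n" "k \<le> n" by auto
  then obtain m where m: "n = k + m" using le_Suc_ex by blast
  show "lap_mat n (E1, J0, E3) $$ (j, k) = (of_nat (n * (n + 2)) \<cdot>\<^sub>m 1\<^sub>m (Suc n)) $$ (j, k)"
    using jk unfolding lap_mat_index[OF jk] dent_mult[OF jk(2)] unfolding m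
    by (cases k; cases m) (auto simp: dent_def algebra_simps)
qed auto

lemma lap_mat_diagonal:
  assumes "j \<le> n" "k \<le> n"
  shows "lap_mat n (E3, 0, 0) $$ (j, k) = (if j = k then of_real ((2 * real k - real n)\<^sup>2) else 0)"
proof -
  obtain m where m: "n = k + m" using assms le_Suc_ex by blast
  show ?thesis
    using assms unfolding lap_mat_index[OF assms] dent_mult[OF assms(2)] unfolding m
    by (auto simp: dent_def algebra_simps power2_eq_square)
qed

text \<open>Since (E1 + E3)^2 + J0^2 is the Casimir element plus the anticommutator of
  \<open>E1\<close> and \<open>E3\<close>, the diagonal is the constant n (n + 2). The
  anticommutator moves the exponent by exactly one, weighted by the sum 2 (2 i + 1 - n) of two
  neighbouring weights.\<close>

lemma lap_mat_tridiag:
  "lap_mat n (E1 + E3, J0, 0) = tridiag (\<lambda>i. of_real (real n * (real n + 2)))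
     (\<lambda>i. of_real (2 * (real i + 1) * (2 * real i + 1 - real n)))
     (\<lambda>i. of_real (2 * (real n - real i) * (2 * real i + 1 - real n))) (Suc n)" (is "_ = ?R")
proof (rule eq_matI)
  fix j k assume "j < dim_row ?R" "k < dim_col ?R"
  then have jk: "j \<le> n" "k \<le> n" by (auto simp: tridiag_def)
  then obtain m where m: "n = k + m" using le_Suc_ex by blast
  show "lap_mat n (E1 + E3, J0, 0) $$ (j, k) = ?R $$ (j, k)"
    using jk unfolding lap_mat_index[OF jk] dent_mult[OF jk(2)] unfolding m tridiag_def
    by (cases k; cases m) (auto simp: dent_def algebra_simps)
qed (auto simp: tridiag_def)

lemma lap_mat_casimir_root:
  assumes "poly (char_poly (lap_mat n (E1, J0, E3))) z = 0"
  shows "z = of_nat (n * (n + 2))"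
proof -
  let ?A = "of_nat (n * (n + 2)) \<cdot>\<^sub>m 1\<^sub>m (Suc n) :: complex mat"
  have A: "?A \<in> carrier_mat (Suc n) (Suc n)" by simp
  have "eigenvalue ?A z"
    using assms unfolding lap_mat_casimir eigenvalue_root_char_poly[OF A] .
  then obtain v where v: "v \<in> carrier_vec (Suc n)" "v \<noteq> 0\<^sub>v (Suc n)" "?A *\<^sub>v v = z \<cdot>\<^sub>v v"
    by (auto simp: eigenvalue_def eigenvector_def)
  have "\<exists>i<Suc n. v $ i \<noteq> 0"
  proof (rule ccontr)
    assume "\<not> ?thesis"
    then have "v = 0\<^sub>v (Suc n)" using v(1) by (intro eq_vecI) auto
    then show False using v by simp
  qed
  then obtain i where i: "i < Suc n" "v $ i \<noteq> 0" by auto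
  have "?A *\<^sub>v v = of_nat (n * (n + 2)) \<cdot>\<^sub>v v" using v(1) by (intro eq_vecI) auto
  then have "(of_nat (n * (n + 2)) \<cdot>\<^sub>v v) $ i = (z \<cdot>\<^sub>v v) $ i" using v(3) by simp
  then show ?thesis using i v(1) by simp
qed

lemma casimir_inj: "(of_nat (n * (n + 2)) :: complex) = of_nat (m * (m + 2)) \<Longrightarrow> n = m"
proof -
  assume "(of_nat (n * (n + 2)) :: complex) = of_nat (m * (m + 2))"
  then have e: "n * (n + 2) = m * (m + 2)" by (simp only: of_nat_eq_iff)
  have "a * (a + 2) < b * (b + 2)" if "a < b" for a b :: nat
    using that by (intro mult_strict_mono) auto
  then show "n = m" using e by (metis nat_neq_iff)
qed

lemma char_poly_nonzero [simp]: "A \<in> carrier_mat n n \<Longrightarrow> char_poly (A :: complex mat) \<noteq> 0"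
  using degree_monic_char_poly[of A n] by auto

lemma lap_mat_casimir_resultant:
  assumes "n \<noteq> m"
  shows "resultant (char_poly (lap_mat n (E1, J0, E3))) (char_poly (lap_mat m (E1, J0, E3))) \<noteq> 0"
proof (rule resultant_nonzeroI)
  fix z assume "poly (char_poly (lap_mat n (E1, J0, E3))) z = 0" "poly (char_poly (lap_mat m (E1, J0, E3))) z = 0"
  then show False using casimir_inj[of n m] assms by (metis lap_mat_casimir_root)
qed (rule char_poly_nonzero[OF lap_mat_carrier])

text \<open>The product of opposite entries is 4 (i + 1) (n - i) (2 i + 1 - n)^2. It could vanish
  for \<open>i < n\<close> only if \<open>n = 2 * i + 1\<close>, which an even \<open>n\<close>
  excludes; so the roots are simple.\<close>

lemma lap_mat_even_resultant:
  assumes "even n"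
  shows "resultant (char_poly (lap_mat n (E1 + E3, J0, 0))) (pderiv (char_poly (lap_mat n (E1 + E3, J0, 0)))) \<noteq> 0"
proof -
  define \<beta> where "\<beta> i = (2 * (real i + 1) * (2 * real i + 1 - real n)) * (2 * (real n - real i) * (2 * real i + 1 - real n))" for i
  have cp: "char_poly (lap_mat n (E1 + E3, J0, 0)) = jacobi_poly (\<lambda>i. real n * (real n + 2)) \<beta> (Suc n)"
    unfolding lap_mat_tridiag by (rule char_poly_tridiag) (simp add: \<beta>_def)
  have pos: "\<beta> i > 0" if "i < n" for i
  proof -
    have "2 * real i + 1 - real n \<noteq> 0"
    proof
      assume "2 * real i + 1 - real n = 0"
      then have "real (2 * i + 1) = real n" by simp
      then have "2 * i + 1 = n" by (simp only: of_nat_eq_iff)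
      then show False using assms by (metis even_plus_one_iff dvd_triv_left)
    qed
    then have "(2 * real i + 1 - real n)\<^sup>2 > 0" by simp
    then have "(4 * (real i + 1) * (real n - real i)) * (2 * real i + 1 - real n)\<^sup>2 > 0"
      using that by (intro mult_pos_pos) auto
    then show ?thesis by (simp add: \<beta>_def power2_eq_square algebra_simps)
  qed
  show ?thesis
    unfolding cp
    by (rule resultant_nonzeroI) (use jacobi_poly_nonzero jacobi_poly_simple_roots[OF pos] in \<open>auto simp del: jacobi_poly.simps\<close>)
qed

text \<open>The eigenvalues (2 k - n)^2 coincide exactly for \<open>k\<close> and
  \<open>n - k\<close>, which differ because \<open>n\<close> is odd. So every root is exactly
  double, and at a double root the second derivative is twice the complementary factor
  \<open>g\<close>.\<close>

lemma lap_mat_odd_resultant: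
  assumes "odd n"
  shows "resultant (char_poly (lap_mat n (E3, 0, 0))) (pderiv (pderiv (char_poly (lap_mat n (E3, 0, 0))))) \<noteq> 0"
proof -
  define \<mu> where "\<mu> k = complex_of_real ((2 * real k - real n)\<^sup>2)" for k
  have "upper_triangular (lap_mat n (E3, 0, 0))"
    by (rule upper_triangularI) (use lap_mat_carrier[of n "(E3, 0, 0)"] in \<open>auto simp: lap_mat_diagonal less_Suc_eq_le\<close>)
  then have "char_poly (lap_mat n (E3, 0, 0)) = (\<Prod>a\<leftarrow>diag_mat (lap_mat n (E3, 0, 0)). [:- a, 1:])"
    by (rule char_poly_upper_triangular[OF lap_mat_carrier])
  also have "diag_mat (lap_mat n (E3, 0, 0)) = map \<mu> [0..<Suc n]"
    unfolding diag_mat_def lap_mat_dim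
    by (rule map_cong) (auto simp: lap_mat_diagonal \<mu>_def)
  also have "(\<Prod>a\<leftarrow>map \<mu> [0..<Suc n]. [:- a, 1:]) = (\<Prod>k\<in>{0..<Suc n}. [:- \<mu> k, 1:])"
    using prod.distinct_set_conv_list[of "[0..<Suc n]" "\<lambda>k. [:- \<mu> k, 1:]"] distinct_upt[of 0 "Suc n"]
    by (simp only: map_map o_def set_upt)
  finally have cp: "char_poly (lap_mat n (E3, 0, 0)) = (\<Prod>k\<in>{0..<Suc n}. [:- \<mu> k, 1:])" .
  have \<mu>_eq: "\<mu> k = \<mu> l \<longleftrightarrow> k = l \<or> k + l = n" for k l
  proof -
    have "\<mu> k = \<mu> l \<longleftrightarrow> (2 * real k - real n)\<^sup>2 = (2 * real l - real n)\<^sup>2"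
      unfolding \<mu>_def by (rule of_real_eq_iff)
    also have "\<dots> \<longleftrightarrow> real k = real l \<or> real k + real l = real n"
      unfolding power2_eq_iff by auto
    also have "\<dots> \<longleftrightarrow> k = l \<or> k + l = n" by (metis of_nat_add of_nat_eq_iff)
    finally show ?thesis .
  qed
  show ?thesis
  proof (rule resultant_nonzeroI)
    fix z assume z: "poly (char_poly (lap_mat n (E3, 0, 0))) z = 0"
      and z'': "poly (pderiv (pderiv (char_poly (lap_mat n (E3, 0, 0))))) z = 0"
    from z obtain k where "k < Suc n" and kz: "z = \<mu> k"
      unfolding cp poly_prod by (auto simp del: prod.op_ivl_Suc)
    then have k: "k \<le> n" "z = \<mu> k" by simp_all
    define l where "l = n - k"
    have "k \<noteq> l"
    proof
      assume "k = l"
      then have "n = 2 * k" using k by (simp add: l_def)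
      then show False using assms by simp
    qed
    then have l: "l \<le> n" "k + l = n" "k \<noteq> l" using k by (auto simp: l_def)
    define g where "g = (\<Prod>i\<in>{0..<Suc n} - {k, l}. [:- \<mu> i, 1:])"
    have E: "(\<Prod>k\<in>{0..<Suc n}. [:- \<mu> k, 1:]) = [:- z, 1:] * ([:- z, 1:] * g)"
    proof -
      have "(\<Prod>k\<in>{0..<Suc n}. [:- \<mu> k, 1:]) = (\<Prod>i\<in>{k, l}. [:- \<mu> i, 1:]) * g"
        unfolding g_def mult.commute[of "prod _ {k, l}"] by (rule prod.subset_diff) (use k l in auto)
      also have "(\<Prod>i\<in>{k, l}. F i) = F k * F l" for F :: "nat \<Rightarrow> complex poly"
        using l(3) by simp
      finally have "(\<Prod>k\<in>{0..<Suc n}. [:- \<mu> k, 1:]) = [:- \<mu> k, 1:] * [:- \<mu> l, 1:] * g" .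
      moreover have "\<mu> l = z" "\<mu> k = z" using \<mu>_eq[of l k] l k by simp_all
      ultimately show ?thesis by (simp only: mult.assoc)
    qed
    have d1: "pderiv [:- z, 1:] = 1" by (simp add: pderiv_pCons)
    have "poly (pderiv (pderiv (char_poly (lap_mat n (E3, 0, 0))))) z = 2 * poly g z"
      unfolding cp E pderiv_mult pderiv_add d1 poly_add poly_mult by simp
    then have "poly g z = 0" using z'' by simp
    then have "\<exists>i\<in>{0..<Suc n} - {k, l}. poly [:- \<mu> i, 1:] z = 0"
      unfolding g_def poly_prod by (subst (asm) prod_zero_iff) blast+
    then obtain i where i: "i \<in> {0..<Suc n} - {k, l}" and "poly [:- \<mu> i, 1:] z = 0" by blast
    then have "z = \<mu> i" by simp
    then have "i = k \<or> i + k = n" using \<mu>_eq[of i k] k by simp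
    then show False using i l by auto
  qed (rule char_poly_nonzero[OF lap_mat_carrier])
qed

section \<open>Passing from the representation on forms to an isomorphic one\<close>

lemma rep_deriv_carrier [simp]: "rep_deriv d \<rho> Y \<in> carrier_mat d d"
  by (simp add: rep_deriv_def)

lemma D_op_Nil [simp]: "D_op d \<rho> [] = 0\<^sub>m d d"
  by (simp add: D_op_def)

lemma D_op_Cons [simp]: "D_op d \<rho> ((Y, Z) # s) = D_op d \<rho> s + ((- 1 / 2) \<cdot>\<^sub>m
       (rep_deriv d \<rho> Y * rep_deriv d \<rho> Z + rep_deriv d \<rho> Z * rep_deriv d \<rho> Y))"
  by (simp add: D_op_def)

lemma D_op_carrier [simp]: "D_op d \<rho> s \<in> carrier_mat d d"
proof (induction s)
  case (Cons a s)
  have "rep_deriv d \<rho> Y * rep_deriv d \<rho> Z \<in> carrier_mat d d" for Y Z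
    by (rule mult_carrier_mat[OF rep_deriv_carrier rep_deriv_carrier])
  then show ?case using Cons by (cases a) auto
qed simp

lemma D_op_dim [simp]: "dim_row (D_op d \<rho> s) = d" "dim_col (D_op d \<rho> s) = d"
  using D_op_carrier by (auto simp del: D_op_carrier)

lemma p_poly_char_poly: "p_poly d \<rho> s = smult ((- 1) ^ d) (char_poly (D_op d \<rho> s))"
proof -
  let ?A = "D_op d \<rho> s"
  have A: "?A \<in> carrier_mat d d" by simp
  have "map_mat (\<lambda>a. [:a:]) ?A - [:0, 1:] \<cdot>\<^sub>m 1\<^sub>m d = (- 1) \<cdot>\<^sub>m char_poly_matrix ?A"
    by (rule eq_matI) (use A in \<open>auto simp: char_poly_matrix_def\<close>)
  moreover have "dim_col (char_poly_matrix ?A) = d" by (simp add: char_poly_matrix_def)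
  ultimately have "p_poly d \<rho> s = (- 1) ^ d * char_poly ?A"
    by (simp add: p_poly_def char_poly_def)
  also have "(- 1 :: complex poly) ^ d = [:(- 1) ^ d:]"
    by (metis minus_pCons minus_zero one_pCons poly_const_pow)
  finally show ?thesis by simp
qed

lemma p_poly_roots [simp]: "poly (p_poly d \<rho> s) z = 0 \<longleftrightarrow> poly (char_poly (D_op d \<rho> s)) z = 0"
  by (simp add: p_poly_char_poly)

lemma p_poly_nonzero [simp]: "p_poly d \<rho> s \<noteq> 0"
  by (simp add: p_poly_char_poly char_poly_nonzero[OF D_op_carrier])

lemma resultant_p_poly_iff:
  assumes "resultant (char_poly (D_op d \<rho> s)) (char_poly (D_op d' \<sigma> s)) \<noteq> 0"
  shows "resultant (p_poly d \<rho> s) (p_poly d' \<sigma> s) \<noteq> 0"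
  by (rule resultant_nonzeroI)
    (use assms resultant_common_root[OF char_poly_nonzero[OF D_op_carrier]] in auto)

lemma resultant_p_poly_pderiv:
  assumes "resultant (char_poly (D_op d \<rho> s)) (pderiv (char_poly (D_op d \<rho> s))) \<noteq> 0"
  shows "resultant (p_poly d \<rho> s) (pderiv (p_poly d \<rho> s)) \<noteq> 0"
proof (rule resultant_nonzeroI)
  fix z assume "poly (p_poly d \<rho> s) z = 0" "poly (pderiv (p_poly d \<rho> s)) z = 0"
  then show False using resultant_common_root[OF char_poly_nonzero[OF D_op_carrier], of d \<rho> s z "pderiv (char_poly (D_op d \<rho> s))"] assms
    by (simp add: p_poly_char_poly pderiv_smult)
qed simp

lemma resultant_p_poly_pderiv2:
  assumes "resultant (char_poly (D_op d \<rho> s)) (pderiv (pderiv (char_poly (D_op d \<rho> s)))) \<noteq> 0"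
  shows "resultant (p_poly d \<rho> s) (pderiv (pderiv (p_poly d \<rho> s))) \<noteq> 0"
proof (rule resultant_nonzeroI)
  fix z assume "poly (p_poly d \<rho> s) z = 0" "poly (pderiv (pderiv (p_poly d \<rho> s))) z = 0"
  then show False using resultant_common_root[OF char_poly_nonzero[OF D_op_carrier], of d \<rho> s z "pderiv (pderiv (char_poly (D_op d \<rho> s)))"] assms
    by (simp add: p_poly_char_poly pderiv_smult)
qed simp

text \<open>The isomorphism \<open>T\<close> is kept together with its inverse \<open>S\<close>, so
  that every object attached to \<rho> is the conjugate by \<open>T\<close> of the one attached to
  \<open>sym_rep n\<close>. This leaves characteristic polynomials unchanged.\<close>

locale irrep_equiv =
  fixes n :: nat and \<rho> :: "m2 \<Rightarrow> complex mat" and T S :: "complex mat"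
  assumes \<rho>: "is_rep (Suc n) \<rho>"
    and T: "T \<in> carrier_mat (Suc n) (Suc n)" and S: "S \<in> carrier_mat (Suc n) (Suc n)"
    and TS: "T * S = 1\<^sub>m (Suc n)" and ST: "S * T = 1\<^sub>m (Suc n)"
    and comm: "\<And>U. U \<in> SU2 \<Longrightarrow> \<rho> U * T = T * sym_rep n U"
begin

lemma rho_eq: "U \<in> SU2 \<Longrightarrow> \<rho> U = T * sym_rep n U * S"
proof -
  assume U: "U \<in> SU2"
  have "\<rho> U = \<rho> U * (T * S)" using is_repD(1)[OF \<rho> U] by (simp add: TS)
  also have "\<dots> = \<rho> U * T * S" using is_repD(1)[OF \<rho> U] T S by (simp add: assoc_mult_mat[of _ "Suc n" "Suc n" _ "Suc n" _ "Suc n"])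
  finally show ?thesis using comm[OF U] by simp
qed

abbreviation conj :: "complex mat \<Rightarrow> complex mat" where "conj A \<equiv> T * A * S"

lemma conj_carrier: "A \<in> carrier_mat (Suc n) (Suc n) \<Longrightarrow> conj A \<in> carrier_mat (Suc n) (Suc n)"
  using T S by auto

lemma conj_add: "A \<in> carrier_mat (Suc n) (Suc n) \<Longrightarrow> B \<in> carrier_mat (Suc n) (Suc n) \<Longrightarrow> conj (A + B) = conj A + conj B"
proof -
  assume A: "A \<in> carrier_mat (Suc n) (Suc n)" and B: "B \<in> carrier_mat (Suc n) (Suc n)"
  show ?thesis
    unfolding mult_add_distrib_mat[OF T A B]
    by (rule add_mult_distrib_mat[OF mult_carrier_mat[OF T A] mult_carrier_mat[OF T B] S])
qed

lemma conj_smult: "A \<in> carrier_mat (Suc n) (Suc n) \<Longrightarrow> conj (c \<cdot>\<^sub>m A) = c \<cdot>\<^sub>m conj A"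
proof -
  assume A: "A \<in> carrier_mat (Suc n) (Suc n)"
  show ?thesis
    unfolding mult_smult_distrib[OF T A]
    by (rule mult_smult_assoc_mat[OF mult_carrier_mat[OF T A] S])
qed

lemma conj_mult: "A \<in> carrier_mat (Suc n) (Suc n) \<Longrightarrow> B \<in> carrier_mat (Suc n) (Suc n) \<Longrightarrow> conj (A * B) = conj A * conj B"
proof -
  assume A: "A \<in> carrier_mat (Suc n) (Suc n)" and B: "B \<in> carrier_mat (Suc n) (Suc n)"
  note assoc = assoc_mult_mat[of _ "Suc n" "Suc n" _ "Suc n" _ "Suc n"]
  note c = mult_carrier_mat[of _ "Suc n" "Suc n" _ "Suc n"]
  have "conj A * conj B = T * (A * ((S * T) * (B * S)))"
    using A B T S by (simp add: assoc c)
  also have "\<dots> = conj (A * B)"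
    unfolding ST using A B T S by (simp add: assoc c left_mult_one_mat[OF c])
  finally show ?thesis ..
qed

lemma rep_deriv_eq:
  assumes Y: "Y \<in> su2"
  shows "rep_deriv (Suc n) \<rho> Y = conj (drep n Y)"
proof (rule eq_matI)
  fix i j assume "i < dim_row (conj (drep n Y))" "j < dim_col (conj (drep n Y))"
  then have ij: "i < Suc n" "j < Suc n" using T S by auto
  have e: "conj A $$ (i, j) = (\<Sum>q<Suc n. (\<Sum>p<Suc n. T $$ (i, p) * A $$ (p, q)) * S $$ (q, j))"
    if "A \<in> carrier_mat (Suc n) (Suc n)" for A
    unfolding mat_mult_index[OF ij mult_carrier_mat[OF T that] S]
    by (intro sum.cong refl arg_cong2[of _ _ _ _ "(*)"] mat_mult_index[OF ij(1) _ T that]) auto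
  have eq: "(\<lambda>t. \<rho> (mexp (t *\<^sub>R Y)) $$ (i, j)) = (\<lambda>t. conj (sym_rep n (mexp (t *\<^sub>R Y))) $$ (i, j))"
    by (simp add: rho_eq[OF mexp_SU2[OF Y]])
  have "((\<lambda>t. \<rho> (mexp (t *\<^sub>R Y)) $$ (i, j)) has_vector_derivative conj (drep n Y) $$ (i, j)) (at 0)"
    unfolding eq e[OF sym_rep_carrier] e[OF drep_carrier]
    by (intro has_vector_derivative_sum has_vector_derivative_mult_left has_vector_derivative_mult_right)
      (simp add: has_vector_derivative_sym_rep[OF Y] del: sym_rep_index)
  then show "rep_deriv (Suc n) \<rho> Y $$ (i, j) = conj (drep n Y) $$ (i, j)"
    using ij by (simp add: rep_deriv_def vector_derivative_at del: index_mult_mat)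
qed (use T S in \<open>auto simp: rep_deriv_def\<close>)

lemma D_op_eq: "s \<in> sym2_su2 \<Longrightarrow> D_op (Suc n) \<rho> s = conj (D_op (Suc n) (sym_rep n) s)"
proof (induction s)
  case Nil
  then show ?case using T S by (simp add: right_mult_zero_mat[OF T] left_mult_zero_mat[OF S])
next
  case (Cons a s)
  obtain Y Z where a: "a = (Y, Z)" by fastforce
  then have YZ: "Y \<in> su2" "Z \<in> su2" and s: "s \<in> sym2_su2" using Cons.prems by (auto simp: sym2_su2_def)
  have c: "drep n Y * drep n Z \<in> carrier_mat (Suc n) (Suc n)" "drep n Z * drep n Y \<in> carrier_mat (Suc n) (Suc n)"
    by (auto intro: mult_carrier_mat)
  show ?case
    unfolding a D_op_Cons Cons.IH[OF s] rep_deriv_eq[OF YZ(1)] rep_deriv_eq[OF YZ(2)]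
      rep_deriv_sym_rep[OF YZ(1)] rep_deriv_sym_rep[OF YZ(2)]
      conj_mult[OF drep_carrier drep_carrier, symmetric] conj_add[OF c, symmetric]
      conj_smult[OF add_carrier_mat[OF c(2)], symmetric]
    by (rule conj_add[symmetric]) (use c in auto)
qed

lemma char_poly_D_op:
  assumes "s \<in> sym2_su2"
  shows "char_poly (D_op (Suc n) \<rho> s) = char_poly (D_op (Suc n) (sym_rep n) s)"
proof (rule char_poly_similar)
  show "similar_mat (D_op (Suc n) \<rho> s) (D_op (Suc n) (sym_rep n) s)"
    unfolding similar_mat_def D_op_eq[OF assms]
    by (rule exI[of _ T], rule exI[of _ S], rule similar_mat_witI[of _ _ "Suc n"])
      (use T S TS ST conj_carrier in auto)
qed

text \<open>The antilinear map on forms transported along \<open>T\<close>; conjugation by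
  \<open>T\<close> does not affect the sign of its square.\<close>

lemma conj_structure:
  "\<exists>J. conj_linear_Gmap (Suc n) \<rho> J \<and> (\<forall>v\<in>carrier_vec (Suc n). J (J v) = (- 1) ^ n \<cdot>\<^sub>v v)"
proof (intro exI conjI ballI)
  let ?J = "\<lambda>v. T *\<^sub>v conj_sym n (S *\<^sub>v v)"
  note C = conj_linear_conj_sym[of n, unfolded conj_linear_Gmap_def]
  have Sc: "S *\<^sub>v v \<in> carrier_vec (Suc n)" if "v \<in> carrier_vec (Suc n)" for v using S that by auto
  have ST': "S *\<^sub>v (T *\<^sub>v v) = v" if "v \<in> carrier_vec (Suc n)" for v
    using assoc_mult_mat_vec[OF S T that] that by (simp add: ST)
  have TS': "T *\<^sub>v (S *\<^sub>v v) = v" if "v \<in> carrier_vec (Suc n)" for v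
    using assoc_mult_mat_vec[OF T S that] that by (simp add: TS)
  have S\<rho>: "S *\<^sub>v (\<rho> U *\<^sub>v v) = sym_rep n U *\<^sub>v (S *\<^sub>v v)" if U: "U \<in> SU2" and v: "v \<in> carrier_vec (Suc n)" for U v
  proof -
    have "\<rho> U *\<^sub>v v = (\<rho> U * T) *\<^sub>v (S *\<^sub>v v)"
      using assoc_mult_mat_vec[OF is_repD(1)[OF \<rho> U] T Sc[OF v]] by (simp add: TS'[OF v])
    also have "\<dots> = T *\<^sub>v (sym_rep n U *\<^sub>v (S *\<^sub>v v))"
      unfolding comm[OF U] using assoc_mult_mat_vec[OF T sym_rep_carrier Sc[OF v]] by simp
    finally show ?thesis using ST'[OF mult_mat_vec_carrier[OF sym_rep_carrier Sc[OF v]]] by simp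
  qed
  have \<rho>T: "\<rho> U *\<^sub>v (T *\<^sub>v v) = T *\<^sub>v (sym_rep n U *\<^sub>v v)" if U: "U \<in> SU2" and v: "v \<in> carrier_vec (Suc n)" for U v
    using assoc_mult_mat_vec[OF is_repD(1)[OF \<rho> U] T v] assoc_mult_mat_vec[OF T sym_rep_carrier v]
    by (simp add: comm[OF U])
  show "conj_linear_Gmap (Suc n) \<rho> ?J"
    unfolding conj_linear_Gmap_def
  proof (intro conjI ballI allI, goal_cases)
    case (1 v)
    then show ?case by (intro mult_mat_vec_carrier[OF T]) simp
  next
    case (2 v w)
    have "conj_sym n (S *\<^sub>v (v + w)) = conj_sym n (S *\<^sub>v v) + conj_sym n (S *\<^sub>v w)"
      using C Sc[OF 2(1)] Sc[OF 2(2)] by (simp add: mult_add_distrib_mat_vec[OF S 2])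
    then show ?case by (simp add: mult_add_distrib_mat_vec[OF T])
  next
    case (3 c v)
    have "conj_sym n (S *\<^sub>v (c \<cdot>\<^sub>v v)) = cnj c \<cdot>\<^sub>v conj_sym n (S *\<^sub>v v)"
      using C Sc[OF 3] by (simp add: mult_mat_vec[OF S 3])
    then show ?case by (simp add: mult_mat_vec[OF T])
  next
    case (4 U v)
    have "conj_sym n (S *\<^sub>v (\<rho> U *\<^sub>v v)) = sym_rep n U *\<^sub>v conj_sym n (S *\<^sub>v v)"
      using C Sc[OF 4(2)] 4(1) by (simp add: S\<rho>[OF 4])
    then show ?case by (simp add: \<rho>T[OF 4(1)])
  qed
  fix v :: "complex Matrix.vec" assume v: "v \<in> carrier_vec (Suc n)"
  have "?J (?J v) = T *\<^sub>v ((- 1) ^ n \<cdot>\<^sub>v (S *\<^sub>v v))"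
    by (simp add: ST' conj_sym_twice[OF Sc[OF v]])
  then show "?J (?J v) = (- 1) ^ n \<cdot>\<^sub>v v"
    by (simp add: mult_mat_vec[OF T Sc[OF v]] TS'[OF v])
qed

lemma type_even: "even n \<Longrightarrow> real_type (Suc n) \<rho>"
  using conj_structure by (auto simp: real_type_def)

lemma type_odd: "odd n \<Longrightarrow> quaternionic_type (Suc n) \<rho>"
proof -
  assume "odd n"
  moreover have "(- 1 :: complex) \<cdot>\<^sub>v v = - v" for v :: "complex Matrix.vec" by (rule eq_vecI) auto
  ultimately show ?thesis using conj_structure by (simp add: quaternionic_type_def)
qed

end

lemma irrep_equivE:
  assumes "is_irrep d \<rho>"
  obtains n T S where "d = Suc n" "irrep_equiv n \<rho> T S"
proof -
  obtain n T S where *: "d = Suc n" "T \<in> carrier_mat d d" "S \<in> carrier_mat d d" "T * S = 1\<^sub>m d" "S * T = 1\<^sub>m d"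
    "\<forall>U\<in>SU2. \<rho> U * T = T * sym_rep n U"
    using irrep_classification[OF assms] by blast
  have "irrep_equiv n \<rho> T S"
    by standard (use * is_irrepD(1)[OF assms] in auto)
  then show ?thesis using that *(1) by blast
qed

section \<open>The three conditions on the resultants\<close>

definition tri_list :: "tri \<Rightarrow> (m2 \<times> m2) list" where
  "tri_list = (\<lambda>(X, Y, Z). [(X, X), (Y, Y), (Z, Z)])"

lemma tri_list_sym2: "X \<in> su2 \<Longrightarrow> Y \<in> su2 \<Longrightarrow> Z \<in> su2 \<Longrightarrow> tri_list (X, Y, Z) \<in> sym2_su2"
  by (simp add: tri_list_def sym2_su2_def)

text \<open>For a square Y.Y the two symmetrised products agree, so the factor -1/2 gives minus the
  square of the derivative. This identifies the operators of the algebraic conditions with the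
  matrices of Laplacians.\<close>

lemma D_op_tri:
  assumes "X \<in> su2" "Y \<in> su2" "Z \<in> su2"
  shows "D_op (Suc n) (sym_rep n) (tri_list (X, Y, Z)) = lap_mat n (X, Y, Z)"
proof (rule eq_matI)
  fix j k assume "j < dim_row (lap_mat n (X, Y, Z))" "k < dim_col (lap_mat n (X, Y, Z))"
  then have jk: "j \<le> n" "k \<le> n" by auto
  have e: "(drep n Y * drep n Y) $$ (j, k) = (\<Sum>l\<le>n. dent n Y j l * dent n Y l k)" for Y
    using jk by (subst mat_mult_index[of j "Suc n" k "Suc n" _ "Suc n"]) (auto simp: lessThan_Suc_atMost intro!: sum.cong)
  have c: "drep n Y * drep n Y \<in> carrier_mat (Suc n) (Suc n)" for Y by (auto intro: mult_carrier_mat)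
  have "((- 1 / 2) \<cdot>\<^sub>m (drep n Y * drep n Y + drep n Y * drep n Y)) $$ (j, k) = - (\<Sum>l\<le>n. dent n Y j l * dent n Y l k)" for Y
    using jk c[of Y] by (simp add: e del: index_mult_mat(1))
  then show "D_op (Suc n) (sym_rep n) (tri_list (X, Y, Z)) $$ (j, k) = lap_mat n (X, Y, Z) $$ (j, k)"
    using jk assms c unfolding lap_mat_index[OF jk]
    by (simp add: tri_list_def rep_deriv_sym_rep e del: index_mult_mat(1))
qed (auto intro: carrier_matD[OF D_op_carrier])

text \<open>Both representations are isomorphic to the same forms, and \<open>T' * S\<close>
  composes the two isomorphisms. Read contrapositively, irreducibles that are not isomorphic have
  different degrees.\<close>

lemma irrep_not_iso_dim:
  assumes "irrep_equiv n \<rho> T S" "irrep_equiv n \<sigma> T' S'"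
  shows "rep_iso (Suc n) \<rho> (Suc n) \<sigma>"
proof -
  interpret r: irrep_equiv n \<rho> T S by fact
  interpret s: irrep_equiv n \<sigma> T' S' by fact
  note assoc = assoc_mult_mat[of _ "Suc n" "Suc n" _ "Suc n" _ "Suc n"]
  note c = mult_carrier_mat[of _ "Suc n" "Suc n" _ "Suc n"]
  note car = r.T r.S s.T s.S
  let ?P = "T' * S" and ?Q = "T * S'"
  have PQ: "?P * ?Q = 1\<^sub>m (Suc n)"
  proof -
    have "?P * ?Q = T' * ((S * T) * S')" using car by (simp add: assoc c)
    then show ?thesis using car by (simp add: r.ST s.TS)
  qed
  have QP: "?Q * ?P = 1\<^sub>m (Suc n)"
  proof -
    have "?Q * ?P = T * ((S' * T') * S)" using car by (simp add: assoc c)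
    then show ?thesis using car by (simp add: s.ST r.TS)
  qed
  have P: "?P \<in> carrier_mat (Suc n) (Suc n)" "?Q \<in> carrier_mat (Suc n) (Suc n)" using car by auto
  have "invertible_mat ?P"
    unfolding invertible_mat_def inverts_mat_def using P PQ QP car by (auto intro!: exI[of _ ?Q])
  moreover have "?P * \<rho> U = \<sigma> U * ?P" if U: "U \<in> SU2" for U
  proof -
    have "?P * \<rho> U = T' * ((S * T) * (sym_rep n U * S))"
      unfolding r.rho_eq[OF U] using car by (simp add: assoc c)
    also have "\<dots> = (T' * sym_rep n U) * S" using car by (simp add: r.ST assoc c left_mult_one_mat[OF c])
    also have "\<dots> = \<sigma> U * ?P" unfolding s.comm[OF U, symmetric]
      using car is_repD(1)[OF s.\<rho> U] by (simp add: assoc c)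
    finally show ?thesis .
  qed
  ultimately show ?thesis using P unfolding rep_iso_def by blast
qed

text \<open>Different classes have different degrees, and the single Casimir tensor separates all
  degrees.\<close>

theorem SU2_condition_a:
  assumes "is_irrep d \<rho>" "is_irrep d' \<sigma>" "\<not> rep_iso d \<rho> d' \<sigma>"
  shows "\<exists>s\<in>sym2_su2. resultant (p_poly d \<rho> s) (p_poly d' \<sigma> s) \<noteq> 0"
proof -
  obtain n T S where r: "d = Suc n" "irrep_equiv n \<rho> T S" using irrep_equivE[OF assms(1)] .
  obtain m T' S' where s: "d' = Suc m" "irrep_equiv m \<sigma> T' S'" using irrep_equivE[OF assms(2)] .
  have nm: "n \<noteq> m" using irrep_not_iso_dim r s assms(3) by blast
  let ?s = "tri_list (E1, J0, E3)"
  have sym: "?s \<in> sym2_su2" by (rule tri_list_sym2) auto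
  have "resultant (char_poly (D_op d \<rho> ?s)) (char_poly (D_op d' \<sigma> ?s)) \<noteq> 0"
    using lap_mat_casimir_resultant[OF nm]
    unfolding r(1) s(1) irrep_equiv.char_poly_D_op[OF r(2) sym] irrep_equiv.char_poly_D_op[OF s(2) sym]
    by (simp add: D_op_tri)
  then show ?thesis using sym resultant_p_poly_iff by blast
qed

text \<open>An odd degree would make the representation quaternionic. This contradicts complex type
  by definition and real type by Schur, so the degree is even.\<close>

theorem SU2_condition_b:
  assumes \<rho>: "is_irrep d \<rho>" and t: "real_type d \<rho> \<or> complex_type d \<rho>"
  shows "\<exists>s\<in>sym2_su2. resultant (p_poly d \<rho> s) (pderiv (p_poly d \<rho> s)) \<noteq> 0"
proof -
  obtain n T S where r: "d = Suc n" "irrep_equiv n \<rho> T S" using irrep_equivE[OF \<rho>] .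
  have n: "even n"
    using irrep_equiv.type_odd[OF r(2)] real_quaternionic_exclusive[OF \<rho>] t r(1) by (auto simp: complex_type_def)
  let ?s = "tri_list (E1 + E3, J0, 0)"
  have sym: "?s \<in> sym2_su2" by (rule tri_list_sym2) auto
  have "resultant (char_poly (D_op d \<rho> ?s)) (pderiv (char_poly (D_op d \<rho> ?s))) \<noteq> 0"
    using lap_mat_even_resultant[OF n]
    unfolding r(1) irrep_equiv.char_poly_D_op[OF r(2) sym] by (simp add: D_op_tri)
  then show ?thesis using sym resultant_p_poly_pderiv by blast
qed

theorem SU2_condition_c:
  assumes \<rho>: "is_irrep d \<rho>" and t: "quaternionic_type d \<rho>"
  shows "\<exists>s\<in>sym2_su2. resultant (p_poly d \<rho> s) (pderiv (pderiv (p_poly d \<rho> s))) \<noteq> 0"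
proof -
  obtain n T S where r: "d = Suc n" "irrep_equiv n \<rho> T S" using irrep_equivE[OF \<rho>] .
  have n: "odd n"
    using irrep_equiv.type_even[OF r(2)] real_quaternionic_exclusive[OF \<rho>] t r(1) by auto
  let ?s = "tri_list (E3, 0, 0)"
  have sym: "?s \<in> sym2_su2" by (rule tri_list_sym2) auto
  have "resultant (char_poly (D_op d \<rho> ?s)) (pderiv (pderiv (char_poly (D_op d \<rho> ?s)))) \<noteq> 0"
    using lap_mat_odd_resultant[OF n]
    unfolding r(1) irrep_equiv.char_poly_D_op[OF r(2) sym] by (simp add: D_op_tri)
  then show ?thesis using sym resultant_p_poly_pderiv2 by blast
qed

subsection \<open>Residual sets of metrics\<close>

text \<open>Polynomials in the real coordinates with complex values. They are split into real and
  imaginary parts because the density argument counts real zeros along real lines.\<close>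

definition cpoly_fun :: "('a::real_normed_vector \<Rightarrow> complex) \<Rightarrow> bool" where
  "cpoly_fun f \<longleftrightarrow> real_polynomial_function (\<lambda>x. Re (f x)) \<and> real_polynomial_function (\<lambda>x. Im (f x))"

lemma cpoly_fun_const [intro]: "cpoly_fun (\<lambda>x. c)"
  by (auto simp: cpoly_fun_def)

lemma cpoly_fun_add [intro]: "cpoly_fun f \<Longrightarrow> cpoly_fun g \<Longrightarrow> cpoly_fun (\<lambda>x. f x + g x)"
  by (auto simp: cpoly_fun_def)

lemma cpoly_fun_mult [intro]: "cpoly_fun f \<Longrightarrow> cpoly_fun g \<Longrightarrow> cpoly_fun (\<lambda>x. f x * g x)"
  by (auto simp: cpoly_fun_def)

lemma cpoly_fun_minus [intro]: "cpoly_fun f \<Longrightarrow> cpoly_fun (\<lambda>x. - f x)"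
  by (auto simp: cpoly_fun_def)

lemma cpoly_fun_sum: "(\<And>i. i \<in> I \<Longrightarrow> cpoly_fun (f i)) \<Longrightarrow> cpoly_fun (\<lambda>x. \<Sum>i\<in>I. f i x)"
  by (induction I rule: infinite_finite_induct) auto

lemma cpoly_fun_if:
  "(c \<Longrightarrow> cpoly_fun f) \<Longrightarrow> (\<not> c \<Longrightarrow> cpoly_fun g) \<Longrightarrow> cpoly_fun (\<lambda>x. if c then f x else g x)"
  by (cases c) auto

lemma continuous_on_cpoly_fun:
  assumes "cpoly_fun (f :: 'a::euclidean_space \<Rightarrow> complex)"
  shows "continuous_on S f"
proof -
  have "continuous_on S (\<lambda>x. Re (f x))" "continuous_on S (\<lambda>x. Im (f x))"
    using assms unfolding cpoly_fun_def real_polynomial_function_eq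
    by (auto intro: continuous_on_polymonial_function)
  then have "continuous_on S (\<lambda>x. of_real (Re (f x)) + \<i> * of_real (Im (f x)))"
    by (intro continuous_on_add continuous_on_mult continuous_on_const continuous_on_of_real) auto
  then show ?thesis by (simp only: complex_eq[symmetric])
qed

text \<open>The Leibniz formula only uses sums and products. It is stated for an arbitrary closed
  class of functions, since it serves both for scalar functions and for polynomials whose
  coefficients are such functions.\<close>

lemma det_closed:
  fixes C :: "('a \<Rightarrow> 'r::comm_ring_1) \<Rightarrow> bool"
  assumes const: "\<And>c. C (\<lambda>_. c)" and add: "\<And>f g. C f \<Longrightarrow> C g \<Longrightarrow> C (\<lambda>x. f x + g x)"
    and mult: "\<And>f g. C f \<Longrightarrow> C g \<Longrightarrow> C (\<lambda>x. f x * g x)"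
    and A: "\<And>x. A x \<in> carrier_mat n n"
    and e: "\<And>i j. i < n \<Longrightarrow> j < n \<Longrightarrow> C (\<lambda>x. A x $$ (i, j))"
  shows "C (\<lambda>x. det (A x))"
proof -
  have sum: "C (\<lambda>x. \<Sum>i\<in>I. f i x)" if "\<And>i. i \<in> I \<Longrightarrow> C (f i)" for I :: "'c set" and f
    using that by (induction I rule: infinite_finite_induct) (auto intro: const add)
  have prod: "C (\<lambda>x. \<Prod>i\<in>I. f i x)" if "\<And>i. i \<in> I \<Longrightarrow> C (f i)" for I :: "'c set" and f
    using that by (induction I rule: infinite_finite_induct) (auto intro: const mult)
  have "C (\<lambda>x. \<Sum>p \<in> {p. p permutes {0..<n}}. signof p * (\<Prod>i = 0..<n. A x $$ (i, p i)))"
    by (intro sum mult const prod e) (auto dest: permutes_in_image)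
  then show ?thesis by (simp add: det_def'[OF A])
qed

definition cpoly_coeffs :: "('a::real_normed_vector \<Rightarrow> complex poly) \<Rightarrow> bool" where
  "cpoly_coeffs p \<longleftrightarrow> (\<forall>j. cpoly_fun (\<lambda>x. coeff (p x) j))"

lemma cpoly_coeffs_const: "cpoly_coeffs (\<lambda>x. c)"
  by (auto simp: cpoly_coeffs_def)

lemma cpoly_coeffs_add: "cpoly_coeffs p \<Longrightarrow> cpoly_coeffs q \<Longrightarrow> cpoly_coeffs (\<lambda>x. p x + q x)"
  by (auto simp: cpoly_coeffs_def)

lemma cpoly_coeffs_mult: "cpoly_coeffs p \<Longrightarrow> cpoly_coeffs q \<Longrightarrow> cpoly_coeffs (\<lambda>x. p x * q x)"
  unfolding cpoly_coeffs_def coeff_mult by (auto intro!: cpoly_fun_sum)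

lemma cpoly_coeffs_pderiv: "cpoly_coeffs p \<Longrightarrow> cpoly_coeffs (\<lambda>x. pderiv (p x))"
  unfolding cpoly_coeffs_def coeff_pderiv by auto

lemma cpoly_coeffs_char_poly:
  assumes A: "\<And>x. A x \<in> carrier_mat n n" and e: "\<And>i j. i < n \<Longrightarrow> j < n \<Longrightarrow> cpoly_fun (\<lambda>x. A x $$ (i, j))"
  shows "cpoly_coeffs (\<lambda>x. char_poly (A x))"
proof -
  have 1: "char_poly_matrix (A x) \<in> carrier_mat n n" for x using A by simp
  have 2: "cpoly_coeffs (\<lambda>x. char_poly_matrix (A x) $$ (i, j))" if ij: "i < n" "j < n" for i j
  proof -
    have "char_poly_matrix (A x) $$ (i, j) = (if i = j then [:0, 1:] else 0) + [:- A x $$ (i, j):]" for x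
      using ij A[of x] by (auto simp: char_poly_matrix_def)
    moreover have "cpoly_coeffs (\<lambda>x. [:- A x $$ (i, j):])"
      unfolding cpoly_coeffs_def
    proof
      show "cpoly_fun (\<lambda>x. coeff [:- A x $$ (i, j):] l)" for l
        using e[OF ij] by (cases l) auto
    qed
    ultimately show ?thesis
      by (simp only: cpoly_coeffs_add cpoly_coeffs_const)
  qed
  show ?thesis
    unfolding char_poly_def
    by (rule det_closed[where C = cpoly_coeffs, OF cpoly_coeffs_const cpoly_coeffs_add cpoly_coeffs_mult 1 2])
qed

text \<open>Constant degrees fix the size of the Sylvester matrix, so the resultant is one
  determinant with polynomial entries.\<close>

lemma cpoly_fun_resultant:
  assumes p: "cpoly_coeffs p" and q: "cpoly_coeffs q"
    and d: "\<And>x. degree (p x) = m" "\<And>x. degree (q x) = n"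
  shows "cpoly_fun (\<lambda>x. resultant (p x) (q x))"
proof -
  have "cpoly_fun (\<lambda>x. det (sylvester_mat_sub m n (p x) (q x)))"
  proof (rule det_closed[where C = cpoly_fun and A = "\<lambda>x. sylvester_mat_sub m n (p x) (q x)" and n = "m + n",
        OF cpoly_fun_const cpoly_fun_add cpoly_fun_mult])
    fix i j assume "i < m + n" "j < m + n"
    then show "cpoly_fun (\<lambda>x. sylvester_mat_sub m n (p x) (q x) $$ (i, j))"
      using p q unfolding cpoly_coeffs_def
      by (auto simp only: sylvester_mat_sub_index intro!: cpoly_fun_if cpoly_fun_const)
  qed (auto intro: sylvester_mat_sub_carrier)
  then show ?thesis by (simp add: resultant_def sylvester_mat_def d)
qed

lemma cpoly_fun_entry:
  assumes "bounded_linear (h :: 'a::real_normed_vector \<Rightarrow> m2)"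
  shows "cpoly_fun (\<lambda>x. h x $v i $v j)"
proof -
  have "bounded_linear (\<lambda>x. h x $v i $v j)"
    by (intro bounded_linear_compose[OF bounded_linear_vec_nth] assms)
  then show ?thesis unfolding cpoly_fun_def
    by (auto intro!: real_polynomial_function.intros(1) bounded_linear_compose[OF bounded_linear_Re] bounded_linear_compose[OF bounded_linear_Im])
qed

lemma cpoly_fun_dent:
  assumes "bounded_linear (h :: 'a::real_normed_vector \<Rightarrow> m2)"
  shows "cpoly_fun (\<lambda>x. dent n (h x) j k)"
proof -
  note e = cpoly_fun_entry[OF assms]
  show ?thesis unfolding dent_def
    by (cases "k = Suc j"; cases "j = k"; cases "j = Suc k")
      (auto intro!: cpoly_fun_add cpoly_fun_mult cpoly_fun_const e)
qed

lemma cpoly_coeffs_lap: "cpoly_coeffs (\<lambda>X. char_poly (lap_mat n X))"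
proof (rule cpoly_coeffs_char_poly)
  fix j k assume jk: "j < Suc n" "k < Suc n"
  have b: "bounded_linear (fst :: tri \<Rightarrow> m2)" "bounded_linear (\<lambda>X :: tri. fst (snd X))" "bounded_linear (\<lambda>X :: tri. snd (snd X))"
    by (auto intro: bounded_linear_fst bounded_linear_fst_comp bounded_linear_snd_comp bounded_linear_snd)
  have "cpoly_fun (\<lambda>X :: tri. - (\<Sum>l\<le>n. dent n (fst X) j l * dent n (fst X) l k + dent n (fst (snd X)) j l * dent n (fst (snd X)) l k
      + dent n (snd (snd X)) j l * dent n (snd (snd X)) l k))"
    by (intro cpoly_fun_minus cpoly_fun_sum cpoly_fun_add cpoly_fun_mult cpoly_fun_dent b)
  then show "cpoly_fun (\<lambda>X. lap_mat n X $$ (j, k))"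
    using jk by (simp add: lap_mat_def split_beta)
qed simp

text \<open>Distinct indices carry condition (a). The diagonal of the index set is free, so it
  carries (b) or (c) according to parity, and one countable family encodes all the
  conditions.\<close>

definition generic_fun :: "nat \<Rightarrow> nat \<Rightarrow> tri \<Rightarrow> complex" where
  "generic_fun m n X =
    (if m \<noteq> n then resultant (char_poly (lap_mat m X)) (char_poly (lap_mat n X))
     else if even n then resultant (char_poly (lap_mat n X)) (pderiv (char_poly (lap_mat n X)))
     else resultant (char_poly (lap_mat n X)) (pderiv (pderiv (char_poly (lap_mat n X)))))"

lemma degree_lap: "degree (char_poly (lap_mat n X)) = Suc n"
  using degree_monic_char_poly[OF lap_mat_carrier] by simp

lemma cpoly_fun_generic: "cpoly_fun (generic_fun m n)"
proof -
  note l = cpoly_coeffs_lap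
  have "cpoly_fun (\<lambda>X. resultant (char_poly (lap_mat m X)) (char_poly (lap_mat n X)))"
    by (intro cpoly_fun_resultant[OF l l]) (rule degree_lap)+
  moreover have "cpoly_fun (\<lambda>X. resultant (char_poly (lap_mat n X)) (pderiv (char_poly (lap_mat n X))))"
    by (intro cpoly_fun_resultant[where m = "Suc n" and n = n, OF l cpoly_coeffs_pderiv[OF l]]) (simp_all add: degree_lap degree_pderiv)
  moreover have "cpoly_fun (\<lambda>X. resultant (char_poly (lap_mat n X)) (pderiv (pderiv (char_poly (lap_mat n X)))))"
    \<comment> \<open>Truncated subtraction agrees with the convention that the zero polynomial,
      which is the second derivative for \<open>n = 0\<close>, has degree 0.\<close>
    by (intro cpoly_fun_resultant[where m = "Suc n" and n = "n - 1", OF l cpoly_coeffs_pderiv[OF cpoly_coeffs_pderiv[OF l]]]) (simp_all add: degree_lap degree_pderiv)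
  ultimately show ?thesis unfolding generic_fun_def[abs_def] by (cases "m = n"; cases "even n") simp_all
qed

definition su2_coord :: "m2 \<Rightarrow> nat \<Rightarrow> real" where
  "su2_coord Y i = (if i = 0 then Im (Y $v 1 $v 1) else if i = 1 then Re (Y $v 2 $v 1) else Im (Y $v 2 $v 1))"

definition tri_det_expr :: "(nat \<Rightarrow> real) \<Rightarrow> (nat \<Rightarrow> real) \<Rightarrow> (nat \<Rightarrow> real) \<Rightarrow> real" where
  "tri_det_expr x y z = x 0 * (y 1 * z 2 - y 2 * z 1) - x 1 * (y 0 * z 2 - y 2 * z 0) + x 2 * (y 0 * z 1 - y 1 * z 0)"

definition tri_det :: "tri \<Rightarrow> real" where
  "tri_det = (\<lambda>(X, Y, Z). tri_det_expr (su2_coord X) (su2_coord Y) (su2_coord Z))"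

lemma su2_coord_lin: "su2_coord (a *\<^sub>R X + b *\<^sub>R Y + c *\<^sub>R Z) i = a * su2_coord X i + b * su2_coord Y i + c * su2_coord Z i"
  by (simp add: su2_coord_def)

text \<open>Cramer's rule: replacing one row of the coordinate determinant by the linear combination
  multiplies it by the corresponding coefficient, while a vanishing combination makes it 0.\<close>

lemma tri_det_basis:
  assumes "X \<in> su2" "Y \<in> su2" "Z \<in> su2" and D: "tri_det (X, Y, Z) \<noteq> 0"
  shows "is_basis_su2 X Y Z"
proof -
  have "a = 0 \<and> b = 0 \<and> c = 0" if z: "a *\<^sub>R X + b *\<^sub>R Y + c *\<^sub>R Z = 0" for a b c
  proof -
    define s where "s i = a * su2_coord X i + b * su2_coord Y i + c * su2_coord Z i" for i
    have s0: "s i = 0" for i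
      using su2_coord_lin[of a X b Y c Z i] unfolding z s_def by (auto simp: su2_coord_def)
    have "a * tri_det (X, Y, Z) = tri_det_expr s (su2_coord Y) (su2_coord Z)"
      "b * tri_det (X, Y, Z) = tri_det_expr (su2_coord X) s (su2_coord Z)"
      "c * tri_det (X, Y, Z) = tri_det_expr (su2_coord X) (su2_coord Y) s"
      unfolding tri_det_def prod.case s_def tri_det_expr_def by (simp_all add: algebra_simps)
    then show ?thesis using D by (simp_all add: tri_det_expr_def s0)
  qed
  then show ?thesis using assms(1-3) unfolding is_basis_su2_def by blast
qed

lemma cpoly_fun_tri_det: "cpoly_fun (\<lambda>X. of_real (tri_det X))"
proof -
  have b: "bounded_linear (fst :: tri \<Rightarrow> m2)" "bounded_linear (\<lambda>X :: tri. fst (snd X))" "bounded_linear (\<lambda>X :: tri. snd (snd X))"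
    by (auto intro: bounded_linear_fst bounded_linear_fst_comp bounded_linear_snd_comp bounded_linear_snd)
  have c: "real_polynomial_function (\<lambda>X. su2_coord (h X) i)" if "bounded_linear (h :: tri \<Rightarrow> m2)" for h i
    using cpoly_fun_entry[OF that] unfolding su2_coord_def cpoly_fun_def
    by (cases "i = 0"; cases "i = 1") auto
  have "real_polynomial_function tri_det"
    unfolding tri_det_def tri_det_expr_def split_beta
    by (intro real_polynomial_function.intros(3,4) real_polynomial_function_diff c b)
  then show ?thesis unfolding cpoly_fun_def by auto
qed

text \<open>On the line from \<open>P\<close> to a point where \<open>h\<close> is nonzero,
  \<open>h\<close> is a nonzero polynomial in one variable. It has finitely many roots, so
  arbitrarily small parameters avoid them.\<close>

lemma real_polynomial_dense:
  fixes h :: "'a::euclidean_space \<Rightarrow> real"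
  assumes h: "real_polynomial_function h" and S: "\<And>P Q t. P \<in> S \<Longrightarrow> Q \<in> S \<Longrightarrow> P + t *\<^sub>R (Q - P) \<in> S"
    and Q: "Q \<in> S" "h Q \<noteq> 0"
  shows "S \<subseteq> closure {x \<in> S. h x \<noteq> 0}"
proof
  fix P assume P: "P \<in> S"
  have "polynomial_function (\<lambda>t::real. P + t *\<^sub>R (Q - P))"
    by (intro polynomial_function_add polynomial_function_const polynomial_function_bounded_linear bounded_linear_scaleR_left)
  then have "real_polynomial_function (h \<circ> (\<lambda>t::real. P + t *\<^sub>R (Q - P)))"
    using h by (rule real_polynomial_function_compose)
  then obtain a n where an: "h \<circ> (\<lambda>t::real. P + t *\<^sub>R (Q - P)) = (\<lambda>x. \<Sum>i\<le>n. a i * x ^ i)"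
    unfolding real_polynomial_function_iff_sum by blast
  have hs: "h (P + t *\<^sub>R (Q - P)) = (\<Sum>i\<le>n. a i * t ^ i)" for t
    using fun_cong[OF an, of t] by simp
  have "\<exists>i\<le>n. a i \<noteq> 0"
  proof (rule ccontr)
    assume "\<not> ?thesis"
    then have "(\<Sum>i\<le>n. a i * 1 ^ i) = 0" by simp
    then show False using hs[of 1] Q by simp
  qed
  then have fin: "finite {t. (\<Sum>i\<le>n. a i * t ^ i) = 0}"
    by (simp add: polyfun_finite_roots)
  show "P \<in> closure {x \<in> S. h x \<noteq> 0}"
    unfolding closure_approachable
  proof (intro allI impI)
    fix e :: real assume e: "e > 0"
    \<comment> \<open>The summand 1 keeps the quotient meaningful when \<open>Q = P\<close> and
      makes the final estimate strict.\<close>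
    define d where "d = e / (norm (Q - P) + 1)"
    have d: "d > 0" using e by (simp add: d_def add_nonneg_pos)
    have "infinite {0<..<d}" using d by (simp add: infinite_Ioo)
    then obtain t where t: "t \<in> {0<..<d}" "t \<notin> {t. (\<Sum>i\<le>n. a i * t ^ i) = 0}"
      using fin finite_subset[of "{0<..<d}"] by blast
    have "t * norm (Q - P) \<le> d * norm (Q - P)" using t by (intro mult_right_mono) auto
    also have "\<dots> < d * (norm (Q - P) + 1)" using d by simp
    also have "\<dots> = e"
    proof -
      have "norm (Q - P) + 1 \<noteq> 0" using norm_ge_zero[of "Q - P"] by linarith
      then show ?thesis by (simp add: d_def)
    qed
    finally have "dist (P + t *\<^sub>R (Q - P)) P < e" using t by (simp add: dist_norm)
    moreover have "P + t *\<^sub>R (Q - P) \<in> {x \<in> S. h x \<noteq> 0}" using S[OF P Q(1), of t] t hs[of t] by simp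
    ultimately show "\<exists>y\<in>{x \<in> S. h x \<noteq> 0}. dist y P < e" by blast
  qed
qed

lemma cpoly_fun_dense:
  fixes h :: "'a::euclidean_space \<Rightarrow> complex"
  assumes h: "cpoly_fun h" and S: "\<And>P Q t. P \<in> S \<Longrightarrow> Q \<in> S \<Longrightarrow> P + t *\<^sub>R (Q - P) \<in> S"
    and Q: "Q \<in> S" "h Q \<noteq> 0"
  shows "S \<subseteq> closure {x \<in> S. h x \<noteq> 0}"
proof (cases "Re (h Q) = 0")
  case True
  then have "Im (h Q) \<noteq> 0" using Q by (simp add: complex_eq_iff)
  then have "S \<subseteq> closure {x \<in> S. Im (h x) \<noteq> 0}"
    using h by (intro real_polynomial_dense[OF _ S Q(1)]) (auto simp: cpoly_fun_def)
  also have "\<dots> \<subseteq> closure {x \<in> S. h x \<noteq> 0}" by (intro closure_mono) auto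
  finally show ?thesis .
next
  case False
  then have "S \<subseteq> closure {x \<in> S. Re (h x) \<noteq> 0}"
    using h by (intro real_polynomial_dense[OF _ S Q(1)]) (auto simp: cpoly_fun_def)
  also have "\<dots> \<subseteq> closure {x \<in> S. h x \<noteq> 0}" by (intro closure_mono) auto
  finally show ?thesis .
qed

section \<open>The residual set\<close>

abbreviation su2_tri :: "tri set" where "su2_tri \<equiv> su2 \<times> su2 \<times> su2"

lemma su2_tri_line: "P \<in> su2_tri \<Longrightarrow> Q \<in> su2_tri \<Longrightarrow> P + t *\<^sub>R (Q - P) \<in> su2_tri"
proof -
  have "Y + t *\<^sub>R (Z - Y) \<in> su2" if "Y \<in> su2" "Z \<in> su2" for Y Z
    using that by (simp add: su2_iff algebra_simps)
  then show "P \<in> su2_tri \<Longrightarrow> Q \<in> su2_tri \<Longrightarrow> P + t *\<^sub>R (Q - P) \<in> su2_tri"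
    by (cases P; cases Q) auto
qed

lemma cpoly_fun_openin:
  assumes "cpoly_fun (h :: 'a::euclidean_space \<Rightarrow> complex)"
  shows "openin (top_of_set S) {x \<in> S. h x \<noteq> 0}"
proof -
  have "open {x. h x \<noteq> 0}"
    by (intro open_Collect_neq continuous_on_cpoly_fun assms continuous_on_const)
  then have "openin (top_of_set S) (S \<inter> {x. h x \<noteq> 0})" by (rule openin_open_Int)
  also have "S \<inter> {x. h x \<noteq> 0} = {x \<in> S. h x \<noteq> 0}" by auto
  finally show ?thesis .
qed

text \<open>Only the nonvanishing of a polynomial function on triples is at stake, so linearly
  dependent witnesses are admissible; independence is imposed by \<open>tri_det\<close>.\<close>

lemma generic_fun_witness: "\<exists>Q\<in>su2_tri. generic_fun m n Q \<noteq> 0"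
proof (cases "m = n")
  case False
  then show ?thesis using lap_mat_casimir_resultant[OF False]
    by (intro bexI[of _ "(E1, J0, E3)"]) (auto simp: generic_fun_def)
next
  case True
  show ?thesis
  proof (cases "even n")
    case e: True
    then show ?thesis using lap_mat_even_resultant[OF e] True
      by (intro bexI[of _ "(E1 + E3, J0, 0)"]) (auto simp: generic_fun_def)
  next
    case o: False
    then show ?thesis using lap_mat_odd_resultant[OF o] True
      by (intro bexI[of _ "(E3, 0, 0)"]) (auto simp: generic_fun_def)
  qed
qed

definition generic_tris :: "tri set" where
  "generic_tris = {X \<in> su2_tri. tri_det X \<noteq> 0 \<and> (\<forall>m n. generic_fun m n X \<noteq> 0)}"

theorem residual_generic_tris: "residual_in su2_tri generic_tris"
proof -
  \<comment> \<open>Index 0 carries the basis condition; the successors run through all pairs of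
    degrees.\<close>
  define F where "F k = (case k of 0 \<Rightarrow> {X \<in> su2_tri. complex_of_real (tri_det X) \<noteq> 0}
    | Suc k \<Rightarrow> {X \<in> su2_tri. generic_fun (fst (prod_decode k)) (snd (prod_decode k)) X \<noteq> 0})" for k
  have "openin (top_of_set su2_tri) (F k)" for k
    unfolding F_def by (auto split: nat.split intro!: cpoly_fun_openin cpoly_fun_generic cpoly_fun_tri_det simp del: of_real_eq_0_iff)
  moreover have "su2_tri \<subseteq> closure (F k)" for k
  proof (cases k)
    case 0
    have "su2_tri \<subseteq> closure {X \<in> su2_tri. complex_of_real (tri_det X) \<noteq> 0}"
      by (rule cpoly_fun_dense[OF cpoly_fun_tri_det su2_tri_line, of "(E1, J0, E3)"])
        (auto simp: tri_det_def tri_det_expr_def su2_coord_def)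
    then show ?thesis by (simp add: F_def 0)
  next
    case (Suc l)
    obtain Q where "Q \<in> su2_tri" "generic_fun (fst (prod_decode l)) (snd (prod_decode l)) Q \<noteq> 0"
      using generic_fun_witness by blast
    from cpoly_fun_dense[OF cpoly_fun_generic su2_tri_line this]
    show ?thesis by (simp add: F_def Suc)
  qed
  moreover have "su2_tri \<inter> (\<Inter>k. F k) \<subseteq> generic_tris"
  proof
    fix X assume X: "X \<in> su2_tri \<inter> (\<Inter>k. F k)"
    then have "X \<in> F 0" by blast
    moreover have "X \<in> F (Suc (prod_encode (m, n)))" for m n using X by blast
    ultimately show "X \<in> generic_tris" using X by (simp add: F_def generic_tris_def)
  qed
  moreover have "generic_tris \<subseteq> su2_tri" by (auto simp: generic_tris_def)
  ultimately show ?thesis unfolding residual_in_def by blast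
qed

subsection \<open>Eigenspaces at roots of low multiplicity\<close>

text \<open>Geometric multiplicity is bounded by algebraic multiplicity. \<open>P\<close> is the
  identity with the columns in \<open>C\<close> replaced by eigenvectors, and \<open>indep\<close>
  says that it is injective. In (X - A) P these columns are divisible by X - lam, so the determinant
  is divisible by the corresponding power.\<close>

lemma eigenvectors_dvd_char_poly:
  fixes A :: "complex mat"
  assumes A: "A \<in> carrier_mat n n" and C: "C \<subseteq> {..<n}"
    and V: "\<And>c. c \<in> C \<Longrightarrow> V c \<in> carrier_vec n" "\<And>c. c \<in> C \<Longrightarrow> A *\<^sub>v V c = lam \<cdot>\<^sub>v V c"
    and indep: "\<And>x. x \<in> carrier_vec n \<Longrightarrow> (\<And>r. r < n \<Longrightarrow> (\<Sum>c\<in>C. V c $ r * x $ c) + (if r \<in> C then 0 else x $ r) = 0) \<Longrightarrow> x = 0\<^sub>v n"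
  shows "[:- lam, 1:] ^ card C dvd char_poly A"
proof -
  have finC: "finite C" using C finite_subset by blast
  define P where "P = Matrix.mat n n (\<lambda>(r, c). if c \<in> C then V c $ r else if r = c then 1 else 0)"
  have P: "P \<in> carrier_mat n n" by (simp add: P_def)
  have Px: "(P *\<^sub>v x) $ r = (\<Sum>c\<in>C. V c $ r * x $ c) + (if r \<in> C then 0 else x $ r)"
    if "x \<in> carrier_vec n" "r < n" for x r
  proof -
    have "(P *\<^sub>v x) $ r = (\<Sum>c<n. P $$ (r, c) * x $ c)" by (rule mult_mat_vec_index[OF that(2) P that(1)])
    also have "\<dots> = (\<Sum>c<n. (if c \<in> C then V c $ r * x $ c else 0) + (if c = r then (if r \<in> C then 0 else x $ r) else 0))"
      using that by (intro sum.cong) (auto simp: P_def)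
    also have "\<dots> = (\<Sum>c<n. if c \<in> C then V c $ r * x $ c else 0) + (\<Sum>c<n. if c = r then (if r \<in> C then 0 else x $ r) else 0)"
      by (rule sum.distrib)
    also have "(\<Sum>c<n. if c \<in> C then V c $ r * x $ c else 0) = (\<Sum>c\<in>C. V c $ r * x $ c)"
    proof -
      have "{..<n} \<inter> C = C" using C by auto
      then show ?thesis by (simp add: sum.If_cases Int_def)
    qed
    also have "(\<Sum>c<n. if c = r then (if r \<in> C then 0 else x $ r) else 0) = (if r \<in> C then 0 else x $ r)"
      using that by (subst sum.delta) auto
    finally show ?thesis .
  qed
  have detP: "det P \<noteq> 0"
  proof
    assume "det P = 0"
    then obtain x where x: "x \<in> carrier_vec n" "x \<noteq> 0\<^sub>v n" "P *\<^sub>v x = 0\<^sub>v n"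
      using det_0_iff_vec_prod_zero_field[OF P] by auto
    have "x = 0\<^sub>v n"
      by (rule indep[OF x(1)]) (use Px[OF x(1)] x(3) in simp)
    then show False using x by simp
  qed
  let ?d = "[:- lam, 1:]"
  let ?M = "char_poly_matrix A"
  let ?Pp = "map_mat (\<lambda>a. [:a:]) P"
  \<comment> \<open>\<open>N\<close> is the product with the factor X - lam cancelled from the
    columns in \<open>C\<close>, and the diagonal matrix \<open>D\<close> puts these factors
    back.\<close>
  define N where "N = Matrix.mat n n (\<lambda>(r, c). if c \<in> C then [:V c $ r:] else (?M * ?Pp) $$ (r, c))"
  define D where "D = Matrix.mat n n (\<lambda>(r, c). if r = c then (if c \<in> C then ?d else 1) else 0)"
  have M: "?M \<in> carrier_mat n n" using A by simp
  have Pp: "?Pp \<in> carrier_mat n n" using P by simp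
  have N: "N \<in> carrier_mat n n" and D: "D \<in> carrier_mat n n" by (simp_all add: N_def D_def)
  have MP: "?M * ?Pp = N * D"
  proof (rule eq_matI)
    fix r c assume "r < dim_row (N * D)" "c < dim_col (N * D)"
    then have r: "r < n" and c: "c < n" using N D by auto
    have "(N * D) $$ (r, c) = (\<Sum>l<n. if l = c then N $$ (r, l) * D $$ (l, c) else 0)"
      unfolding mat_mult_index[OF r c N D] using c by (intro sum.cong) (auto simp: D_def)
    also have "\<dots> = N $$ (r, c) * D $$ (c, c)" using c by simp
    finally have ND: "(N * D) $$ (r, c) = N $$ (r, c) * D $$ (c, c)" .
    show "(?M * ?Pp) $$ (r, c) = (N * D) $$ (r, c)"
    proof (cases "c \<in> C")
      case False
      then show ?thesis unfolding ND using r c by (simp add: N_def D_def del: index_mult_mat)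
    next
      case True
      have "(?M * ?Pp) $$ (r, c) = (\<Sum>l<n. ?M $$ (r, l) * ?Pp $$ (l, c))"
        by (rule mat_mult_index[OF r c M Pp])
      also have "\<dots> = (\<Sum>l<n. (if l = r then [:0, V c $ r:] else 0) + [:- (A $$ (r, l) * V c $ l):])"
        using r c True A P by (intro sum.cong) (auto simp: char_poly_matrix_def P_def)
      also have "\<dots> = [:0, V c $ r:] + (\<Sum>l<n. [:- (A $$ (r, l) * V c $ l):])"
        using r by (simp add: sum.distrib)
      also have "(\<Sum>l<n. [:- (A $$ (r, l) * V c $ l):]) = [:- (\<Sum>l<n. A $$ (r, l) * V c $ l):]"
        by (induction n) auto
      also have "(\<Sum>l<n. A $$ (r, l) * V c $ l) = (A *\<^sub>v V c) $ r"
        by (rule mult_mat_vec_index[OF r A V(1)[OF True], symmetric])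
      also have "\<dots> = lam * V c $ r" unfolding V(2)[OF True] using V(1)[OF True] r by simp
      finally show ?thesis unfolding ND using r c True by (simp add: N_def D_def del: index_mult_mat)
    qed
  qed (use M P N D in auto)
  have "det D = prod_list (diag_mat D)"
    by (rule det_upper_triangular[OF _ D]) (rule upper_triangularI, use D in \<open>auto simp: D_def\<close>)
  also have "\<dots> = (\<Prod>c<n. D $$ (c, c))"
    using D by (simp add: prod_list_diag_prod atLeast0LessThan)
  also have "\<dots> = (\<Prod>c<n. if c \<in> C then ?d else 1)"
    by (intro prod.cong) (auto simp: D_def)
  also have "\<dots> = ?d ^ card C"
  proof -
    have "{..<n} \<inter> C = C" using C by auto
    then show ?thesis by (simp add: prod.If_cases Int_def)
  qed
  finally have detD: "det D = ?d ^ card C" .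
  have "det ?Pp = [:det P:]" by (rule coeff_lift_hom.hom_det)
  then have "char_poly A * [:det P:] = det N * ?d ^ card C"
    using det_mult[OF M Pp] det_mult[OF N D] unfolding MP detD char_poly_def by simp
  then have "?d ^ card C dvd smult (det P) (char_poly A)" by simp
  then show ?thesis using detP by (simp add: dvd_smult_iff)
qed

lemma square_dvd_imp_pderiv_0:
  fixes p :: "complex poly"
  assumes "[:- z, 1:] ^ 2 dvd p"
  shows "poly p z = 0" "poly (pderiv p) z = 0"
proof -
  obtain g where "p = [:- z, 1:] ^ 2 * g" using assms by (rule dvdE)
  then have g: "p = [:- z, 1:] * ([:- z, 1:] * g)" by (simp only: power2_eq_square mult.assoc)
  show "poly p z = 0" unfolding g by simp
  show "poly (pderiv p) z = 0" unfolding g pderiv_mult poly_add poly_mult by simp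
qed

lemma cube_dvd_imp_pderiv_0:
  fixes p :: "complex poly"
  assumes "[:- z, 1:] ^ 3 dvd p"
  shows "poly p z = 0" "poly (pderiv (pderiv p)) z = 0"
proof -
  obtain g where "p = [:- z, 1:] ^ 3 * g" using assms by (rule dvdE)
  then have g: "p = [:- z, 1:] * ([:- z, 1:] * ([:- z, 1:] * g))" by (simp only: power3_eq_cube mult.assoc)
  show "poly p z = 0" unfolding g by simp
  show "poly (pderiv (pderiv p)) z = 0" unfolding g pderiv_mult pderiv_add poly_add poly_mult by simp
qed

lemma nonzero_vec_index:
  assumes "v \<in> carrier_vec n" "v \<noteq> 0\<^sub>v n"
  obtains i where "i < n" "v $ i \<noteq> 0"
  using assms by (metis carrier_vecD eq_vecI index_zero_vec)

lemma eigen_sub: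
  fixes A :: "complex mat"
  assumes A: "A \<in> carrier_mat n n" and v: "v \<in> carrier_vec n" "A *\<^sub>v v = lam \<cdot>\<^sub>v v"
    and w: "w \<in> carrier_vec n" "A *\<^sub>v w = lam \<cdot>\<^sub>v w"
  shows "A *\<^sub>v (w + c \<cdot>\<^sub>v v) = lam \<cdot>\<^sub>v (w + c \<cdot>\<^sub>v v)"
proof -
  have "A *\<^sub>v (w + c \<cdot>\<^sub>v v) = lam \<cdot>\<^sub>v w + c \<cdot>\<^sub>v (lam \<cdot>\<^sub>v v)"
    using v w by (simp add: mult_add_distrib_mat_vec[OF A] mult_mat_vec[OF A])
  also have "\<dots> = lam \<cdot>\<^sub>v (w + c \<cdot>\<^sub>v v)"
    using v w by (intro eq_vecI) (auto simp: algebra_simps)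
  finally show ?thesis .
qed

text \<open>Eliminate from \<open>w\<close> its coordinate at a pivot \<open>i\<close> of
  \<open>v\<close>. A nonzero remainder has a pivot \<open>k\<close> other than \<open>i\<close>, so
  the two eigenvectors placed in columns \<open>i\<close> and \<open>k\<close> are independent, and
  the root would be multiple.\<close>

lemma simple_root_eigenspace:
  fixes A :: "complex mat"
  assumes A: "A \<in> carrier_mat n n"
    and simple: "\<not> (poly (char_poly A) lam = 0 \<and> poly (pderiv (char_poly A)) lam = 0)"
    and v: "v \<in> carrier_vec n" "A *\<^sub>v v = lam \<cdot>\<^sub>v v" "v \<noteq> 0\<^sub>v n"
    and w: "w \<in> carrier_vec n" "A *\<^sub>v w = lam \<cdot>\<^sub>v w"
  shows "\<exists>a. w = a \<cdot>\<^sub>v v"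
proof -
  obtain i where i: "i < n" "v $ i \<noteq> 0" using nonzero_vec_index[OF v(1,3)] .
  define u where "u = w + (- (w $ i / v $ i)) \<cdot>\<^sub>v v"
  have u: "u \<in> carrier_vec n" using v w by (simp add: u_def)
  have Au: "A *\<^sub>v u = lam \<cdot>\<^sub>v u" unfolding u_def by (rule eigen_sub[OF A v(1,2) w])
  have ui: "u $ i = 0" using i v w by (simp add: u_def)
  show ?thesis
  proof (cases "u = 0\<^sub>v n")
    case True
    have "w = (w $ i / v $ i) \<cdot>\<^sub>v v"
    proof (rule eq_vecI)
      fix r assume "r < dim_vec ((w $ i / v $ i) \<cdot>\<^sub>v v)"
      then have r: "r < n" using v by simp
      have "u $ r = 0" using True r by simp
      then show "w $ r = ((w $ i / v $ i) \<cdot>\<^sub>v v) $ r" using r v w by (simp add: u_def)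
    qed (use v w in auto)
    then show ?thesis ..
  next
    case False
    then obtain k where k: "k < n" "u $ k \<noteq> 0" using nonzero_vec_index[OF u] by blast
    have ik: "i \<noteq> k" using ui k by auto
    let ?V = "\<lambda>c. if c = i then v else u"
    have "[:- lam, 1:] ^ card {i, k} dvd char_poly A"
    proof (rule eigenvectors_dvd_char_poly[OF A, where V = ?V])
      fix x :: "complex Matrix.vec" assume x: "x \<in> carrier_vec n"
        and e: "\<And>r. r < n \<Longrightarrow> (\<Sum>c\<in>{i, k}. ?V c $ r * x $ c) + (if r \<in> {i, k} then 0 else x $ r) = 0"
      have xi: "x $ i = 0" using e[of i] i ik ui by simp
      have xk: "x $ k = 0" using e[of k] k ik xi by simp
      show "x = 0\<^sub>v n"
      proof (rule eq_vecI)
        fix r assume "r < dim_vec (0\<^sub>v n :: complex Matrix.vec)"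
        then have r: "r < n" by simp
        show "x $ r = 0\<^sub>v n $ r" using e[of r] r ik xi xk by (cases "r = i"; cases "r = k") auto
      qed (use x in auto)
    qed (use i k v u Au in auto)
    then have "[:- lam, 1:] ^ 2 dvd char_poly A" using ik by (simp add: numeral_2_eq_2)
    then show ?thesis using square_dvd_imp_pderiv_0 simple by blast
  qed
qed

text \<open>One more elimination step than for a simple root: a third independent eigenvector would
  force a triple factor, hence a common root with the second derivative.\<close>

lemma double_root_eigenspace:
  fixes A :: "complex mat"
  assumes A: "A \<in> carrier_mat n n"
    and double: "\<not> (poly (char_poly A) lam = 0 \<and> poly (pderiv (pderiv (char_poly A))) lam = 0)"
    and v: "v \<in> carrier_vec n" "A *\<^sub>v v = lam \<cdot>\<^sub>v v" "v \<noteq> 0\<^sub>v n"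
    and v': "v' \<in> carrier_vec n" "A *\<^sub>v v' = lam \<cdot>\<^sub>v v'" "\<And>a. v' \<noteq> a \<cdot>\<^sub>v v"
    and w: "w \<in> carrier_vec n" "A *\<^sub>v w = lam \<cdot>\<^sub>v w"
  shows "\<exists>a b. w = a \<cdot>\<^sub>v v + b \<cdot>\<^sub>v v'"
proof -
  obtain i where i: "i < n" "v $ i \<noteq> 0" using nonzero_vec_index[OF v(1,3)] .
  define s where "s = v' $ i / v $ i"
  define u where "u = v' + (- s) \<cdot>\<^sub>v v"
  have u: "u \<in> carrier_vec n" using v v' by (simp add: u_def)
  have Au: "A *\<^sub>v u = lam \<cdot>\<^sub>v u" unfolding u_def by (rule eigen_sub[OF A v(1,2) v'(1,2)])
  have ui: "u $ i = 0" using i v v' by (simp add: u_def s_def)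
  have u_r: "u $ r = v' $ r - s * v $ r" if "r < n" for r using that v v' by (simp add: u_def)
  have "u \<noteq> 0\<^sub>v n"
  proof
    assume u0: "u = 0\<^sub>v n"
    have "v' = s \<cdot>\<^sub>v v"
    proof (rule eq_vecI)
      fix r assume "r < dim_vec (s \<cdot>\<^sub>v v)"
      then have r: "r < n" using v by simp
      then show "v' $ r = (s \<cdot>\<^sub>v v) $ r" using u_r[OF r] v by (simp add: u0)
    qed (use v v' in auto)
    then show False using v'(3) by blast
  qed
  then obtain k where k: "k < n" "u $ k \<noteq> 0" using nonzero_vec_index[OF u] by blast
  have ik: "i \<noteq> k" using ui k by auto
  define a where "a = w $ i / v $ i"
  define y where "y = w + (- a) \<cdot>\<^sub>v v"
  have y: "y \<in> carrier_vec n" using v w by (simp add: y_def)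
  have Ay: "A *\<^sub>v y = lam \<cdot>\<^sub>v y" unfolding y_def by (rule eigen_sub[OF A v(1,2) w])
  have yi: "y $ i = 0" using i v w by (simp add: y_def a_def)
  define b where "b = y $ k / u $ k"
  define z where "z = y + (- b) \<cdot>\<^sub>v u"
  have z: "z \<in> carrier_vec n" using y u by (simp add: z_def)
  have Az: "A *\<^sub>v z = lam \<cdot>\<^sub>v z" unfolding z_def by (rule eigen_sub[OF A u Au y Ay])
  have zi: "z $ i = 0" using i ui yi u y by (simp add: z_def)
  have zk: "z $ k = 0" using k u y by (simp add: z_def b_def)
  have z_r: "z $ r = w $ r - a * v $ r - b * (v' $ r - s * v $ r)" if "r < n" for r
    using that u_r[OF that] u y w v by (simp add: z_def y_def)
  show ?thesis
  proof (cases "z = 0\<^sub>v n")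
    case True
    have "w = (a - b * s) \<cdot>\<^sub>v v + b \<cdot>\<^sub>v v'"
    proof (rule eq_vecI)
      fix r assume "r < dim_vec ((a - b * s) \<cdot>\<^sub>v v + b \<cdot>\<^sub>v v')"
      then have r: "r < n" using v v' by simp
      have "w $ r - a * v $ r - b * (v' $ r - s * v $ r) = 0" using z_r[OF r] r True by simp
      then show "w $ r = ((a - b * s) \<cdot>\<^sub>v v + b \<cdot>\<^sub>v v') $ r" using r v v' by (simp add: algebra_simps)
    qed (use v v' w in auto)
    then show ?thesis by blast
  next
    case False
    then obtain m where m: "m < n" "z $ m \<noteq> 0" using nonzero_vec_index[OF z] by blast
    have im: "i \<noteq> m" "k \<noteq> m" using zi zk m by auto
    let ?V = "\<lambda>c. if c = i then v else if c = k then u else z"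
    have "[:- lam, 1:] ^ card {i, k, m} dvd char_poly A"
    proof (rule eigenvectors_dvd_char_poly[OF A, where V = ?V])
      fix x :: "complex Matrix.vec" assume x: "x \<in> carrier_vec n"
        and e: "\<And>r. r < n \<Longrightarrow> (\<Sum>c\<in>{i, k, m}. ?V c $ r * x $ c) + (if r \<in> {i, k, m} then 0 else x $ r) = 0"
      have s3: "(\<Sum>c\<in>{i, k, m}. F c) = F i + F k + F m" for F :: "nat \<Rightarrow> complex"
        using ik im by simp
      have xi: "x $ i = 0" using e[of i] i ik im ui zi unfolding s3 by simp
      have xk: "x $ k = 0" using e[of k] k ik im xi zk unfolding s3 by simp
      have xm: "x $ m = 0" using e[of m] m ik im xi xk unfolding s3 by simp
      show "x = 0\<^sub>v n"
      proof (rule eq_vecI)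
        fix r assume "r < dim_vec (0\<^sub>v n :: complex Matrix.vec)"
        then have r: "r < n" by simp
        show "x $ r = 0\<^sub>v n $ r" using e[of r] r xi xk xm unfolding s3
          by (cases "r = i"; cases "r = k"; cases "r = m") auto
      qed (use x in auto)
    qed (use i k m v u z Au Az in auto)
    then have "[:- lam, 1:] ^ 3 dvd char_poly A" using ik im by (simp add: numeral_3_eq_3)
    then show ?thesis using cube_dvd_imp_pderiv_0 double by blast
  qed
qed

subsection \<open>Fourier coefficients of eigenfunctions\<close>

lemma has_vector_derivative_quotient_limit:
  fixes f :: "real \<Rightarrow> 'a::real_normed_vector"
  assumes f: "(f has_vector_derivative d) (at 0)" and h: "h \<longlonglongrightarrow> 0" "\<And>i. h i \<noteq> (0::real)"
  shows "(\<lambda>i. (1 / h i) *\<^sub>R (f (h i) - f 0)) \<longlonglongrightarrow> d"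
proof -
  have "((\<lambda>y. norm (f y - f 0 - (y - 0) *\<^sub>R d) / norm (y - 0)) \<longlongrightarrow> 0) (at 0)"
    using f unfolding has_vector_derivative_def has_derivative_iff_norm by simp
  moreover have "filterlim h (at 0) sequentially"
    using h by (auto simp: filterlim_at)
  ultimately have "(\<lambda>i. norm (f (h i) - f 0 - (h i - 0) *\<^sub>R d) / norm (h i - 0)) \<longlonglongrightarrow> 0"
    by (rule filterlim_compose)
  moreover have "norm (f (h i) - f 0 - (h i - 0) *\<^sub>R d) / norm (h i - 0) = norm ((1 / h i) *\<^sub>R (f (h i) - f 0) - d)" for i
  proof -
    have "(1 / h i) *\<^sub>R (f (h i) - f 0) - d = (1 / h i) *\<^sub>R (f (h i) - f 0 - h i *\<^sub>R d)"
      using h(2)[of i] by (simp add: scaleR_right_diff_distrib)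
    then show ?thesis by simp
  qed
  ultimately have "(\<lambda>i. norm ((1 / h i) *\<^sub>R (f (h i) - f 0) - d)) \<longlonglongrightarrow> 0" by simp
  then have "(\<lambda>i. (1 / h i) *\<^sub>R (f (h i) - f 0) - d) \<longlonglongrightarrow> 0" by (rule tendsto_norm_zero_cancel)
  then show ?thesis by (rule LIM_zero_cancel)
qed

text \<open>By the group law x exp((s + t) X) = (x exp(t X)) exp(s X), so differentiability at time
  0 from every base point gives it at every time.\<close>

lemma lvf_has_derivative:
  assumes diff: "\<And>x. x \<in> SU2 \<Longrightarrow> (\<lambda>t::real. f (x ** mexp (t *\<^sub>R X))) differentiable (at 0)"
    and X: "X \<in> su2" and x: "x \<in> SU2"
  shows "((\<lambda>t. f (x ** mexp (t *\<^sub>R X))) has_real_derivative lvf X f (x ** mexp (t *\<^sub>R X))) (at t)"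
proof -
  let ?y = "x ** mexp (t *\<^sub>R X)"
  have y: "?y \<in> SU2" using x X by simp
  have "((\<lambda>s. f (?y ** mexp (s *\<^sub>R X))) has_vector_derivative lvf X f ?y) (at 0)"
    using diff[OF y] unfolding lvf_def by (simp only: vector_derivative_works)
  then have "((\<lambda>s. f (?y ** mexp (s *\<^sub>R X))) has_real_derivative lvf X f ?y) (at 0)"
    by (simp only: has_real_derivative_iff_has_vector_derivative)
  moreover have "?y ** mexp (s *\<^sub>R X) = x ** mexp ((s + t) *\<^sub>R X)" for s
    by (simp only: add.commute[of s] mexp_add[OF X] matrix_mul_assoc)
  ultimately have "((\<lambda>s. f (x ** mexp ((s + t) *\<^sub>R X))) has_real_derivative lvf X f ?y) (at 0)" by simp
  then show ?thesis using DERIV_shift[of "\<lambda>s. f (x ** mexp (s *\<^sub>R X))" "lvf X f ?y" 0 t] by simp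
qed

text \<open>Difference quotients of \<open>f\<close> are bounded by the supremum of
  \<open>lvf X f\<close> through the mean value theorem, so dominated convergence applies. Right
  invariance then shifts the translation to the matrix entry, as translation by exp(-t X); this is
  the origin of the sign.\<close>

lemma haar_integral_by_parts:
  fixes f :: "m2 \<Rightarrow> real"
  assumes f: "continuous_on SU2 f" and Df: "continuous_on SU2 (lvf X f)"
    and diff: "\<And>x. x \<in> SU2 \<Longrightarrow> (\<lambda>t::real. f (x ** mexp (t *\<^sub>R X))) differentiable (at 0)"
    and X: "X \<in> su2" and jk: "j \<le> n" "k \<le> n"
  shows "(LINT x|haar. of_real (lvf X f x) * sym_rep n x $$ (j, k))
    = - (\<Sum>l\<le>n. (LINT x|haar. of_real (f x) * sym_rep n x $$ (j, l)) * dent n X l k)"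
proof -
  define h where "h i = inverse (real (Suc i))" for i
  have h: "h \<longlonglongrightarrow> 0" "\<And>i. h i > 0" unfolding h_def using LIMSEQ_inverse_real_of_nat by auto
  have hn: "h i \<noteq> 0" for i using h(2)[of i] by simp
  define F where "F l = (LINT x|haar. of_real (f x) * sym_rep n x $$ (j, l))" for l
  let ?g = "\<lambda>x. sym_rep n x $$ (j, k)"
  let ?e = "\<lambda>t. mexp (t *\<^sub>R X)"
  define q where "q i x = (f (x ** ?e (h i)) - f x) / h i" for i x
  have g: "continuous_on SU2 (\<lambda>x. sym_rep n x $$ (j, l))" if "l \<le> n" for l
    using that jk by (simp add: sym_rep_form_coeff continuous_intros del: sym_rep_index)
  have fe: "continuous_on SU2 (\<lambda>x. f (x ** ?e t))" for t
    by (rule continuous_on_compose2[OF f]) (use X in \<open>auto intro!: continuous_intros\<close>)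
  have cq: "continuous_on SU2 (q i)" for i
    unfolding q_def using hn by (intro continuous_intros fe f) auto
  have "bounded (lvf X f ` SU2)"
    using compact_continuous_image[OF Df compact_SU2] by (rule compact_imp_bounded)
  then obtain B where B: "\<And>x. x \<in> SU2 \<Longrightarrow> \<bar>lvf X f x\<bar> \<le> B" unfolding bounded_iff by auto
  note der = lvf_has_derivative[where f = f, OF diff X]
  have qB: "\<bar>q i x\<bar> \<le> B" if x: "x \<in> SU2" for i x
  proof -
    obtain z where "0 < z" "z < h i" "f (x ** ?e (h i)) - f (x ** ?e 0) = (h i - 0) * lvf X f (x ** ?e z)"
      using MVT2[of 0 "h i" "\<lambda>t. f (x ** ?e t)" "\<lambda>t. lvf X f (x ** ?e t)"] der[OF _ x] h(2)[of i] by auto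
    then have "q i x = lvf X f (x ** ?e z)" using hn[of i] by (simp add: q_def)
    then show ?thesis using B[of "x ** ?e z"] x X by simp
  qed
  have ql: "(\<lambda>i. q i x) \<longlonglongrightarrow> lvf X f x" if x: "x \<in> SU2" for x
  proof -
    have "((\<lambda>t. f (x ** ?e t)) has_vector_derivative lvf X f (x ** ?e 0)) (at 0)"
      using der[OF _ x, of 0] by (simp only: has_real_derivative_iff_has_vector_derivative)
    from has_vector_derivative_quotient_limit[OF this h(1) hn] show ?thesis by (simp add: q_def)
  qed
  have lim1: "(\<lambda>i. LINT x|haar. of_real (q i x) * ?g x) \<longlonglongrightarrow> (LINT x|haar. of_real (lvf X f x) * ?g x)"
  proof (rule integral_dominated_convergence[where w = "\<lambda>x. B * norm (?g x)"])
    show "(\<lambda>x. of_real (lvf X f x) * ?g x) \<in> borel_measurable haar"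
      by (intro haar_measurable continuous_intros Df g jk)
    show "(\<lambda>x. of_real (q i x) * ?g x) \<in> borel_measurable haar" for i
      by (intro haar_measurable continuous_intros cq g jk)
    show "integrable haar (\<lambda>x. B * norm (?g x))"
      by (intro haar_integrable continuous_intros g jk)
    show "AE x in haar. (\<lambda>i. of_real (q i x) * ?g x) \<longlonglongrightarrow> of_real (lvf X f x) * ?g x"
      by (rule AE_I2) (auto intro!: tendsto_intros ql simp del: sym_rep_index)
    show "AE x in haar. norm (of_real (q i x) * ?g x) \<le> B * norm (?g x)" for i
      by (rule AE_I2) (auto simp: norm_mult intro!: mult_right_mono qB simp del: sym_rep_index)
  qed
  have trans: "(LINT x|haar. of_real (f (x ** ?e t)) * ?g x) = (\<Sum>l\<le>n. F l * sym_rep n (?e (- t)) $$ (l, k))" for t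
  proof -
    have inv: "x ** ?e t ** ?e (- t) = x" for x :: m2
      unfolding matrix_mul_assoc[symmetric] mexp_add[OF X, symmetric] by simp
    have "(LINT x|haar. of_real (f (x ** ?e t)) * ?g x) = (LINT x|haar. of_real (f (x ** ?e t)) * ?g (x ** ?e t ** ?e (- t)))"
      unfolding inv ..
    also have "\<dots> = (LINT x|haar. of_real (f x) * ?g (x ** ?e (- t)))"
    proof (rule haar_integral_translate(2)[where f = "\<lambda>x. of_real (f x) * ?g (x ** ?e (- t))"])
      show "continuous_on SU2 (\<lambda>x. of_real (f x) * ?g (x ** ?e (- t)))"
        using jk unfolding sym_rep_form_coeff[OF jk] by (intro continuous_intros f)
    qed (use X in simp)
    also have "\<dots> = (LINT x|haar. (\<Sum>l\<le>n. of_real (f x) * sym_rep n x $$ (j, l) * sym_rep n (?e (- t)) $$ (l, k)))"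
    proof (rule Bochner_Integration.integral_cong)
      fix x
      have "?g (x ** ?e (- t)) = (\<Sum>l\<le>n. sym_rep n x $$ (j, l) * sym_rep n (?e (- t)) $$ (l, k))"
        using mat_mult_index[of j "Suc n" k "Suc n" "sym_rep n x" "Suc n" "sym_rep n (?e (- t))"] jk
        unfolding sym_rep_mult lessThan_Suc_atMost by simp
      then show "of_real (f x) * ?g (x ** ?e (- t)) = (\<Sum>l\<le>n. of_real (f x) * sym_rep n x $$ (j, l) * sym_rep n (?e (- t)) $$ (l, k))"
        by (simp only: sum_distrib_left mult.assoc)
    qed simp
    also have "\<dots> = (\<Sum>l\<le>n. F l * sym_rep n (?e (- t)) $$ (l, k))"
      unfolding F_def
      by (subst Bochner_Integration.integral_sum)
        (auto intro!: haar_integrable continuous_intros f g simp del: sym_rep_index)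
    finally show ?thesis .
  qed
  have int_q: "(LINT x|haar. of_real (q i x) * ?g x)
     = (\<Sum>l\<le>n. F l * (- ((1 / (- h i)) *\<^sub>R (sym_rep n (?e (- h i)) $$ (l, k) - sym_rep n (?e 0) $$ (l, k)))))" for i
  proof -
    have "(LINT x|haar. of_real (q i x) * ?g x)
       = (LINT x|haar. of_real (1 / h i) * (of_real (f (x ** ?e (h i))) * ?g x - of_real (f (x ** ?e 0)) * ?g x))"
      using hn[of i] by (intro Bochner_Integration.integral_cong) (auto simp: q_def field_simps simp del: sym_rep_index)
    also have "\<dots> = of_real (1 / h i) * ((LINT x|haar. of_real (f (x ** ?e (h i))) * ?g x) - (LINT x|haar. of_real (f (x ** ?e 0)) * ?g x))"
      by (subst integral_mult_right_zero, subst Bochner_Integration.integral_diff)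
        (auto intro!: haar_integrable continuous_intros fe g jk simp del: sym_rep_index mexp_0 scaleR_zero_left)
    also have "\<dots> = (\<Sum>l\<le>n. F l * (- ((1 / (- h i)) *\<^sub>R (sym_rep n (?e (- h i)) $$ (l, k) - sym_rep n (?e 0) $$ (l, k)))))"
      unfolding trans sum_subtractf[symmetric] sum_distrib_left
      by (rule sum.cong) (auto simp: c_scaleR algebra_simps simp del: sym_rep_index)
    finally show ?thesis .
  qed
  have lim2: "(\<lambda>i. LINT x|haar. of_real (q i x) * ?g x) \<longlonglongrightarrow> (\<Sum>l\<le>n. F l * (- dent n X l k))"
    unfolding int_q
  proof (intro tendsto_sum tendsto_mult tendsto_const tendsto_minus)
    fix l assume "l \<in> {..n}"
    then have l: "l \<le> n" by simp
    have "(\<lambda>i. - h i) \<longlonglongrightarrow> 0" using tendsto_minus[OF h(1)] by simp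
    then show "(\<lambda>i. (1 / (- h i)) *\<^sub>R (sym_rep n (?e (- h i)) $$ (l, k) - sym_rep n (?e 0) $$ (l, k))) \<longlonglongrightarrow> dent n X l k"
      using hn by (intro has_vector_derivative_quotient_limit[where f = "\<lambda>t. sym_rep n (?e t) $$ (l, k)" and h = "\<lambda>i. - h i"]
          has_vector_derivative_sym_rep[OF X l jk(2)]) auto
  qed
  from LIMSEQ_unique[OF lim1 lim2] show ?thesis
    by (simp add: F_def sum_negf del: sym_rep_index)
qed

lemma smooth_SU2D:
  assumes "smooth_SU2 f"
  shows "\<And>x. x \<notin> SU2 \<Longrightarrow> f x = 0" "continuous_on SU2 f"
    and "\<And>X. X \<in> su2 \<Longrightarrow> continuous_on SU2 (lvf X f)"
    and "\<And>X Y. X \<in> su2 \<Longrightarrow> Y \<in> su2 \<Longrightarrow> continuous_on SU2 (lvf Y (lvf X f))"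
    and "\<And>X x. X \<in> su2 \<Longrightarrow> x \<in> SU2 \<Longrightarrow> (\<lambda>t::real. f (x ** mexp (t *\<^sub>R X))) differentiable (at 0)"
    and "\<And>X Y x. X \<in> su2 \<Longrightarrow> Y \<in> su2 \<Longrightarrow> x \<in> SU2 \<Longrightarrow> (\<lambda>t::real. lvf Y f (x ** mexp (t *\<^sub>R X))) differentiable (at 0)"
proof -
  note s = assms[unfolded smooth_SU2_def]
  show "f x = 0" if "x \<notin> SU2" for x using s that by blast
  have c: "continuous_on SU2 (iter_lvf Xs f)" if "set Xs \<subseteq> su2" for Xs using s that by blast
  have d: "(\<lambda>t::real. iter_lvf Xs f (x ** mexp (t *\<^sub>R X))) differentiable (at 0)" if "set Xs \<subseteq> su2" "X \<in> su2" "x \<in> SU2" for Xs X x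
    using s that by blast
  show "continuous_on SU2 f" using c[of "[]"] by (simp add: iter_lvf_def)
  show "continuous_on SU2 (lvf X f)" if "X \<in> su2" for X using c[of "[X]"] that by (simp add: iter_lvf_def)
  show "continuous_on SU2 (lvf Y (lvf X f))" if "X \<in> su2" "Y \<in> su2" for X Y using c[of "[Y, X]"] that by (simp add: iter_lvf_def)
  show "(\<lambda>t::real. f (x ** mexp (t *\<^sub>R X))) differentiable (at 0)" if "X \<in> su2" "x \<in> SU2" for X x
    using d[of "[]" X x] that by (simp add: iter_lvf_def)
  show "(\<lambda>t::real. lvf Y f (x ** mexp (t *\<^sub>R X))) differentiable (at 0)" if "X \<in> su2" "Y \<in> su2" "x \<in> SU2" for X Y x
    using d[of "[Y]" X x] that by (simp add: iter_lvf_def)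
qed

definition fourier :: "nat \<Rightarrow> (m2 \<Rightarrow> real) \<Rightarrow> nat \<Rightarrow> nat \<Rightarrow> complex" where
  "fourier n f j k = (LINT x|haar. of_real (f x) * sym_rep n x $$ (j, k))"

lemma fourier_lvf_lvf:
  assumes f: "smooth_SU2 f" and X: "X \<in> su2" and jk: "j \<le> n" "k \<le> n"
  shows "fourier n (lvf X (lvf X f)) j k = (\<Sum>m\<le>n. fourier n f j m * (\<Sum>l\<le>n. dent n X m l * dent n X l k))"
proof -
  note s = smooth_SU2D[OF f]
  have "fourier n (lvf X (lvf X f)) j k = - (\<Sum>l\<le>n. fourier n (lvf X f) j l * dent n X l k)"
    unfolding fourier_def by (rule haar_integral_by_parts[OF s(3) s(4) s(6)]) (use X jk in auto)
  also have "\<dots> = - (\<Sum>l\<le>n. (- (\<Sum>m\<le>n. fourier n f j m * dent n X m l)) * dent n X l k)"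
  proof -
    have "fourier n (lvf X f) j l = - (\<Sum>m\<le>n. fourier n f j m * dent n X m l)" if "l \<le> n" for l
      unfolding fourier_def by (rule haar_integral_by_parts[OF s(2) s(3) s(5)]) (use X jk that in auto)
    then show ?thesis by simp
  qed
  also have "\<dots> = (\<Sum>l\<le>n. \<Sum>m\<le>n. fourier n f j m * (dent n X m l * dent n X l k))"
    by (simp add: sum_negf sum_distrib_right mult.assoc)
  also have "\<dots> = (\<Sum>m\<le>n. \<Sum>l\<le>n. fourier n f j m * (dent n X m l * dent n X l k))"
    by (rule sum.swap)
  finally show ?thesis by (simp add: sum_distrib_left)
qed

text \<open>Two integrations by parts cancel each other's sign. Every row of the matrix of Fourier
  coefficients is therefore a left eigenvector of \<open>lap_mat\<close>, which is why the transpose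
  appears later.\<close>

lemma fourier_eigenspace:
  assumes f: "f \<in> eigenspace X Y Z lam" and XYZ: "X \<in> su2" "Y \<in> su2" "Z \<in> su2" and jk: "j \<le> n" "k \<le> n"
  shows "of_real lam * fourier n f j k = (\<Sum>m\<le>n. fourier n f j m * lap_mat n (X, Y, Z) $$ (m, k))"
proof -
  have sm: "smooth_SU2 f" and lap: "laplacian X Y Z f = (\<lambda>x. lam * f x)" using f by (auto simp: eigenspace_def)
  note s = smooth_SU2D[OF sm]
  have g: "continuous_on SU2 (\<lambda>x. sym_rep n x $$ (j, k))"
    using jk by (simp add: sym_rep_form_coeff continuous_intros del: sym_rep_index)
  have i: "integrable haar (\<lambda>x. of_real (lvf W (lvf W f) x) * sym_rep n x $$ (j, k))" if "W \<in> su2" for W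
    by (intro haar_integrable continuous_intros s(4) g that)
  have "of_real lam * fourier n f j k = (LINT x|haar. of_real (lam * f x) * sym_rep n x $$ (j, k))"
    by (simp add: fourier_def mult.assoc del: sym_rep_index)
  also have "\<dots> = (LINT x|haar. - (of_real (lvf X (lvf X f) x) * sym_rep n x $$ (j, k)
      + of_real (lvf Y (lvf Y f) x) * sym_rep n x $$ (j, k) + of_real (lvf Z (lvf Z f) x) * sym_rep n x $$ (j, k)))"
  proof (rule Bochner_Integration.integral_cong)
    fix x assume "x \<in> space haar"
    then have x: "x \<in> SU2" by simp
    have e: "lam * f x = - (lvf X (lvf X f) x + lvf Y (lvf Y f) x + lvf Z (lvf Z f) x)"
      using fun_cong[OF lap, of x] x by (simp add: laplacian_def)
    show "of_real (lam * f x) * sym_rep n x $$ (j, k) = - (of_real (lvf X (lvf X f) x) * sym_rep n x $$ (j, k)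
      + of_real (lvf Y (lvf Y f) x) * sym_rep n x $$ (j, k) + of_real (lvf Z (lvf Z f) x) * sym_rep n x $$ (j, k))"
      unfolding e by (simp add: algebra_simps del: sym_rep_index)
  qed simp
  also have "\<dots> = - (fourier n (lvf X (lvf X f)) j k + fourier n (lvf Y (lvf Y f)) j k + fourier n (lvf Z (lvf Z f)) j k)"
    unfolding fourier_def using i[OF XYZ(1)] i[OF XYZ(2)] i[OF XYZ(3)]
    by (simp del: sym_rep_index)
  also have "\<dots> = (\<Sum>m\<le>n. fourier n f j m * lap_mat n (X, Y, Z) $$ (m, k))"
    unfolding fourier_lvf_lvf[OF sm XYZ(1) jk] fourier_lvf_lvf[OF sm XYZ(2) jk] fourier_lvf_lvf[OF sm XYZ(3) jk]
      sum.distrib[symmetric] sum_negf[symmetric]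
    by (rule sum.cong) (use jk in \<open>auto simp: lap_mat_index algebra_simps\<close>)
  finally show ?thesis .
qed

text \<open>By the orthogonality relations the difference of the two sides has vanishing
  coefficients in every degree, so completeness applies. The prefactor is the inverse of the
  constant in \<open>avg_mat_sym_rep_eq\<close>.\<close>

lemma fourier_inversion:
  assumes f: "continuous_on SU2 f" and 0: "\<And>m j k. m \<noteq> n \<Longrightarrow> j \<le> m \<Longrightarrow> k \<le> m \<Longrightarrow> fourier m f j k = 0"
    and y: "y \<in> SU2"
  shows "of_real (f y) = of_nat (Suc n) / of_real (measure haar SU2) *
    (\<Sum>j\<le>n. \<Sum>i\<le>n. fourier n f i j * sym_rep n (cadj y) $$ (j, i))"
proof -
  let ?c = "of_nat (Suc n) / complex_of_real (measure haar SU2)"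
  define q where "q x = ?c * (\<Sum>j\<le>n. \<Sum>i\<le>n. fourier n f i j * sym_rep n (cadj x) $$ (j, i))" for x
  have c0: "?c * (of_real (measure haar SU2) / of_nat (Suc n)) = 1"
    using haar_measure_pos by (simp del: of_nat_Suc)
  have cs: "continuous_on SU2 (\<lambda>x. sym_rep n (cadj x) $$ (j, i))" if "j \<le> n" "i \<le> n" for i j
    unfolding sym_rep_form_coeff[OF that] by (intro continuous_intros)
  have cs': "continuous_on SU2 (\<lambda>x. sym_rep m x $$ (j, i))" if "j \<le> m" "i \<le> m" for i j m
    unfolding sym_rep_form_coeff[OF that] by (intro continuous_intros)
  have cq: "continuous_on SU2 q"
    unfolding q_def by (intro continuous_intros cs) auto
  have "of_real (f y) - q y = 0"
  proof (rule sym_rep_complete[where f = "\<lambda>x. of_real (f x) - q x", OF _ _ y])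
    show "continuous_on SU2 (\<lambda>x. of_real (f x) - q x)" by (intro continuous_intros f cq)
    fix m k l :: nat assume kl: "k \<le> m" "l \<le> m"
    have "(LINT x|haar. q x * sym_rep m x $$ (k, l))
      = (LINT x|haar. (\<Sum>j\<le>n. \<Sum>i\<le>n. (?c * fourier n f i j) * (sym_rep m x $$ (k, l) * sym_rep n (cadj x) $$ (j, i))))"
      unfolding q_def sum_distrib_left sum_distrib_right by (intro Bochner_Integration.integral_cong sum.cong) (auto simp: mult_ac simp del: sym_rep_index of_nat_Suc)
    also have "\<dots> = (\<Sum>j\<le>n. \<Sum>i\<le>n. (?c * fourier n f i j) * (LINT x|haar. sym_rep m x $$ (k, l) * sym_rep n (cadj x) $$ (j, i)))"
      by (subst Bochner_Integration.integral_sum, (intro haar_integrable continuous_intros cs cs' kl; simp),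
          rule sum.cong[OF refl], subst Bochner_Integration.integral_sum, (intro haar_integrable continuous_intros cs cs' kl; simp),
          rule sum.cong[OF refl], rule integral_mult_right_zero)
    also have "\<dots> = (\<Sum>j\<le>n. \<Sum>i\<le>n. (?c * fourier n f i j) * avg_mat (Suc m) (sym_rep m) (Suc n) (sym_rep n) l j $$ (k, i))"
      using kl by (intro sum.cong refl) (auto simp: avg_mat_def simp del: sym_rep_index)
    also have "\<dots> = fourier m f k l"
    proof (cases "m = n")
      case False
      have "avg_mat (Suc m) (sym_rep m) (Suc n) (sym_rep n) l j $$ (k, i) = 0" if "j \<le> n" "i \<le> n" for i j
        using avg_mat_sym_rep_neq[OF False, of l j] kl that by simp
      then show ?thesis using 0[OF False kl] by simp
    next
      case True
      have "(?c * fourier n f i j) * avg_mat (Suc m) (sym_rep m) (Suc n) (sym_rep n) l j $$ (k, i)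
         = (if i = k then if j = l then fourier n f k l else 0 else 0)" if "j \<le> n" "i \<le> n" for i j
      proof -
        have "avg_mat (Suc m) (sym_rep m) (Suc n) (sym_rep n) l j $$ (k, i)
           = (if l = j \<and> i = k then of_real (measure haar SU2) / of_nat (Suc n) else 0)"
          using avg_mat_sym_rep_eq[of l n j] kl that True by auto
        then show ?thesis using c0 by (auto simp del: of_nat_Suc)
      qed
      then have "(\<Sum>j\<le>n. \<Sum>i\<le>n. (?c * fourier n f i j) * avg_mat (Suc m) (sym_rep m) (Suc n) (sym_rep n) l j $$ (k, i))
         = (\<Sum>j\<le>n. \<Sum>i\<le>n. (if i = k then if j = l then fourier n f k l else 0 else 0))"
        by (intro sum.cong) auto
      also have "\<dots> = fourier n f k l" using kl True by (simp add: sum.delta)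
      finally show ?thesis using True by simp
    qed
    finally have "(LINT x|haar. q x * sym_rep m x $$ (k, l)) = fourier m f k l" .
    moreover have "(LINT x|haar. (of_real (f x) - q x) * sym_rep m x $$ (k, l))
       = fourier m f k l - (LINT x|haar. q x * sym_rep m x $$ (k, l))"
      unfolding fourier_def left_diff_distrib
      by (rule Bochner_Integration.integral_diff) (intro haar_integrable continuous_intros f cq cs' kl)+
    ultimately show "(LINT x|haar. (of_real (f x) - q x) * sym_rep m x $$ (k, l)) = 0" by simp
  qed
  then show ?thesis by (simp add: q_def)
qed

subsection \<open>Real eigenfunctions and the quaternionic structure\<close>

text \<open>The matrix coefficient u^T \<rho>(x^-1) w. The inverse turns the left regular action on
  functions into the representation acting on \<open>w\<close>, with \<open>u\<close> fixed.\<close>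

definition mcoeff :: "nat \<Rightarrow> complex Matrix.vec \<Rightarrow> complex Matrix.vec \<Rightarrow> m2 \<Rightarrow> complex" where
  "mcoeff n u w x = (\<Sum>j\<le>n. \<Sum>i\<le>n. u $ j * sym_rep n (cadj x) $$ (j, i) * w $ i)"

lemma mcoeff_add_right: "v \<in> carrier_vec (Suc n) \<Longrightarrow> w \<in> carrier_vec (Suc n) \<Longrightarrow> mcoeff n u (v + w) x = mcoeff n u v x + mcoeff n u w x"
  unfolding mcoeff_def sum.distrib[symmetric] by (intro sum.cong) (auto simp: algebra_simps simp del: sym_rep_index)

lemma mcoeff_smult_right: "v \<in> carrier_vec (Suc n) \<Longrightarrow> mcoeff n u (c \<cdot>\<^sub>v v) x = c * mcoeff n u v x"
  unfolding mcoeff_def sum_distrib_left by (intro sum.cong) (auto simp: algebra_simps simp del: sym_rep_index)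

lemma mcoeff_zero_right: "mcoeff n u (0\<^sub>v (Suc n)) x = 0"
  unfolding mcoeff_def by (intro sum.neutral ballI) simp

lemma mcoeff_left_translate:
  assumes "w \<in> carrier_vec (Suc n)"
  shows "mcoeff n u (sym_rep n g *\<^sub>v w) x = mcoeff n u w (cadj g ** x)"
proof -
  have s: "(\<Sum>i\<le>n. a * sym_rep n (cadj x) $$ (j, i) * (sym_rep n g *\<^sub>v w) $ i) = (\<Sum>i\<le>n. a * sym_rep n (cadj (cadj g ** x)) $$ (j, i) * w $ i)"
    if "j \<le> n" for a j
  proof -
    have "(\<Sum>i\<le>n. a * sym_rep n (cadj x) $$ (j, i) * (sym_rep n g *\<^sub>v w) $ i)
      = a * (sym_rep n (cadj x) *\<^sub>v (sym_rep n g *\<^sub>v w)) $ j"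
      using that assms mult_mat_vec_index[of j "Suc n" "sym_rep n (cadj x)" "Suc n" "sym_rep n g *\<^sub>v w"]
      by (simp add: lessThan_Suc_atMost sum_distrib_left mult.assoc mult_mat_vec_carrier[OF sym_rep_carrier] del: sym_rep_index index_mult_mat_vec)
    also have "sym_rep n (cadj x) *\<^sub>v (sym_rep n g *\<^sub>v w) = sym_rep n (cadj (cadj g ** x)) *\<^sub>v w"
      using assoc_mult_mat_vec[OF sym_rep_carrier sym_rep_carrier assms, of "cadj x" g]
      by (simp add: cadj_mult sym_rep_mult)
    also have "a * (sym_rep n (cadj (cadj g ** x)) *\<^sub>v w) $ j = (\<Sum>i\<le>n. a * sym_rep n (cadj (cadj g ** x)) $$ (j, i) * w $ i)"
      using that assms mult_mat_vec_index[of j "Suc n" "sym_rep n (cadj (cadj g ** x))" "Suc n" w]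
      by (simp add: lessThan_Suc_atMost sum_distrib_left mult.assoc del: sym_rep_index index_mult_mat_vec)
    finally show ?thesis .
  qed
  show ?thesis unfolding mcoeff_def by (intro sum.cong refl s) simp
qed

text \<open>The invariant antilinear map of \<open>sym_rep n\<close> in the monomial basis, acting on the row index.\<close>
definition twist :: "nat \<Rightarrow> complex Matrix.vec \<Rightarrow> complex Matrix.vec" where
  "twist n v = vec (Suc n) (\<lambda>l. (- 1) ^ l * cnj (v $ (n - l)))"

lemma twist_carrier [simp]: "twist n v \<in> carrier_vec (Suc n)"
  by (simp add: twist_def)

lemma twist_index [simp]: "l \<le> n \<Longrightarrow> twist n v $ l = (- 1) ^ l * cnj (v $ (n - l))"
  by (simp add: twist_def)

lemma twist_dim [simp]: "dim_vec (twist n v) = Suc n"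
  by (simp add: twist_def)

lemma minus_one_power_diff: "l \<le> n \<Longrightarrow> (- 1 :: complex) ^ (n - l) = (- 1) ^ n * (- 1) ^ l"
proof -
  assume "l \<le> n"
  then obtain m where "n = l + m" using le_Suc_ex by blast
  then show ?thesis by (simp add: power_add)
qed

lemma minus_one_power_square: "(- 1 :: complex) ^ l * (- 1) ^ l = 1"
  by (simp flip: power_mult_distrib)

lemma twist_twist:
  assumes "v \<in> carrier_vec (Suc n)"
  shows "twist n (twist n v) = (- 1) ^ n \<cdot>\<^sub>v v"
proof (rule eq_vecI)
  fix l assume "l < dim_vec ((- 1) ^ n \<cdot>\<^sub>v v)"
  then have l: "l \<le> n" using assms by simp
  have "twist n (twist n v) $ l = (- 1) ^ l * ((- 1) ^ (n - l) * v $ l)" using l by simp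
  also have "\<dots> = (- 1) ^ n * v $ l"
    unfolding minus_one_power_diff[OF l] using minus_one_power_square[of l] by (simp add: mult_ac)
  finally show "twist n (twist n v) $ l = ((- 1) ^ n \<cdot>\<^sub>v v) $ l" using l assms by simp
qed (use assms in \<open>simp add: twist_def\<close>)

lemma twist_smult: "v \<in> carrier_vec (Suc n) \<Longrightarrow> twist n (c \<cdot>\<^sub>v v) = cnj c \<cdot>\<^sub>v twist n v"
  by (rule eq_vecI) (auto simp: twist_def)

lemma sym_rep_J0:
  assumes "j \<le> n" "k \<le> n"
  shows "sym_rep n J0 $$ (j, k) = (if k = n - j then (- 1) ^ j else 0)"
proof -
  have "Pp J0 ^ k * Qp J0 ^ (n - k) = monom ((- 1) ^ (n - k)) (n - k)"
    by (simp add: Pp_def Qp_def pCons_0_power)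
  then show ?thesis using assms by auto
qed

text \<open>The relation J0 cnj(U) = U J0 read entrywise: \<open>J0\<close> acts on monomials by the
  reflection of exponents \<open>j\<close> to \<open>n - j\<close> with alternating signs.\<close>

lemma sym_rep_cnj_reflect:
  assumes U: "U \<in> SU2" and jk: "j \<le> n" "k \<le> n"
  shows "cnj (sym_rep n U $$ (n - j, n - k)) = (- 1) ^ (j + k) * sym_rep n U $$ (j, k)"
proof -
  have m: "(A * B) $$ (j, n - k) = (\<Sum>l\<le>n. A $$ (j, l) * B $$ (l, n - k))"
    if "A \<in> carrier_mat (Suc n) (Suc n)" "B \<in> carrier_mat (Suc n) (Suc n)" for A B :: "complex mat"
    using mat_mult_index[of j "Suc n" "n - k" "Suc n" A "Suc n" B] that jk by (simp add: lessThan_Suc_atMost)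
  have "sym_rep n J0 * sym_rep n (cnj_m2 U) = sym_rep n U * sym_rep n J0"
    unfolding sym_rep_mult[symmetric] J0_cnj[OF U] ..
  then have "(\<Sum>l\<le>n. sym_rep n J0 $$ (j, l) * sym_rep n (cnj_m2 U) $$ (l, n - k)) = (\<Sum>l\<le>n. sym_rep n U $$ (j, l) * sym_rep n J0 $$ (l, n - k))"
    by (simp only: m[OF sym_rep_carrier sym_rep_carrier, symmetric])
  also have "(\<Sum>l\<le>n. sym_rep n J0 $$ (j, l) * sym_rep n (cnj_m2 U) $$ (l, n - k)) = (\<Sum>l\<le>n. if l = n - j then (- 1) ^ j * sym_rep n (cnj_m2 U) $$ (l, n - k) else 0)"
    using jk by (intro sum.cong) (auto simp: sym_rep_J0 simp del: sym_rep_index)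
  also have "\<dots> = (- 1) ^ j * sym_rep n (cnj_m2 U) $$ (n - j, n - k)" by simp
  also have "(\<Sum>l\<le>n. sym_rep n U $$ (j, l) * sym_rep n J0 $$ (l, n - k)) = (\<Sum>l\<le>n. if l = k then sym_rep n U $$ (j, l) * (- 1) ^ l else 0)"
    using jk by (intro sum.cong) (auto simp: sym_rep_J0 simp del: sym_rep_index)
  also have "\<dots> = sym_rep n U $$ (j, k) * (- 1) ^ k" using jk by (simp del: sym_rep_index)
  finally have "(- 1) ^ j * sym_rep n (cnj_m2 U) $$ (n - j, n - k) = sym_rep n U $$ (j, k) * (- 1) ^ k" .
  then have "(- 1) ^ j * ((- 1) ^ j * sym_rep n (cnj_m2 U) $$ (n - j, n - k)) = (- 1) ^ j * (sym_rep n U $$ (j, k) * (- 1) ^ k)"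
    by (simp only:)
  then have "sym_rep n (cnj_m2 U) $$ (n - j, n - k) = (- 1) ^ j * (sym_rep n U $$ (j, k) * (- 1) ^ k)"
    by (simp only: mult.assoc[symmetric] minus_one_power_square mult_1)
  moreover have "sym_rep n (cnj_m2 U) $$ (n - j, n - k) = cnj (sym_rep n U $$ (n - j, n - k))"
    unfolding cnj_sym_rep[symmetric] by simp
  ultimately show ?thesis by (simp only: power_add mult_ac)
qed

lemma sum_reflect: "(\<Sum>j\<le>n. F (n - j)) = (\<Sum>j\<le>n. F j)" for F :: "nat \<Rightarrow> 'a::comm_monoid_add"
  by (rule sum.reindex_bij_witness[of _ "\<lambda>j. n - j" "\<lambda>j. n - j"]) auto

lemma sum_reflect2:
  "(\<Sum>j\<le>n. \<Sum>i\<le>n. G (n - j) (n - i)) = (\<Sum>j\<le>n. \<Sum>i\<le>n. G j i)" for G :: "nat \<Rightarrow> nat \<Rightarrow> 'a::comm_monoid_add"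
  unfolding sum_reflect[of "G _"] by (rule sum_reflect)

text \<open>Reversing both summation indices turns conjugated entries back into entries, and the
  resulting signs are absorbed by the two twists.\<close>

lemma cnj_mcoeff:
  assumes x: "x \<in> SU2"
  shows "cnj (mcoeff n u w x) = mcoeff n (twist n u) (twist n w) x"
proof -
  have "cnj (mcoeff n u w x) = (\<Sum>j\<le>n. \<Sum>i\<le>n. cnj (u $ j) * cnj (sym_rep n (cadj x) $$ (j, i)) * cnj (w $ i))"
    by (simp add: mcoeff_def cnj_sum del: sym_rep_index)
  also have "\<dots> = (\<Sum>j\<le>n. \<Sum>i\<le>n. cnj (u $ (n - j)) * cnj (sym_rep n (cadj x) $$ (n - j, n - i)) * cnj (w $ (n - i)))"
    by (rule sum_reflect2[symmetric])
  also have "\<dots> = mcoeff n (twist n u) (twist n w) x"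
    unfolding mcoeff_def
    by (intro sum.cong refl) (simp add: sym_rep_cnj_reflect[OF SU2_cadj[OF x]] power_add mult_ac del: sym_rep_index)
  finally show ?thesis .
qed

lemma dent_cnj_reflect:
  assumes Y: "Y \<in> su2" and jk: "j \<le> n" "k \<le> n"
  shows "cnj (dent n Y (n - j) (n - k)) = (- 1) ^ (j + k) * dent n Y j k"
proof -
  have c: "cnj (Y $v 1 $v 1) = - Y $v 1 $v 1" "Y $v 2 $v 2 = - Y $v 1 $v 1" "cnj (Y $v 2 $v 1) = - Y $v 1 $v 2" "cnj (Y $v 1 $v 2) = - Y $v 2 $v 1"
    using Y by (auto simp: su2_iff complex_eq_iff)
  consider "j = k" | "j = Suc k" | "k = Suc j" | "j \<noteq> k" "j \<noteq> Suc k" "k \<noteq> Suc j" by blast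
  then show ?thesis
  proof cases
    case 1
    have p: "(- 1 :: complex) ^ (j + k) = 1" using 1 by (simp add: power_add minus_one_power_square)
    show ?thesis using 1 jk c unfolding p by (simp add: dent_def algebra_simps)
  next
    case 2
    have p: "(- 1 :: complex) ^ (j + k) = - 1" using 2 by (simp add: power_add minus_one_power_square)
    have "n - k = Suc (n - j)" using 2 jk by simp
    then show ?thesis using 2 jk c unfolding p by (simp add: dent_def algebra_simps)
  next
    case 3
    have p: "(- 1 :: complex) ^ (j + k) = - 1" using 3 by (simp add: power_add minus_one_power_square)
    have "n - j = Suc (n - k)" using 3 jk by simp
    then show ?thesis using 3 jk c unfolding p by (simp add: dent_def algebra_simps)
  next
    case 4
    then have "n - j \<noteq> n - k" "n - j \<noteq> Suc (n - k)" "n - k \<noteq> Suc (n - j)" using jk by auto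
    then show ?thesis using 4 by (simp add: dent_def)
  qed
qed

lemma lap_mat_cnj_reflect:
  assumes XYZ: "X \<in> su2" "Y \<in> su2" "Z \<in> su2" and jk: "j \<le> n" "k \<le> n"
  shows "cnj (lap_mat n (X, Y, Z) $$ (n - j, n - k)) = (- 1) ^ (j + k) * lap_mat n (X, Y, Z) $$ (j, k)"
proof -
  have s: "cnj (\<Sum>l\<le>n. dent n W (n - j) l * dent n W l (n - k)) = (- 1) ^ (j + k) * (\<Sum>l\<le>n. dent n W j l * dent n W l k)"
    if W: "W \<in> su2" for W
  proof -
    have "cnj (\<Sum>l\<le>n. dent n W (n - j) l * dent n W l (n - k)) = (\<Sum>l\<le>n. cnj (dent n W (n - j) l) * cnj (dent n W l (n - k)))"
      by (simp add: cnj_sum)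
    also have "\<dots> = (\<Sum>l\<le>n. cnj (dent n W (n - j) (n - l)) * cnj (dent n W (n - l) (n - k)))"
      by (rule sum_reflect[symmetric])
    also have "\<dots> = (\<Sum>l\<le>n. (- 1) ^ (j + k) * (dent n W j l * dent n W l k))"
    proof (rule sum.cong)
      fix l assume "l \<in> {..n}"
      then have l: "l \<le> n" by simp
      have "(- 1 :: complex) ^ (j + l) * (- 1) ^ (l + k) = (- 1) ^ (j + k)"
        using minus_one_power_square[of l] by (simp add: power_add mult_ac)
      then show "cnj (dent n W (n - j) (n - l)) * cnj (dent n W (n - l) (n - k)) = (- 1) ^ (j + k) * (dent n W j l * dent n W l k)"
        unfolding dent_cnj_reflect[OF W jk(1) l] dent_cnj_reflect[OF W l jk(2)] by (simp only: mult_ac)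
    qed simp
    finally show ?thesis by (simp add: sum_distrib_left)
  qed
  have nj: "n - j \<le> n" "n - k \<le> n" by auto
  show ?thesis
    unfolding lap_mat_index[OF jk] lap_mat_index[OF nj] complex_cnj_minus complex_cnj_add s[OF XYZ(1)] s[OF XYZ(2)] s[OF XYZ(3)]
    by (simp add: algebra_simps)
qed

text \<open>The twist is antilinear and commutes with the transposed matrix, so it preserves the
  eigenspace of a real eigenvalue. For odd \<open>n\<close> its square is -1, which forces complex
  dimension at least two.\<close>

lemma twist_eigenvector:
  assumes XYZ: "X \<in> su2" "Y \<in> su2" "Z \<in> su2" and v: "v \<in> carrier_vec (Suc n)"
    and ev: "(lap_mat n (X, Y, Z))\<^sup>T *\<^sub>v v = of_real lam \<cdot>\<^sub>v v"
  shows "(lap_mat n (X, Y, Z))\<^sup>T *\<^sub>v twist n v = of_real lam \<cdot>\<^sub>v twist n v"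
proof (rule eq_vecI)
  let ?A = "lap_mat n (X, Y, Z)"
  have At: "?A\<^sup>T \<in> carrier_mat (Suc n) (Suc n)" by simp
  have mv: "(?A\<^sup>T *\<^sub>v u) $ k = (\<Sum>m\<le>n. ?A $$ (m, k) * u $ m)" if "k \<le> n" "u \<in> carrier_vec (Suc n)" for u k
    using mult_mat_vec_index[of k "Suc n" "?A\<^sup>T" "Suc n" u] that by (simp add: lessThan_Suc_atMost del: index_mult_mat_vec)
  fix k assume "k < dim_vec (of_real lam \<cdot>\<^sub>v twist n v)"
  then have k: "k \<le> n" by (simp add: twist_def)
  have nk: "n - k \<le> n" by simp
  have "(?A\<^sup>T *\<^sub>v twist n v) $ k = (\<Sum>m\<le>n. ?A $$ (m, k) * ((- 1) ^ m * cnj (v $ (n - m))))"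
    unfolding mv[OF k twist_carrier] by (intro sum.cong) auto
  also have "\<dots> = (\<Sum>m\<le>n. (- 1) ^ k * cnj (?A $$ (n - m, n - k) * v $ (n - m)))"
  proof (rule sum.cong)
    fix m assume "m \<in> {..n}"
    then have m: "m \<le> n" by simp
    have h: "(- 1) ^ m = ((- 1) ^ k * (- 1) ^ (m + k) :: complex)"
      using minus_one_power_square[of k] by (simp add: power_add mult_ac)
    show "?A $$ (m, k) * ((- 1) ^ m * cnj (v $ (n - m))) = (- 1) ^ k * cnj (?A $$ (n - m, n - k) * v $ (n - m))"
      unfolding complex_cnj_mult lap_mat_cnj_reflect[OF XYZ m k] h by (simp only: mult_ac)
  qed simp
  also have "\<dots> = (- 1) ^ k * cnj (\<Sum>m\<le>n. ?A $$ (n - m, n - k) * v $ (n - m))"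
    by (simp add: sum_distrib_left cnj_sum)
  also have "(\<Sum>m\<le>n. ?A $$ (n - m, n - k) * v $ (n - m)) = (?A\<^sup>T *\<^sub>v v) $ (n - k)"
    unfolding mv[OF nk v] by (rule sum_reflect)
  also have "(- 1) ^ k * cnj \<dots> = (of_real lam \<cdot>\<^sub>v twist n v) $ k"
    unfolding ev using v k by simp
  finally show "(?A\<^sup>T *\<^sub>v twist n v) $ k = (of_real lam \<cdot>\<^sub>v twist n v) $ k" .
qed (simp add: twist_def)

text \<open>The intersection of Z and i Z and the sum of Z and i Z are complex invariant subspaces.
  If the first is zero and the second everything, then Z is a real form, and conjugation with
  respect to Z is an equivariant real structure, contrary to \<open>nr\<close>.\<close>

lemma real_subspace_irreducible:
  assumes \<rho>: "is_irrep d \<rho>" and nr: "\<not> real_type d \<rho>"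
    and Zc: "Z \<subseteq> carrier_vec d" and Z0: "0\<^sub>v d \<in> Z" and Za: "\<And>v w. v \<in> Z \<Longrightarrow> w \<in> Z \<Longrightarrow> v + w \<in> Z"
    and Zs: "\<And>(c::real) v. v \<in> Z \<Longrightarrow> of_real c \<cdot>\<^sub>v v \<in> Z" and Zi: "\<And>U v. U \<in> SU2 \<Longrightarrow> v \<in> Z \<Longrightarrow> \<rho> U *\<^sub>v v \<in> Z"
  shows "Z = {0\<^sub>v d} \<or> Z = carrier_vec d"
proof -
  note \<rho>c = is_repD(1)[OF is_irrepD(1)[OF \<rho>]]
  have Zv: "v \<in> carrier_vec d" if "v \<in> Z" for v using Zc that by auto
  have \<rho>s: "\<rho> U *\<^sub>v (c \<cdot>\<^sub>v v) = c \<cdot>\<^sub>v (\<rho> U *\<^sub>v v)" if "U \<in> SU2" "v \<in> carrier_vec d" for U c v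
    using mult_mat_vec[OF \<rho>c[OF that(1)] that(2)] .
  have \<rho>a: "\<rho> U *\<^sub>v (v + w) = \<rho> U *\<^sub>v v + \<rho> U *\<^sub>v w" if "U \<in> SU2" "v \<in> carrier_vec d" "w \<in> carrier_vec d" for U v w
    using mult_add_distrib_mat_vec[OF \<rho>c[OF that(1)] that(2,3)] .
  have dec: "c \<cdot>\<^sub>v v = of_real (Re c) \<cdot>\<^sub>v v + of_real (Im c) \<cdot>\<^sub>v (\<i> \<cdot>\<^sub>v v)" if "v \<in> carrier_vec d" for c v
  proof (rule eq_vecI)
    fix r assume "r < dim_vec (of_real (Re c) \<cdot>\<^sub>v v + of_real (Im c) \<cdot>\<^sub>v (\<i> \<cdot>\<^sub>v v))"
    then have "r < d" using that by simp
    then show "(c \<cdot>\<^sub>v v) $ r = (of_real (Re c) \<cdot>\<^sub>v v + of_real (Im c) \<cdot>\<^sub>v (\<i> \<cdot>\<^sub>v v)) $ r"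
      using that arg_cong[OF complex_eq[of c], of "\<lambda>z. z * v $ r"] by (simp add: algebra_simps)
  qed (use that in auto)
  have neg: "(- 1) \<cdot>\<^sub>v v \<in> Z" if "v \<in> Z" for v using Zs[OF that, of "- 1"] by simp
  \<comment> \<open>The largest complex subspace inside \<open>Z\<close>.\<close>
  define Z1 where "Z1 = {v \<in> Z. \<i> \<cdot>\<^sub>v v \<in> Z}"
  have "csubspace d Z1"
    unfolding csubspace_def
  proof (intro conjI ballI allI)
    show "Z1 \<subseteq> carrier_vec d" using Zc by (auto simp: Z1_def)
    have "\<i> \<cdot>\<^sub>v 0\<^sub>v d = (0\<^sub>v d :: complex Matrix.vec)" by (rule eq_vecI) auto
    then show "0\<^sub>v d \<in> Z1" using Z0 by (simp add: Z1_def)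
    show "v + w \<in> Z1" if "v \<in> Z1" "w \<in> Z1" for v w
      using that Za by (auto simp: Z1_def smult_add_distrib_vec[OF Zv Zv])
    show "c \<cdot>\<^sub>v v \<in> Z1" if v: "v \<in> Z1" for c v
    proof -
      have vz: "v \<in> Z" "\<i> \<cdot>\<^sub>v v \<in> Z" using v by (auto simp: Z1_def)
      have "c \<cdot>\<^sub>v v \<in> Z" if "v \<in> Z" "\<i> \<cdot>\<^sub>v v \<in> Z" for c v
        using that by (subst dec[OF Zv]) (auto intro!: Za Zs)
      then show ?thesis using vz by (simp add: Z1_def smult_smult_assoc)
    qed
  qed
  then have "Z1 = {0\<^sub>v d} \<or> Z1 = carrier_vec d"
  proof (rule is_irrepD(3)[OF \<rho>])
    fix U v assume U: "U \<in> SU2" and "v \<in> Z1"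
    then show "\<rho> U *\<^sub>v v \<in> Z1" using Zi[OF U] \<rho>s[OF U Zv] by (auto simp: Z1_def) metis
  qed
  then show ?thesis
  proof
    assume "Z1 = carrier_vec d"
    then show ?thesis using Zc by (auto simp: Z1_def)
  next
    assume Z1: "Z1 = {0\<^sub>v d}"
    \<comment> \<open>The complex span of \<open>Z\<close>.\<close>
    define Z2 where "Z2 = {v. \<exists>a\<in>Z. \<exists>b\<in>Z. v = a + \<i> \<cdot>\<^sub>v b}"
    have "csubspace d Z2"
      unfolding csubspace_def
    proof (intro conjI ballI allI)
      show "Z2 \<subseteq> carrier_vec d" using Zv by (auto simp: Z2_def)
      have "0\<^sub>v d = 0\<^sub>v d + \<i> \<cdot>\<^sub>v (0\<^sub>v d :: complex Matrix.vec)" by (rule eq_vecI) auto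
      then show "0\<^sub>v d \<in> Z2" unfolding Z2_def using Z0 by blast
    next
      fix v w assume "v \<in> Z2" "w \<in> Z2"
      then obtain a b a' b' where *: "a \<in> Z" "b \<in> Z" "a' \<in> Z" "b' \<in> Z" "v = a + \<i> \<cdot>\<^sub>v b" "w = a' + \<i> \<cdot>\<^sub>v b'"
        by (auto simp: Z2_def)
      have "v + w = (a + a') + \<i> \<cdot>\<^sub>v (b + b')"
        unfolding * using *(1-4)[THEN Zv] by (intro eq_vecI) (auto simp: algebra_simps)
      then show "v + w \<in> Z2" unfolding Z2_def using *(1-4) Za by blast
    next
      fix c v assume "v \<in> Z2"
      then obtain a b where *: "a \<in> Z" "b \<in> Z" "v = a + \<i> \<cdot>\<^sub>v b" by (auto simp: Z2_def)
      let ?a = "of_real (Re c) \<cdot>\<^sub>v a + of_real (- Im c) \<cdot>\<^sub>v b" and ?b = "of_real (Re c) \<cdot>\<^sub>v b + of_real (Im c) \<cdot>\<^sub>v a"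
      have "c \<cdot>\<^sub>v v = ?a + \<i> \<cdot>\<^sub>v ?b"
      proof (rule eq_vecI)
        fix r assume "r < dim_vec (?a + \<i> \<cdot>\<^sub>v ?b)"
        then have "r < d" using *(1,2)[THEN Zv] by simp
        then show "(c \<cdot>\<^sub>v v) $ r = (?a + \<i> \<cdot>\<^sub>v ?b) $ r"
          unfolding * using *(1,2)[THEN Zv] by (simp add: complex_eq_iff algebra_simps)
      qed (use *(1,2)[THEN Zv] *(3) in auto)
      moreover have "?a \<in> Z" "?b \<in> Z" using * by (auto intro!: Za Zs simp del: of_real_minus)
      ultimately show "c \<cdot>\<^sub>v v \<in> Z2" unfolding Z2_def by blast
    qed
    then have "Z2 = {0\<^sub>v d} \<or> Z2 = carrier_vec d"
    proof (rule is_irrepD(3)[OF \<rho>])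
      fix U v assume U: "U \<in> SU2" and "v \<in> Z2"
      then obtain a b where *: "a \<in> Z" "b \<in> Z" "v = a + \<i> \<cdot>\<^sub>v b" by (auto simp: Z2_def)
      have "\<rho> U *\<^sub>v v = \<rho> U *\<^sub>v a + \<i> \<cdot>\<^sub>v (\<rho> U *\<^sub>v b)"
        unfolding *(3) using *(1,2)[THEN Zv] by (simp add: \<rho>a[OF U] \<rho>s[OF U])
      then show "\<rho> U *\<^sub>v v \<in> Z2" unfolding Z2_def using *(1,2) Zi[OF U] by blast
    qed
    then show ?thesis
    proof
      assume Z2: "Z2 = {0\<^sub>v d}"
      have "v = 0\<^sub>v d" if v: "v \<in> Z" for v
      proof -
        have "v = v + \<i> \<cdot>\<^sub>v 0\<^sub>v d" using Zv[OF v] by (intro eq_vecI) auto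
        then have "v \<in> Z2" using v Z0 unfolding Z2_def by blast
        then show ?thesis using Z2 by simp
      qed
      then show ?thesis using Z0 by blast
    next
      assume Z2: "Z2 = carrier_vec d"
      have "\<forall>v\<in>carrier_vec d. \<exists>p. fst p \<in> Z \<and> snd p \<in> Z \<and> fst p + \<i> \<cdot>\<^sub>v snd p = v"
      proof
        fix v :: "complex Matrix.vec" assume "v \<in> carrier_vec d"
        then obtain a b where "a \<in> Z" "b \<in> Z" "v = a + \<i> \<cdot>\<^sub>v b" using Z2 unfolding Z2_def by blast
        then show "\<exists>p. fst p \<in> Z \<and> snd p \<in> Z \<and> fst p + \<i> \<cdot>\<^sub>v snd p = v" by (intro exI[of _ "(a, b)"]) simp
      qed
      from bchoice[OF this] obtain p
        where p: "\<And>v. v \<in> carrier_vec d \<Longrightarrow> fst (p v) \<in> Z \<and> snd (p v) \<in> Z \<and> fst (p v) + \<i> \<cdot>\<^sub>v snd (p v) = v" by blast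
      define \<alpha> \<beta> where "\<alpha> v = fst (p v)" and "\<beta> v = snd (p v)" for v
      have ab: "\<alpha> v \<in> Z" "\<beta> v \<in> Z" and abe: "\<alpha> v + \<i> \<cdot>\<^sub>v \<beta> v = v" if "v \<in> carrier_vec d" for v
        using p[OF that] by (simp_all add: \<alpha>_def \<beta>_def)
      \<comment> \<open>Two decompositions differ by a vector of \<open>Z\<close> whose multiple by
        i lies in \<open>Z\<close> again, that is, by an element of the zero space
        \<open>Z1\<close>.\<close>
      have uniq: "a = a' \<and> b = b'" if z: "a \<in> Z" "b \<in> Z" "a' \<in> Z" "b' \<in> Z" and eq: "a + \<i> \<cdot>\<^sub>v b = a' + \<i> \<cdot>\<^sub>v b'" for a b a' b'
      proof -
        note zc = z[THEN Zv]
        have r: "a $ r + \<i> * b $ r = a' $ r + \<i> * b' $ r" if "r < d" for r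
          using arg_cong[OF eq, of "\<lambda>v. v $ r"] that zc by simp
        let ?u = "b' + (- 1) \<cdot>\<^sub>v b"
        have "\<i> \<cdot>\<^sub>v ?u = a + (- 1) \<cdot>\<^sub>v a'"
        proof (rule eq_vecI)
          fix i assume "i < dim_vec (a + (- 1) \<cdot>\<^sub>v a')"
          then have i: "i < d" using zc by simp
          show "(\<i> \<cdot>\<^sub>v ?u) $ i = (a + (- 1) \<cdot>\<^sub>v a') $ i" using r[OF i] i zc by (simp add: algebra_simps)
        qed (use zc in auto)
        moreover have "a + (- 1) \<cdot>\<^sub>v a' \<in> Z" "?u \<in> Z" using z neg Za by auto
        ultimately have "?u \<in> Z1" unfolding Z1_def by simp
        then have u0: "?u = 0\<^sub>v d" using Z1 by simp
        have b: "b $ i = b' $ i" if "i < d" for i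
          using arg_cong[OF u0, of "\<lambda>v. v $ i"] that zc by simp
        have "b = b'" by (rule eq_vecI) (use b zc in auto)
        moreover have "a = a'" by (rule eq_vecI) (use b r zc in auto)
        ultimately show ?thesis by simp
      qed
      \<comment> \<open>Complex conjugation with \<open>Z\<close> as its fixed space. Uniqueness of
        the decomposition makes it additive, antilinear and equivariant.\<close>
      define K where "K v = \<alpha> v + (- \<i>) \<cdot>\<^sub>v \<beta> v" for v
      have Keq: "K v = a + (- \<i>) \<cdot>\<^sub>v b" if "a \<in> Z" "b \<in> Z" "v = a + \<i> \<cdot>\<^sub>v b" for a b v
      proof -
        have v: "v \<in> carrier_vec d" using that Zv by auto
        have "\<alpha> v = a \<and> \<beta> v = b" by (rule uniq[OF ab[OF v] that(1,2)]) (rule trans[OF abe[OF v] that(3)])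
        then show ?thesis by (simp add: K_def)
      qed
      have "conj_linear_Gmap d \<rho> K"
        unfolding conj_linear_Gmap_def
      proof (intro conjI ballI allI)
        fix v :: "complex Matrix.vec" assume v: "v \<in> carrier_vec d"
        note abv = ab[OF v]
        have cv: "\<alpha> v \<in> carrier_vec d" "\<beta> v \<in> carrier_vec d" using abv Zv by auto
        show "K v \<in> carrier_vec d" using cv by (simp add: K_def)
        show "K (v + w) = K v + K w" if w: "w \<in> carrier_vec d" for w
        proof -
          note abw = ab[OF w]
          have cw: "\<alpha> w \<in> carrier_vec d" "\<beta> w \<in> carrier_vec d" using abw Zv by auto
          have "(\<alpha> v + \<i> \<cdot>\<^sub>v \<beta> v) + (\<alpha> w + \<i> \<cdot>\<^sub>v \<beta> w) = (\<alpha> v + \<alpha> w) + \<i> \<cdot>\<^sub>v (\<beta> v + \<beta> w)"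
            using cv cw by (intro eq_vecI) (auto simp: algebra_simps)
          then have "v + w = (\<alpha> v + \<alpha> w) + \<i> \<cdot>\<^sub>v (\<beta> v + \<beta> w)" by (simp only: abe[OF v] abe[OF w])
          then have "K (v + w) = (\<alpha> v + \<alpha> w) + (- \<i>) \<cdot>\<^sub>v (\<beta> v + \<beta> w)"
            using abv abw Za by (intro Keq) auto
          also have "\<dots> = K v + K w" unfolding K_def using cv cw by (intro eq_vecI) (auto simp: algebra_simps)
          finally show ?thesis .
        qed
        show "K (c \<cdot>\<^sub>v v) = cnj c \<cdot>\<^sub>v K v" for c
        proof -
          let ?a = "of_real (Re c) \<cdot>\<^sub>v \<alpha> v + of_real (- Im c) \<cdot>\<^sub>v \<beta> v" and ?b = "of_real (Re c) \<cdot>\<^sub>v \<beta> v + of_real (Im c) \<cdot>\<^sub>v \<alpha> v"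
          have "c \<cdot>\<^sub>v (\<alpha> v + \<i> \<cdot>\<^sub>v \<beta> v) = ?a + \<i> \<cdot>\<^sub>v ?b"
          proof (rule eq_vecI)
            fix r assume "r < dim_vec (?a + \<i> \<cdot>\<^sub>v ?b)"
            then have "r < d" using cv by simp
            then show "(c \<cdot>\<^sub>v (\<alpha> v + \<i> \<cdot>\<^sub>v \<beta> v)) $ r = (?a + \<i> \<cdot>\<^sub>v ?b) $ r"
              using cv by (simp add: complex_eq_iff algebra_simps)
          qed (use cv in auto)
          then have "c \<cdot>\<^sub>v v = ?a + \<i> \<cdot>\<^sub>v ?b" by (simp only: abe[OF v])
          moreover have "?a \<in> Z" "?b \<in> Z" using abv by (auto intro!: Za Zs simp del: of_real_minus)
          ultimately have "K (c \<cdot>\<^sub>v v) = ?a + (- \<i>) \<cdot>\<^sub>v ?b" by (intro Keq)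
          also have "\<dots> = cnj c \<cdot>\<^sub>v K v"
          proof (rule eq_vecI)
            fix r assume "r < dim_vec (cnj c \<cdot>\<^sub>v K v)"
            then have "r < d" using cv by (simp add: K_def)
            then show "(?a + (- \<i>) \<cdot>\<^sub>v ?b) $ r = (cnj c \<cdot>\<^sub>v K v) $ r"
              using cv by (simp add: K_def complex_eq_iff algebra_simps)
          qed (use cv in \<open>auto simp: K_def\<close>)
          finally show ?thesis .
        qed
      next
        fix U v assume U: "U \<in> SU2" and v: "(v :: complex Matrix.vec) \<in> carrier_vec d"
        note abv = ab[OF v]
        have cv: "\<alpha> v \<in> carrier_vec d" "\<beta> v \<in> carrier_vec d" using abv Zv by auto
        have "\<rho> U *\<^sub>v (\<alpha> v + \<i> \<cdot>\<^sub>v \<beta> v) = \<rho> U *\<^sub>v \<alpha> v + \<i> \<cdot>\<^sub>v (\<rho> U *\<^sub>v \<beta> v)"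
          using cv by (simp add: \<rho>a[OF U] \<rho>s[OF U])
        then have "\<rho> U *\<^sub>v v = \<rho> U *\<^sub>v \<alpha> v + \<i> \<cdot>\<^sub>v (\<rho> U *\<^sub>v \<beta> v)" by (simp only: abe[OF v])
        then have "K (\<rho> U *\<^sub>v v) = \<rho> U *\<^sub>v \<alpha> v + (- \<i>) \<cdot>\<^sub>v (\<rho> U *\<^sub>v \<beta> v)"
          using abv Zi[OF U] by (intro Keq) auto
        also have "\<dots> = \<rho> U *\<^sub>v K v" unfolding K_def using cv by (simp add: \<rho>a[OF U] \<rho>s[OF U])
        finally show "K (\<rho> U *\<^sub>v v) = \<rho> U *\<^sub>v K v" .
      qed
      moreover have "K (K v) = v" if v: "v \<in> carrier_vec d" for v
      proof -
        note abv = ab[OF v]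
        have cv: "\<alpha> v \<in> carrier_vec d" "\<beta> v \<in> carrier_vec d" using abv Zv by auto
        have "K v = \<alpha> v + \<i> \<cdot>\<^sub>v ((- 1) \<cdot>\<^sub>v \<beta> v)" unfolding K_def using cv by (intro eq_vecI) auto
        then have "K (K v) = \<alpha> v + (- \<i>) \<cdot>\<^sub>v ((- 1) \<cdot>\<^sub>v \<beta> v)" using abv neg by (intro Keq) auto
        also have "\<dots> = \<alpha> v + \<i> \<cdot>\<^sub>v \<beta> v" using cv by (intro eq_vecI) auto
        also have "\<dots> = v" by (rule abe[OF v])
        finally show ?thesis .
      qed
      ultimately show ?thesis using nr unfolding real_type_def by blast
    qed
  qed
qed

section \<open>Irreducibility of the eigenspaces for generic triples\<close>

definition fourier_row :: "nat \<Rightarrow> (m2 \<Rightarrow> real) \<Rightarrow> nat \<Rightarrow> complex Matrix.vec" where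
  "fourier_row n f i = vec (Suc n) (fourier n f i)"

lemma fourier_row_carrier [simp]: "fourier_row n f i \<in> carrier_vec (Suc n)"
  by (simp add: fourier_row_def)

lemma fourier_row_index: "j \<le> n \<Longrightarrow> fourier_row n f i $ j = fourier n f i j"
  by (simp add: fourier_row_def)

lemma fourier_row_eigenvector:
  assumes f: "f \<in> eigenspace X Y Z lam" and XYZ: "X \<in> su2" "Y \<in> su2" "Z \<in> su2" and i: "i \<le> n"
  shows "(lap_mat n (X, Y, Z))\<^sup>T *\<^sub>v fourier_row n f i = of_real lam \<cdot>\<^sub>v fourier_row n f i"
proof (rule eq_vecI)
  let ?A = "lap_mat n (X, Y, Z)"
  fix k assume "k < dim_vec (of_real lam \<cdot>\<^sub>v fourier_row n f i)"
  then have k: "k \<le> n" by (simp add: fourier_row_def)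
  have At: "?A\<^sup>T \<in> carrier_mat (Suc n) (Suc n)" by simp
  have "(?A\<^sup>T *\<^sub>v fourier_row n f i) $ k = (\<Sum>m\<le>n. ?A $$ (m, k) * fourier n f i m)"
    using mult_mat_vec_index[of k "Suc n" "?A\<^sup>T" "Suc n" "fourier_row n f i"] k
    by (simp add: lessThan_Suc_atMost fourier_row_index del: index_mult_mat_vec)
  also have "\<dots> = of_real lam * fourier n f i k"
    unfolding fourier_eigenspace[OF f XYZ i k] by (simp add: mult.commute)
  finally show "(?A\<^sup>T *\<^sub>v fourier_row n f i) $ k = (of_real lam \<cdot>\<^sub>v fourier_row n f i) $ k"
    using k by (simp add: fourier_row_index fourier_row_def del: index_mult_mat_vec)
qed (simp add: fourier_row_def)

lemma transpose_eigenvector_root: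
  fixes A :: "complex mat"
  assumes "A \<in> carrier_mat n n" "v \<in> carrier_vec n" "v \<noteq> 0\<^sub>v n" "A\<^sup>T *\<^sub>v v = c \<cdot>\<^sub>v v"
  shows "poly (char_poly A) c = 0"
proof -
  have At: "A\<^sup>T \<in> carrier_mat n n" using assms by simp
  then have "eigenvalue A\<^sup>T c"
    unfolding eigenvalue_def eigenvector_def using assms by (intro exI[of _ v]) auto
  then show ?thesis
    using eigenvalue_root_char_poly[OF At] char_poly_transpose_mat[OF assms(1)] by simp
qed

lemma zero_in_eigenspace: "(\<lambda>_. 0) \<in> eigenspace X Y Z lam"
proof -
  have l: "lvf W (\<lambda>_. 0) = (\<lambda>_. 0)" for W by (simp add: lvf_def fun_eq_iff)
  have i: "iter_lvf Ws (\<lambda>_. 0) = (\<lambda>_. 0)" for Ws by (induction Ws) (simp_all add: iter_lvf_def l)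
  show ?thesis by (auto simp: eigenspace_def smooth_SU2_def laplacian_def l i fun_eq_iff)
qed

text \<open>In every degree where some eigenfunction has a nonzero coefficient, \<open>lam\<close>
  is a root of the characteristic polynomial. Nonzero resultants allow at most one such degree, the
  same for the whole eigenspace, and completeness provides one.\<close>

lemma eigenfunction_fourier_support:
  assumes g: "(X, Y, Z) \<in> generic_tris" and E: "eigenspace X Y Z lam \<noteq> {\<lambda>_. 0}"
  obtains n \<xi> where "\<xi> \<in> carrier_vec (Suc n)" "\<xi> \<noteq> 0\<^sub>v (Suc n)" "(lap_mat n (X, Y, Z))\<^sup>T *\<^sub>v \<xi> = of_real lam \<cdot>\<^sub>v \<xi>"
    "\<forall>f\<in>eigenspace X Y Z lam. \<forall>m i j. m \<noteq> n \<longrightarrow> i \<le> m \<longrightarrow> j \<le> m \<longrightarrow> fourier m f i j = 0"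
proof -
  have XYZ: "X \<in> su2" "Y \<in> su2" "Z \<in> su2" and gf: "generic_fun m n (X, Y, Z) \<noteq> 0" for m n
    using g by (auto simp: generic_tris_def)
  obtain f where f: "f \<in> eigenspace X Y Z lam" "f \<noteq> (\<lambda>_. 0)"
    using E zero_in_eigenspace by blast
  have sf: "smooth_SU2 f" using f by (simp add: eigenspace_def)
  note s = smooth_SU2D(1,2)[OF sf]
  obtain y where "f y \<noteq> 0" using f(2) by blast
  then have y: "y \<in> SU2" "complex_of_real (f y) \<noteq> 0" using s(1) by auto
  have "\<exists>n j k. j \<le> n \<and> k \<le> n \<and> fourier n f j k \<noteq> 0"
  proof (rule ccontr)
    assume "\<not> ?thesis"
    then have 0: "(LINT x|haar. complex_of_real (f x) * sym_rep n x $$ (j, k)) = 0" if "j \<le> n" "k \<le> n" for n j k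
      using that unfolding fourier_def by blast
    have "continuous_on SU2 (\<lambda>x. complex_of_real (f x))" by (intro continuous_intros s(2))
    from sym_rep_complete[OF this 0 y(1)] have "complex_of_real (f y) = 0" by simp
    then show False using y by simp
  qed
  then obtain n j k where jk: "j \<le> n" "k \<le> n" "fourier n f j k \<noteq> 0" by blast
  have root: "poly (char_poly (lap_mat m (X, Y, Z))) (of_real lam) = 0"
    if "h \<in> eigenspace X Y Z lam" "i \<le> m" "j \<le> m" "fourier m h i j \<noteq> 0" for h m i j
  proof -
    have "fourier_row m h i $ j \<noteq> 0\<^sub>v (Suc m) $ j" using that by (simp add: fourier_row_index)
    then have "fourier_row m h i \<noteq> 0\<^sub>v (Suc m)" by auto
    then show ?thesis
      by (rule transpose_eigenvector_root[OF lap_mat_carrier fourier_row_carrier _ fourier_row_eigenvector[OF that(1) XYZ that(2)]])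
  qed
  have "fourier m h i l = 0" if "h \<in> eigenspace X Y Z lam" "m \<noteq> n" "i \<le> m" "l \<le> m" for h m i l
  proof (rule ccontr)
    assume "fourier m h i l \<noteq> 0"
    then have "resultant (char_poly (lap_mat m (X, Y, Z))) (char_poly (lap_mat n (X, Y, Z))) = 0"
      by (rule resultant_common_root[OF char_poly_nonzero[OF lap_mat_carrier] root[OF that(1,3,4)] root[OF f(1) jk]])
    then show False using gf[of m n] that(2) by (simp add: generic_fun_def)
  qed
  moreover have "fourier_row n f j \<noteq> 0\<^sub>v (Suc n)"
  proof
    assume "fourier_row n f j = 0\<^sub>v (Suc n)"
    then have "fourier_row n f j $ k = 0" using jk by simp
    then show False using jk by (simp add: fourier_row_index)
  qed
  ultimately show thesis
    using that[of "fourier_row n f j" n] fourier_row_eigenvector[OF f(1) XYZ jk(1)] by simp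
qed

text \<open>If all rows lie in the span of \<open>u\<close> and \<open>v\<close>, the matrix of
  Fourier coefficients factors; the coefficients along the rows, scaled by the inversion constant,
  are the entries of \<open>w\<close> and \<open>w'\<close>.\<close>

lemma mcoeff_fourier:
  assumes f: "smooth_SU2 f" and 0: "\<And>m i j. m \<noteq> n \<Longrightarrow> i \<le> m \<Longrightarrow> j \<le> m \<Longrightarrow> fourier m f i j = 0"
    and row: "\<And>i. i \<le> n \<Longrightarrow> fourier_row n f i = a i \<cdot>\<^sub>v u + b i \<cdot>\<^sub>v v"
    and uv: "u \<in> carrier_vec (Suc n)" "v \<in> carrier_vec (Suc n)"
  shows "\<exists>w\<in>carrier_vec (Suc n). \<exists>w'\<in>carrier_vec (Suc n). \<forall>x\<in>SU2. of_real (f x) = mcoeff n u w x + mcoeff n v w' x"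
proof -
  let ?c = "of_nat (Suc n) / complex_of_real (measure haar SU2)"
  let ?w = "vec (Suc n) (\<lambda>i. ?c * a i)" and ?w' = "vec (Suc n) (\<lambda>i. ?c * b i)"
  have "of_real (f x) = mcoeff n u ?w x + mcoeff n v ?w' x" if x: "x \<in> SU2" for x
  proof -
    have r: "fourier n f i j = a i * u $ j + b i * v $ j" if "i \<le> n" "j \<le> n" for i j
      using arg_cong[OF row[OF that(1)], of "\<lambda>u. u $ j"] that uv by (simp add: fourier_row_index)
    have "of_real (f x) = ?c * (\<Sum>j\<le>n. \<Sum>i\<le>n. fourier n f i j * sym_rep n (cadj x) $$ (j, i))"
      by (rule fourier_inversion[OF smooth_SU2D(2)[OF f] 0 x])
    also have "\<dots> = mcoeff n u ?w x + mcoeff n v ?w' x"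
      unfolding mcoeff_def sum.distrib[symmetric] sum_distrib_left
      by (intro sum.cong refl) (simp add: r algebra_simps del: sym_rep_index)
    finally show ?thesis .
  qed
  then show ?thesis by (intro bexI[of _ ?w] bexI[of _ ?w']) auto
qed

lemma not_real_type_odd: "odd n \<Longrightarrow> \<not> real_type (Suc n) (sym_rep n)"
proof
  assume n: "odd n" and r: "real_type (Suc n) (sym_rep n)"
  have "conj_sym n (conj_sym n v) = - v" if "v \<in> carrier_vec (Suc n)" for v
    unfolding conj_sym_twice[OF that] using n by (intro eq_vecI) auto
  then have "quaternionic_type (Suc n) (sym_rep n)"
    unfolding quaternionic_type_def using conj_linear_conj_sym by blast
  then show False using real_quaternionic_exclusive[OF is_irrep_sym_rep r] by simp
qed

text \<open>\<open>Z\<close> is the preimage of the complexification of \<open>W\<close>: real and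
  imaginary parts of the coefficient both lie in \<open>W\<close>. It is a complex subspace, so
  complex irreducibility decides, and real functions are recovered by taking real parts.\<close>

lemma complex_coefficients_irreducible:
  assumes E: "\<And>f. f \<in> E \<Longrightarrow> \<exists>w\<in>carrier_vec (Suc n). \<forall>x\<in>SU2. of_real (f x) = mcoeff n u w x"
    and off: "\<And>f x. f \<in> E \<Longrightarrow> x \<notin> SU2 \<Longrightarrow> f x = 0"
    and WE: "W \<subseteq> E" and W: "rsubspace W" and inv: "\<And>g f. g \<in> SU2 \<Longrightarrow> f \<in> W \<Longrightarrow> left_reg g f \<in> W"
  shows "W = {\<lambda>_. 0} \<or> W = E"
proof -
  have W0: "(\<lambda>_. 0) \<in> W" and Wa: "\<And>f h. f \<in> W \<Longrightarrow> h \<in> W \<Longrightarrow> (\<lambda>x. f x + h x) \<in> W"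
    and Ws: "\<And>c f. f \<in> W \<Longrightarrow> (\<lambda>x. c * f x) \<in> W"
    using W unfolding rsubspace_def by auto
  define Z where "Z = {w \<in> carrier_vec (Suc n). \<exists>f\<in>W. \<exists>h\<in>W. \<forall>x\<in>SU2. mcoeff n u w x = Complex (f x) (h x)}"
  have ZI: "w \<in> Z" if "w \<in> carrier_vec (Suc n)" "f \<in> W" "h \<in> W" "\<And>x. x \<in> SU2 \<Longrightarrow> mcoeff n u w x = Complex (f x) (h x)" for w f h
    using that unfolding Z_def by blast
  have ZE: "w \<in> Z \<Longrightarrow> (\<And>f h. w \<in> carrier_vec (Suc n) \<Longrightarrow> f \<in> W \<Longrightarrow> h \<in> W \<Longrightarrow>
      (\<And>x. x \<in> SU2 \<Longrightarrow> mcoeff n u w x = Complex (f x) (h x)) \<Longrightarrow> thesis) \<Longrightarrow> thesis" for w thesis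
    unfolding Z_def by blast
  have "csubspace (Suc n) Z"
    unfolding csubspace_def
  proof (intro conjI ballI allI)
    show "Z \<subseteq> carrier_vec (Suc n)" by (auto simp: Z_def)
    show "0\<^sub>v (Suc n) \<in> Z" by (rule ZI[OF _ W0 W0]) (auto simp: mcoeff_zero_right complex_eq_iff)
  next
    fix v w assume "v \<in> Z" "w \<in> Z"
    then obtain f h f' h' where *: "v \<in> carrier_vec (Suc n)" "w \<in> carrier_vec (Suc n)" "f \<in> W" "h \<in> W" "f' \<in> W" "h' \<in> W"
      "\<And>x. x \<in> SU2 \<Longrightarrow> mcoeff n u v x = Complex (f x) (h x)" "\<And>x. x \<in> SU2 \<Longrightarrow> mcoeff n u w x = Complex (f' x) (h' x)"
      by (elim ZE) blast
    show "v + w \<in> Z"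
      by (rule ZI[OF add_carrier_vec[OF *(1,2)] Wa[OF *(3,5)] Wa[OF *(4,6)]])
        (simp add: mcoeff_add_right[OF *(1,2)] *(7,8) complex_eq_iff)
  next
    fix c v assume "v \<in> Z"
    then obtain f h where *: "v \<in> carrier_vec (Suc n)" "f \<in> W" "h \<in> W"
      "\<And>x. x \<in> SU2 \<Longrightarrow> mcoeff n u v x = Complex (f x) (h x)" by (elim ZE) blast
    show "c \<cdot>\<^sub>v v \<in> Z"
    proof (rule ZI)
      show "c \<cdot>\<^sub>v v \<in> carrier_vec (Suc n)" using *(1) by simp
      show "(\<lambda>x. Re c * f x + (- Im c) * h x) \<in> W" "(\<lambda>x. Re c * h x + Im c * f x) \<in> W"
        by (rule Wa[OF Ws[OF *(2)] Ws[OF *(3)]], rule Wa[OF Ws[OF *(3)] Ws[OF *(2)]])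
      show "mcoeff n u (c \<cdot>\<^sub>v v) x = Complex (Re c * f x + (- Im c) * h x) (Re c * h x + Im c * f x)" if "x \<in> SU2" for x
        unfolding mcoeff_smult_right[OF *(1)] *(4)[OF that] by (simp add: complex_eq_iff)
    qed
  qed
  then have "Z = {0\<^sub>v (Suc n)} \<or> Z = carrier_vec (Suc n)"
  proof (rule is_irrepD(3)[OF is_irrep_sym_rep])
    fix g v assume g: "g \<in> SU2" and "v \<in> Z"
    then obtain f h where *: "v \<in> carrier_vec (Suc n)" "f \<in> W" "h \<in> W"
      "\<And>x. x \<in> SU2 \<Longrightarrow> mcoeff n u v x = Complex (f x) (h x)" by (elim ZE) blast
    show "sym_rep n g *\<^sub>v v \<in> Z"
      by (rule ZI[OF mult_mat_vec_carrier[OF sym_rep_carrier *(1)] inv[OF g *(2)] inv[OF g *(3)]])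
        (simp add: mcoeff_left_translate[OF *(1)] left_reg_def *(4) g SU2_mult_left_iff)
  qed
  then show ?thesis
  proof
    assume Z: "Z = {0\<^sub>v (Suc n)}"
    have "f = (\<lambda>_. 0)" if f: "f \<in> W" for f
    proof -
      have fE: "f \<in> E" using f WE by blast
      obtain w where w: "w \<in> carrier_vec (Suc n)" "\<And>x. x \<in> SU2 \<Longrightarrow> of_real (f x) = mcoeff n u w x"
        using E[OF fE] by blast
      \<comment> \<open>A real function has imaginary part 0, which belongs to
        \<open>W\<close>.\<close>
      have "w \<in> Z" by (rule ZI[OF w(1) f W0]) (simp add: w(2)[symmetric] complex_eq_iff)
      then have "w = 0\<^sub>v (Suc n)" using Z by simp
      then have "f x = 0" if "x \<in> SU2" for x using w(2)[OF that] by (simp add: mcoeff_zero_right)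
      then show ?thesis using off[OF fE] by (intro ext) blast
    qed
    then show ?thesis using W0 by blast
  next
    assume Z: "Z = carrier_vec (Suc n)"
    have "f \<in> W" if f: "f \<in> E" for f
    proof -
      obtain w where w: "w \<in> carrier_vec (Suc n)" "\<And>x. x \<in> SU2 \<Longrightarrow> of_real (f x) = mcoeff n u w x"
        using E[OF f] by blast
      then have "w \<in> Z" using Z by simp
      then obtain f' h where *: "f' \<in> W" "\<And>x. x \<in> SU2 \<Longrightarrow> mcoeff n u w x = Complex (f' x) (h x)" by (elim ZE) blast
      have "f x = f' x" for x
      proof (cases "x \<in> SU2")
        case True
        then show ?thesis using arg_cong[OF w(2)[OF True], of Re] *(2)[OF True] by simp
      next
        case False
        then show ?thesis using off[OF f] off[of f'] *(1) WE by auto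
      qed
      then have "f = f'" by (rule ext)
      then show ?thesis using *(1) by simp
    qed
    then show ?thesis using WE by blast
  qed
qed

text \<open>Here functions are real parts of coefficients, so the preimage of \<open>W\<close> is
  only a real subspace of the representation. Odd degree excludes real type, which makes the
  representation irreducible over the reals as well.\<close>

lemma real_coefficients_irreducible:
  assumes E: "\<And>f. f \<in> E \<Longrightarrow> \<exists>w\<in>carrier_vec (Suc n). \<forall>x\<in>SU2. f x = Re (mcoeff n u w x)"
    and n: "odd n" and off: "\<And>f x. f \<in> E \<Longrightarrow> x \<notin> SU2 \<Longrightarrow> f x = 0"
    and WE: "W \<subseteq> E" and W: "rsubspace W" and inv: "\<And>g f. g \<in> SU2 \<Longrightarrow> f \<in> W \<Longrightarrow> left_reg g f \<in> W"
  shows "W = {\<lambda>_. 0} \<or> W = E"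
proof -
  have W0: "(\<lambda>_. 0) \<in> W" and Wa: "\<And>f h. f \<in> W \<Longrightarrow> h \<in> W \<Longrightarrow> (\<lambda>x. f x + h x) \<in> W"
    and Ws: "\<And>c f. f \<in> W \<Longrightarrow> (\<lambda>x. c * f x) \<in> W"
    using W unfolding rsubspace_def by auto
  define \<phi> where "\<phi> w = (\<lambda>x. if x \<in> SU2 then Re (mcoeff n u w x) else 0)" for w
  have E: "\<exists>w\<in>carrier_vec (Suc n). f = \<phi> w" if f: "f \<in> E" for f
  proof -
    obtain w where "w \<in> carrier_vec (Suc n)" "\<forall>x\<in>SU2. f x = Re (mcoeff n u w x)" using E[OF f] by blast
    then show ?thesis using off[OF f] by (intro bexI[of _ w]) (auto simp: \<phi>_def)
  qed
  have \<phi>0: "\<phi> (0\<^sub>v (Suc n)) = (\<lambda>_. 0)" by (auto simp: \<phi>_def mcoeff_zero_right)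
  define Z where "Z = {w \<in> carrier_vec (Suc n). \<phi> w \<in> W}"
  have "Z = {0\<^sub>v (Suc n)} \<or> Z = carrier_vec (Suc n)"
  proof (rule real_subspace_irreducible[OF is_irrep_sym_rep not_real_type_odd[OF n]])
    show "Z \<subseteq> carrier_vec (Suc n)" by (auto simp: Z_def)
    show "0\<^sub>v (Suc n) \<in> Z" using W0 by (simp add: Z_def \<phi>0)
  next
    fix v w assume "v \<in> Z" "w \<in> Z"
    then have *: "v \<in> carrier_vec (Suc n)" "w \<in> carrier_vec (Suc n)" "\<phi> v \<in> W" "\<phi> w \<in> W" by (auto simp: Z_def)
    have "\<phi> (v + w) = (\<lambda>x. \<phi> v x + \<phi> w x)" by (auto simp: \<phi>_def mcoeff_add_right[OF *(1,2)])
    then show "v + w \<in> Z" using * Wa[OF *(3,4)] by (simp add: Z_def)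
  next
    fix c :: real and v assume "v \<in> Z"
    then have *: "v \<in> carrier_vec (Suc n)" "\<phi> v \<in> W" by (auto simp: Z_def)
    have "\<phi> (of_real c \<cdot>\<^sub>v v) = (\<lambda>x. c * \<phi> v x)" by (auto simp: \<phi>_def mcoeff_smult_right[OF *(1)])
    then show "of_real c \<cdot>\<^sub>v v \<in> Z" using * Ws[OF *(2), of c] by (simp add: Z_def)
  next
    fix g v assume g: "g \<in> SU2" and "v \<in> Z"
    then have *: "v \<in> carrier_vec (Suc n)" "\<phi> v \<in> W" by (auto simp: Z_def)
    have "\<phi> (sym_rep n g *\<^sub>v v) = left_reg g (\<phi> v)"
      by (auto simp: \<phi>_def left_reg_def mcoeff_left_translate[OF *(1)] SU2_mult_left_iff[OF SU2_cadj[OF g]])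
    then show "sym_rep n g *\<^sub>v v \<in> Z"
      using inv[OF g *(2)] mult_mat_vec_carrier[OF sym_rep_carrier *(1)] by (simp add: Z_def)
  qed
  then show ?thesis
  proof
    assume Z: "Z = {0\<^sub>v (Suc n)}"
    have "f = (\<lambda>_. 0)" if f: "f \<in> W" for f
    proof -
      obtain w where w: "w \<in> carrier_vec (Suc n)" "f = \<phi> w" using E f WE by blast
      then have "w \<in> Z" using f by (simp add: Z_def)
      then show ?thesis using Z w(2) \<phi>0 by simp
    qed
    then show ?thesis using W0 by blast
  next
    assume Z: "Z = carrier_vec (Suc n)"
    have "f \<in> W" if f: "f \<in> E" for f
    proof -
      obtain w where w: "w \<in> carrier_vec (Suc n)" "f = \<phi> w" using E[OF f] by blast
      then have "w \<in> Z" using Z by simp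
      then show ?thesis using w(2) by (simp add: Z_def)
    qed
    then show ?thesis using WE by blast
  qed
qed

theorem generic_irreducible_real_eigenspaces:
  assumes g: "(X, Y, Z) \<in> generic_tris"
  shows "irreducible_real_eigenspaces X Y Z"
  unfolding irreducible_real_eigenspaces_def
proof (intro allI impI, elim conjE)
  fix lam W
  let ?E = "eigenspace X Y Z lam"
  assume E: "?E \<noteq> {\<lambda>_. 0}" and WE: "W \<subseteq> ?E" and W: "rsubspace W" and inv: "\<forall>g\<in>SU2. \<forall>f\<in>W. left_reg g f \<in> W"
  have XYZ: "X \<in> su2" "Y \<in> su2" "Z \<in> su2" and gf: "generic_fun n n (X, Y, Z) \<noteq> 0" for n
    using g by (auto simp: generic_tris_def)
  obtain n \<xi> where \<xi>: "\<xi> \<in> carrier_vec (Suc n)" "\<xi> \<noteq> 0\<^sub>v (Suc n)" "(lap_mat n (X, Y, Z))\<^sup>T *\<^sub>v \<xi> = of_real lam \<cdot>\<^sub>v \<xi>"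
    and F': "\<forall>f\<in>?E. \<forall>m i j. m \<noteq> n \<longrightarrow> i \<le> m \<longrightarrow> j \<le> m \<longrightarrow> fourier m f i j = 0"
    by (rule eigenfunction_fourier_support[OF g E]) (rule that)
  have F: "fourier m f i j = 0" if "f \<in> ?E" "m \<noteq> n" "i \<le> m" "j \<le> m" for f m i j
    using F' that by blast
  let ?A = "lap_mat n (X, Y, Z)"
  have sm: "smooth_SU2 f" if "f \<in> ?E" for f using that by (simp add: eigenspace_def)
  have off: "f x = 0" if "f \<in> ?E" "x \<notin> SU2" for f x by (rule smooth_SU2D(1)[OF sm[OF that(1)] that(2)])
  have invW: "left_reg g f \<in> W" if "g \<in> SU2" "f \<in> W" for g f using inv that by blast
  have At: "?A\<^sup>T \<in> carrier_mat (Suc n) (Suc n)" by simp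
  have cp: "char_poly (?A\<^sup>T) = char_poly ?A" by (rule char_poly_transpose_mat[OF lap_mat_carrier])
  note cr = resultant_common_root[OF char_poly_nonzero[OF lap_mat_carrier]]
  note row = fourier_row_eigenvector[OF _ XYZ]
  show "W = {\<lambda>_. 0} \<or> W = ?E"
  proof (cases "even n")
    case True
    have "\<exists>w\<in>carrier_vec (Suc n). \<forall>x\<in>SU2. of_real (f x) = mcoeff n \<xi> w x" if f: "f \<in> ?E" for f
    proof -
      have simple: "\<not> (poly (char_poly (?A\<^sup>T)) (of_real lam) = 0 \<and> poly (pderiv (char_poly (?A\<^sup>T))) (of_real lam) = 0)"
      proof -
        have "resultant (char_poly ?A) (pderiv (char_poly ?A)) \<noteq> 0" using gf[of n] True by (simp add: generic_fun_def)
        then show ?thesis unfolding cp using cr by blast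
      qed
      have "\<exists>a. fourier_row n f i = a \<cdot>\<^sub>v \<xi>" if "i \<le> n" for i
        by (rule simple_root_eigenspace[OF At simple \<xi>(1,3,2) fourier_row_carrier row[OF f that]])
      then obtain a where a: "\<And>i. i \<le> n \<Longrightarrow> fourier_row n f i = a i \<cdot>\<^sub>v \<xi>" by metis
      \<comment> \<open>Padding to the two-vector form of \<open>mcoeff_fourier\<close>; both
        resulting coefficients use \<xi>, so their right vectors can be added.\<close>
      have "fourier_row n f i = a i \<cdot>\<^sub>v \<xi> + 0 \<cdot>\<^sub>v \<xi>" if "i \<le> n" for i
        unfolding a[OF that] using \<xi>(1) by (intro eq_vecI) auto
      from mcoeff_fourier[OF sm[OF f] F[OF f] this \<xi>(1) \<xi>(1)]
      obtain w w' where "w \<in> carrier_vec (Suc n)" "w' \<in> carrier_vec (Suc n)" "\<forall>x\<in>SU2. of_real (f x) = mcoeff n \<xi> w x + mcoeff n \<xi> w' x"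
        by blast
      then show ?thesis by (intro bexI[of _ "w + w'"]) (auto simp: mcoeff_add_right)
    qed
    then show ?thesis
      by (rule complex_coefficients_irreducible[of ?E n \<xi> W, OF _ _ WE W]) (assumption, fact off, fact invW)
  next
    case False
    have tt: "twist n (twist n v) = (- 1) \<cdot>\<^sub>v v" if "v \<in> carrier_vec (Suc n)" for v
      using twist_twist[OF that] False by simp
    obtain r where r: "r < Suc n" "\<xi> $ r \<noteq> 0" using nonzero_vec_index[OF \<xi>(1,2)] .
    \<comment> \<open>If the twist of \<xi> were a multiple a of \<xi>, twisting again would give
      |a|^2 = -1.\<close>
    have ind: "twist n \<xi> \<noteq> a \<cdot>\<^sub>v \<xi>" for a
    proof
      assume a: "twist n \<xi> = a \<cdot>\<^sub>v \<xi>"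
      have "(- 1) \<cdot>\<^sub>v \<xi> = twist n (twist n \<xi>)" by (rule tt[OF \<xi>(1), symmetric])
      also have "\<dots> = twist n (a \<cdot>\<^sub>v \<xi>)" by (simp only: a)
      also have "\<dots> = cnj a \<cdot>\<^sub>v twist n \<xi>" by (rule twist_smult[OF \<xi>(1)])
      also have "\<dots> = (cnj a * a) \<cdot>\<^sub>v \<xi>" by (simp only: a smult_smult_assoc)
      finally have eq: "(- 1) \<cdot>\<^sub>v \<xi> = (cnj a * a) \<cdot>\<^sub>v \<xi>" .
      have "- 1 * \<xi> $ r = cnj a * a * \<xi> $ r" using arg_cong[OF eq, of "\<lambda>v. v $ r"] r(1) \<xi>(1) by simp
      then have "- 1 = cnj a * a" using r(2) unfolding mult_cancel_right by blast
      from arg_cong[OF this, of Re] have "- 1 = Re (cnj a * a)" by (simp only: uminus_complex.sel one_complex.sel)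
      moreover have "Re (cnj a * a) \<ge> 0" by simp
      ultimately show False by linarith
    qed
    have "\<exists>w\<in>carrier_vec (Suc n). \<forall>x\<in>SU2. f x = Re (mcoeff n \<xi> w x)" if f: "f \<in> ?E" for f
    proof -
      have double: "\<not> (poly (char_poly (?A\<^sup>T)) (of_real lam) = 0 \<and> poly (pderiv (pderiv (char_poly (?A\<^sup>T)))) (of_real lam) = 0)"
      proof -
        have "resultant (char_poly ?A) (pderiv (pderiv (char_poly ?A))) \<noteq> 0" using gf[of n] False by (simp add: generic_fun_def)
        then show ?thesis unfolding cp using cr by blast
      qed
      have "\<exists>a b. fourier_row n f i = a \<cdot>\<^sub>v \<xi> + b \<cdot>\<^sub>v twist n \<xi>" if "i \<le> n" for i
        by (rule double_root_eigenspace[OF At double \<xi>(1,3,2) twist_carrier twist_eigenvector[OF XYZ \<xi>(1,3)] ind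
              fourier_row_carrier row[OF f that]])
      then obtain a b where "\<And>i. i \<le> n \<Longrightarrow> fourier_row n f i = a i \<cdot>\<^sub>v \<xi> + b i \<cdot>\<^sub>v twist n \<xi>" by metis
      from mcoeff_fourier[OF sm[OF f] F[OF f] this \<xi>(1) twist_carrier]
      obtain w w' where w: "w \<in> carrier_vec (Suc n)" "w' \<in> carrier_vec (Suc n)"
        "\<And>x. x \<in> SU2 \<Longrightarrow> of_real (f x) = mcoeff n \<xi> w x + mcoeff n (twist n \<xi>) w' x"
        by blast
      \<comment> \<open>The twist has square -1, so \<open>w'\<close> is the twist of
        \<open>?v\<close>, and the second summand is the conjugate of the coefficient of \<xi> and
        \<open>?v\<close>. As \<open>f\<close> is real, taking real parts merges both summands into
        a coefficient of \<xi> alone.\<close>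
      let ?v = "(- 1) \<cdot>\<^sub>v twist n w'"
      have tv: "twist n ?v = w'"
        unfolding twist_smult[OF twist_carrier] tt[OF w(2)] using w(2) by (intro eq_vecI) auto
      have "f x = Re (mcoeff n \<xi> (w + ?v) x)" if x: "x \<in> SU2" for x
      proof -
        have "of_real (f x) = mcoeff n \<xi> w x + cnj (mcoeff n \<xi> ?v x)"
          unfolding w(3)[OF x] cnj_mcoeff[OF x] tv ..
        from arg_cong[OF this, of Re] show ?thesis using w by (simp add: mcoeff_add_right)
      qed
      then show ?thesis using w by (intro bexI[of _ "w + ?v"]) auto
    qed
    then show ?thesis
      by (rule real_coefficients_irreducible[of ?E n \<xi> W, OF _ False _ WE W]) (assumption, fact off, fact invW)
  qed
qed

theorem theorem4p1:
  shows
   "(\<forall>d \<rho> d' \<sigma>. is_irrep d \<rho> \<and> is_irrep d' \<sigma> \<and> \<not> rep_iso d \<rho> d' \<sigma> \<and>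
        \<not> rep_iso d (dual_rep \<rho>) d' \<sigma> \<longrightarrow>
        (\<exists>s\<in>sym2_su2. resultant (p_poly d \<rho> s) (p_poly d' \<sigma> s) \<noteq> 0)) \<and>
    (\<forall>d \<rho>. is_irrep d \<rho> \<and> (real_type d \<rho> \<or> complex_type d \<rho>) \<longrightarrow>
        (\<exists>s\<in>sym2_su2. resultant (p_poly d \<rho> s) (pderiv (p_poly d \<rho> s)) \<noteq> 0)) \<and>
    (\<forall>d \<rho>. is_irrep d \<rho> \<and> quaternionic_type d \<rho> \<longrightarrow>
        (\<exists>s\<in>sym2_su2. resultant (p_poly d \<rho> s) (pderiv (pderiv (p_poly d \<rho> s))) \<noteq> 0)) \<and>
    (\<exists>R. residual_in (su2 \<times> su2 \<times> su2) R \<and>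
        (\<forall>(X1, X2, X3) \<in> R. is_basis_su2 X1 X2 X3 \<and> irreducible_real_eigenspaces X1 X2 X3))"
proof (intro conjI)
  have "is_basis_su2 X1 X2 X3 \<and> irreducible_real_eigenspaces X1 X2 X3" if "(X1, X2, X3) \<in> generic_tris" for X1 X2 X3
    using that tri_det_basis generic_irreducible_real_eigenspaces[OF that] by (auto simp: generic_tris_def)
  then show "\<exists>R. residual_in (su2 \<times> su2 \<times> su2) R \<and>
      (\<forall>(X1, X2, X3) \<in> R. is_basis_su2 X1 X2 X3 \<and> irreducible_real_eigenspaces X1 X2 X3)"
    using residual_generic_tris by blast
qed (use SU2_condition_a SU2_condition_b SU2_condition_c in blast)+

end
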